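(* Let $N=2$, $k>0$, $f(u)=(1+u)^p$, $V_k(r)=\dfrac{1}{r^2(-\log(r/e))^{2+k}}$. Let $p_s:=k+1$, $p_c:=2k+1$ and $$p^+_{\mathrm{JL}}:=\begin{cases}1+\dfrac{2k}{1-k-\sqrt{k(k+2)}}& k<\frac14,\\ \infty& k\ge\frac14.\end{cases}$$ Then the bifurcation diagram of $$-\Delta u=\lambda V_k(|x|)f(u)\ \text{ in } B_1,\qquad u>0\ \text{ in } B_1,\qquad u=0\ \text{ on }\partial B_1 \qquad (P)$$ is of (i) Type 0 if $p_s<p\le p_c$; (ii) Type I if $p_c<p<p^+_{\mathrm{JL}}$; (iii) Type II if $p\ge p^+_{\mathrm{JL}}$. Moreover, $\lambda$ is globally parameterized by $\alpha$ if $p_s<p\le p_c$ or $p\ge p^+_{\mathrm{JL}}$.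
   Context: $B_1\subset\mathbb{R}^2$ is the open unit ball. A radial solution of $(P)$ is a pair $(\lambda,u)$ with $\lambda>0$, $u$ radial, continuous on $[0,1]$ in $r=|x|$, $C^2$ on $(0,1]$, satisfying $(P)$ (the equation pointwise for $0<r<1$). For $p>p_s$ there is $\beta^*\in(0,\infty]$ (with $\beta^*=\infty$ if $p\ge p_c$ and $\beta^*<\infty$ if $p<p_c$) such that $\beta:=\lambda^{1/(p-1)}(u(0)+1)$ takes values in $(0,\beta^* )$ for all radial solutions, and for every $\beta\in(0,\beta^* )$ there is exactly one radial solution with that value; denote its $\lambda$ by $\lambda(\beta)$ and set $\alpha(\beta):=u(0)=\lVert u\rVert_{L^\infty(B_1)}=\lambda(\beta)^{-1/(p-1)}\beta-1$. The bifurcation curve is $\{(\lambda(\beta),\alpha(\beta));\beta\in(0,\beta^* )\}$; it is a real analytic unbounded curve emanating from $(0,0)$ (the limit as $\beta\to0^+$). A point $(\lambda(\beta),\alpha(\beta))$ is a turning point if $\beta$ is a local extremum point of $\lambda(\cdot)$. Type 0: there is $\lambda^*>0$ such that the curve emanating from $(0,0)$ goes to $\lambda=\lambda^*$, bends back at $\lambda^*$, and then converges to $\lambda=0$ monotonically as $\alpha\to\infty$ (that is, along the curve $\lambda$ first increases from $0$ to $\lambda^*$ and then decreases to $0$). Type I: the curve emanating from $(0,0)$ turns infinitely many times around $\lambda=\lambda_*$ for some $\lambda_*>0$ (that is, $\lambda(\beta)-\lambda_*$ changes sign infinitely many times, giving infinitely many turning points), and the curve converges to $\lambda=\lambda_*$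 as $\alpha\to\infty$. Type II: the curve emanating from $(0,0)$ converges monotonically to $\lambda=\lambda_*$ for some $\lambda_*>0$ as $\alpha\to\infty$ (that is, $\lambda(\beta)$ is monotone along the curve, with no turning points). "$\lambda$ is globally parameterized by $\alpha$" means that the whole curve is the graph of a function $\alpha\mapsto\lambda$. *)

theory Defs
  imports "HOL-Analysis.Analysis"
begin

definition laplacian :: "('a::euclidean_space \<Rightarrow> real) \<Rightarrow> 'a \<Rightarrow> real" where
  "laplacian f x = (\<Sum>b\<in>Basis. (deriv ^^ 2) (\<lambda>t. f (x + t *\<^sub>R b)) 0)"

text \<open>Derivatives are relative to \<open>S\<close>, hence one-sided at a boundary point of an interval.\<close>

definition C2_on :: "real set \<Rightarrow> (real \<Rightarrow> real) \<Rightarrow> bool" where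
  "C2_on S u \<longleftrightarrow> (\<exists>u' u''. (\<forall>r\<in>S. (u has_real_derivative u' r) (at r within S)) \<and>
      (\<forall>r\<in>S. (u' has_real_derivative u'' r) (at r within S)) \<and> continuous_on S u'')"

definition weight :: "real \<Rightarrow> real \<Rightarrow> real" where
  "weight k r = 1 / (r\<^sup>2 * (- ln (r / exp 1)) powr (2 + k))"

definition p_s :: "real \<Rightarrow> real" where
  "p_s k = k + 1"

definition p_c :: "real \<Rightarrow> real" where
  "p_c k = 2 * k + 1"

definition p_JL :: "real \<Rightarrow> ereal" where
  "p_JL k = (if k < 1 / 4 then ereal (1 + 2 * k / (1 - k - sqrt (k * (k + 2)))) else \<infinity>)"

text \<open>A radial function on the closed unit disc is given by its profile \<open>u\<close> on \<open>{0..1}\<close>;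
  the values of \<open>u\<close> outside this interval are irrelevant. The weight is singular at the origin,
  so the equation is imposed on the punctured disc only.\<close>

definition radial_solution :: "real \<Rightarrow> real \<Rightarrow> real \<Rightarrow> (real \<Rightarrow> real) \<Rightarrow> bool" where
  "radial_solution k p l u \<longleftrightarrow>
     l > 0 \<and> continuous_on {0..1} u \<and> C2_on {0<..1} u \<and>
     (\<forall>x::real^2. x \<in> ball 0 1 \<and> x \<noteq> 0 \<longrightarrow>
        - laplacian (\<lambda>y. u (norm y)) x = l * weight k (norm x) * (1 + u (norm x)) powr p) \<and>
     (\<forall>x::real^2. x \<in> ball 0 1 \<longrightarrow> u (norm x) > 0) \<and>
     (\<forall>x::real^2. x \<in> sphere 0 1 \<longrightarrow> u (norm x) = 0)"

definition solution_at :: "real \<Rightarrow> real \<Rightarrow> real \<Rightarrow> real \<Rightarrow> (real \<Rightarrow> real) \<Rightarrow> bool" where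
  "solution_at k p \<beta> l u \<longleftrightarrow> radial_solution k p l u \<and> \<beta> = l powr (1 / (p - 1)) * (u 0 + 1)"

definition beta_star :: "real \<Rightarrow> real \<Rightarrow> ereal" where
  "beta_star k p = Sup {ereal \<beta> | \<beta>. \<exists>l u. solution_at k p \<beta> l u}"

definition beta_dom :: "real \<Rightarrow> real \<Rightarrow> real set" where
  "beta_dom k p = {\<beta>. 0 < \<beta> \<and> ereal \<beta> < beta_star k p}"

text \<open>The parameter \<open>\<beta>\<close> runs exactly through \<open>beta_dom\<close>, and each value belongs to exactly one
  solution. This is what makes the two definite descriptions below meaningful.\<close>

definition well_parameterized :: "real \<Rightarrow> real \<Rightarrow> bool" where
  "well_parameterized k p \<longleftrightarrow> 0 < beta_star k p \<and>
     (\<forall>\<beta> l u. solution_at k p \<beta> l u \<longrightarrow> \<beta> \<in> beta_dom k p) \<and>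
     (\<forall>\<beta>\<in>beta_dom k p. \<exists>l u. solution_at k p \<beta> l u \<and>
        (\<forall>l' u'. solution_at k p \<beta> l' u' \<longrightarrow> l' = l \<and> (\<forall>r\<in>{0..1}. u' r = u r)))"

definition lam :: "real \<Rightarrow> real \<Rightarrow> real \<Rightarrow> real" where
  "lam k p \<beta> = (THE l. \<exists>u. solution_at k p \<beta> l u)"

definition alpha :: "real \<Rightarrow> real \<Rightarrow> real \<Rightarrow> real" where
  "alpha k p \<beta> = (THE a. \<exists>l u. solution_at k p \<beta> l u \<and> a = u 0)"

definition bif_curve :: "real \<Rightarrow> real \<Rightarrow> (real \<times> real) set" where
  "bif_curve k p = {(lam k p \<beta>, alpha k p \<beta>) | \<beta>. \<beta> \<in> beta_dom k p}"

text \<open>The filter \<open>\<beta> \<rightarrow> \<beta>\<^sup>*\<close> from below.\<close>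

definition curve_end :: "real \<Rightarrow> real \<Rightarrow> real filter" where
  "curve_end k p =
     (if beta_star k p = \<infinity> then at_top else at_left (real_of_ereal (beta_star k p)))"

definition emanates_from_origin :: "real \<Rightarrow> real \<Rightarrow> bool" where
  "emanates_from_origin k p \<longleftrightarrow>
     (lam k p \<longlongrightarrow> 0) (at_right 0) \<and> (alpha k p \<longlongrightarrow> 0) (at_right 0)"

text \<open>Along the curve towards its other end, \<open>\<alpha> \<rightarrow> \<infinity>\<close> and \<open>\<lambda> \<rightarrow> L\<close>.\<close>

definition converges_to :: "real \<Rightarrow> real \<Rightarrow> real \<Rightarrow> bool" where
  "converges_to k p L \<longleftrightarrow>
     filterlim (alpha k p) at_top (curve_end k p) \<and> (lam k p \<longlongrightarrow> L) (curve_end k p)"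

definition local_extremum :: "(real \<Rightarrow> real) \<Rightarrow> real \<Rightarrow> bool" where
  "local_extremum f x \<longleftrightarrow>
     (\<forall>\<^sub>F y in nhds x. f y \<le> f x) \<or> (\<forall>\<^sub>F y in nhds x. f x \<le> f y)"

definition turning_points :: "real \<Rightarrow> real \<Rightarrow> (real \<times> real) set" where
  "turning_points k p =
     {(lam k p \<beta>, alpha k p \<beta>) | \<beta>. \<beta> \<in> beta_dom k p \<and> local_extremum (lam k p) \<beta>}"

definition changes_sign_infinitely_often :: "(real \<Rightarrow> real) \<Rightarrow> real set \<Rightarrow> bool" where
  "changes_sign_infinitely_often f D \<longleftrightarrow>
     (\<exists>b::nat \<Rightarrow> real. strict_mono b \<and> range b \<subseteq> D \<and> (\<forall>n. f (b n) * f (b (Suc n)) < 0))"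

definition type_0 :: "real \<Rightarrow> real \<Rightarrow> bool" where
  "type_0 k p \<longleftrightarrow> emanates_from_origin k p \<and>
     (\<exists>ls>0. \<exists>\<beta>0\<in>beta_dom k p. lam k p \<beta>0 = ls \<and>
        strict_mono_on {\<beta>\<in>beta_dom k p. \<beta> \<le> \<beta>0} (lam k p) \<and>
        strict_antimono_on {\<beta>\<in>beta_dom k p. \<beta>0 \<le> \<beta>} (lam k p)) \<and>
     converges_to k p 0"

definition type_I :: "real \<Rightarrow> real \<Rightarrow> bool" where
  "type_I k p \<longleftrightarrow> emanates_from_origin k p \<and>
     (\<exists>ls>0. changes_sign_infinitely_often (\<lambda>\<beta>. lam k p \<beta> - ls) (beta_dom k p) \<and>
        infinite (turning_points k p) \<and> converges_to k p ls)"

definition type_II :: "real \<Rightarrow> real \<Rightarrow> bool" where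
  "type_II k p \<longleftrightarrow> emanates_from_origin k p \<and>
     (mono_on (beta_dom k p) (lam k p) \<or> antimono_on (beta_dom k p) (lam k p)) \<and>
     turning_points k p = {} \<and> (\<exists>ls>0. converges_to k p ls)"

definition globally_parameterized_by_alpha :: "real \<Rightarrow> real \<Rightarrow> bool" where
  "globally_parameterized_by_alpha k p \<longleftrightarrow>
     (\<exists>A g. bif_curve k p = {(g a, a) | a. a \<in> A})"

end

theory Submission
  imports Defs
begin

text \<open>With \<open>s = 1 - ln r\<close> and \<open>t = T - ln s\<close> a radial solution becomes, up to the factor \<open>u(0) + 1\<close>, an
  initial segment \<open>t \<le> T\<close> of one fixed orbit \<open>v\<close> of \<open>v'' + v' + e\<^sup>k\<^sup>t v\<^sup>p = 0\<close>, \<open>v(-\<infinity>) = 1\<close>. The solutions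
  thus correspond to the times \<open>T\<close> with \<open>v(T) > 0\<close>, and for \<open>\<theta> = k / (p - 1)\<close> one finds
  \<open>\<beta> = e\<^sup>\<theta>\<^sup>T\<close>, \<open>\<lambda> = e\<^sup>k\<^sup>T v(T)\<^sup>p\<^sup>-\<^sup>1\<close> and \<open>\<alpha> = 1 / v(T) - 1\<close>. As \<open>v\<close> is strictly decreasing, \<open>\<alpha>\<close>
  always parameterizes the curve. With \<open>q = - v' / v\<close> the pair \<open>(\<lambda>, q)\<close> solves the planar system
  \<open>\<lambda>' = (p - 1) \<lambda> (\<theta> - q)\<close>, \<open>q' = \<lambda> - q (1 - q)\<close> and leaves the origin along its unstable manifold.
  An energy is monotone along the orbit, in the sense given by the sign of \<open>\<theta> - 1/2\<close>, that is of
  \<open>p\<^sub>c - p\<close>. In the subcritical and critical case \<open>q\<close>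
  crosses \<open>\<theta>\<close> exactly once and \<open>\<lambda>\<close> returns to \<open>0\<close>; in the supercritical case the orbit converges to
  the equilibrium \<open>(\<theta> (1 - \<theta>), \<theta>)\<close>, which is a focus below the Joseph-Lundgren exponent and a node,
  approached with \<open>q < \<theta>\<close>, from that exponent on.\<close>

subsection \<open>The Laplacian of a radial function\<close>

text \<open>The thresholds can be read off from the equilibrium
  \<open>(theta * (1 - theta), theta)\<close>. It lies in the open positive quadrant because
  \<open>p > p_s\<close> means \<open>theta < 1\<close>. The linearisation there has trace
  \<open>- (1 - 2 * theta)\<close>, which changes sign at \<open>p_c\<close>, and determinant
  \<open>k * (1 - theta)\<close>; its discriminant vanishes at the Joseph-Lundgren exponent when
  that is finite. No linearisation theorem is invoked, though: convergence comes from the energy and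
  Barbalat's lemma, rotation from the growth of an angle, and the nodal case from an invariant
  triangle. Two obstacles shape the rest. A solution is only assumed continuous at the origin, so
  the logarithmic singularity, which is \<open>exp (- t)\<close> in the new time, must be excluded
  before uniqueness can be applied. And for \<open>p \<le> p_c\<close> it is never decided whether
  \<open>v\<close> reaches zero: a finite and an infinite end of the \<beta>-interval are both
  treated.\<close>

lemma radial_second_derivative:
  fixes x b :: "'a::euclidean_space" and u u' u'' :: "real \<Rightarrow> real"
  assumes b: "norm b = 1" and x: "x \<noteq> 0" "norm x < R"
    and u': "\<And>r. 0 < r \<Longrightarrow> r < R \<Longrightarrow> (u has_real_derivative u' r) (at r)"
    and u'': "(u' has_real_derivative u2) (at (norm x))"
  shows "(deriv ^^ 2) (\<lambda>t. u (norm (x + t *\<^sub>R b))) 0 =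
    u2 * ((x \<bullet> b)\<^sup>2 / (norm x)\<^sup>2) + u' (norm x) * (1 / norm x - (x \<bullet> b)\<^sup>2 / norm x ^ 3)"
proof -
  define N where "N t = norm (x + t *\<^sub>R b)" for t
  have Nsq: "N t = sqrt ((norm x)\<^sup>2 + 2 * t * (x \<bullet> b) + t\<^sup>2)" for t
    using b unfolding N_def norm_eq_sqrt_inner
    by (simp add: inner_add_left inner_add_right inner_commute power2_eq_square algebra_simps)
  have N0: "N 0 = norm x" by (simp add: N_def)
  have dN: "(N has_real_derivative ((x \<bullet> b + t) / N t)) (at t)" if "N t > 0" for t
  proof -
    have pos: "(norm x)\<^sup>2 + 2 * t * (x \<bullet> b) + t\<^sup>2 > 0"
      using that unfolding Nsq by simp
    have alg: "inverse S / 2 * (2 * c + 2 * t) = (c + t) / S" for S c :: real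
      by (cases "S = 0") (auto simp: field_simps)
    have d: "((\<lambda>t. (norm x)\<^sup>2 + 2 * t * (x \<bullet> b) + t\<^sup>2) has_real_derivative 2 * (x \<bullet> b) + 2 * t) (at t)"
      by (auto intro!: derivative_eq_intros)
    have "((\<lambda>t. sqrt ((norm x)\<^sup>2 + 2 * t * (x \<bullet> b) + t\<^sup>2)) has_real_derivative ((x \<bullet> b + t) / N t)) (at t)"
      unfolding Nsq
      by (rule DERIV_cong[OF DERIV_chain2[where f = sqrt, OF DERIV_real_sqrt[OF pos] d]], rule alg)
    moreover have "N = (\<lambda>t. sqrt ((norm x)\<^sup>2 + 2 * t * (x \<bullet> b) + t\<^sup>2))"
      using Nsq by auto
    ultimately show ?thesis by simp
  qed
  have cont: "isCont N 0" using dN[of 0] x by (auto simp: N0 intro: DERIV_isCont)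
  have ev: "\<forall>\<^sub>F t in nhds 0. 0 < N t \<and> N t < R"
    using order_tendstoD(1)[OF cont[unfolded isCont_def tendsto_at_iff_tendsto_nhds], of 0]
      order_tendstoD(2)[OF cont[unfolded isCont_def tendsto_at_iff_tendsto_nhds], of R] x N0
    by (auto intro: eventually_conj)
  \<comment> \<open>\<open>deriv\<close> is a total function, so the first derivative must be
    identified on a whole neighbourhood of 0 before it can be differentiated again.\<close>
  have d1: "\<forall>\<^sub>F t in nhds 0. deriv (\<lambda>t. u (N t)) t = u' (N t) * ((x \<bullet> b + t) / N t)"
    using ev
  proof eventually_elim
    case (elim t)
    then show ?case by (intro DERIV_imp_deriv DERIV_chain2[OF u' dN]) auto
  qed
  have "((\<lambda>t. u' (N t) * ((x \<bullet> b + t) / N t)) has_real_derivative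
     u2 * ((x \<bullet> b)\<^sup>2 / (norm x)\<^sup>2) + u' (norm x) * (1 / norm x - (x \<bullet> b)\<^sup>2 / norm x ^ 3)) (at 0)"
  proof -
    have N0': "N 0 > 0" "N 0 \<noteq> 0" using x N0 by auto
    have "((\<lambda>t. (x \<bullet> b + t) / N t) has_real_derivative
        ((0 + 1) * N 0 - (x \<bullet> b + 0) * ((x \<bullet> b + 0) / N 0)) / (N 0 * N 0)) (at 0)"
      by (intro DERIV_divide DERIV_add DERIV_const DERIV_ident dN N0')
    from DERIV_mult[OF DERIV_chain2[OF u''[folded N0] dN[OF N0'(1)]] this]
    have "((\<lambda>t. u' (N t) * ((x \<bullet> b + t) / N t)) has_real_derivative
      u2 * ((x \<bullet> b + 0) / N 0) * ((x \<bullet> b + 0) / N 0) +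
      ((0 + 1) * N 0 - (x \<bullet> b + 0) * ((x \<bullet> b + 0) / N 0)) / (N 0 * N 0) * u' (N 0)) (at 0)" .
    moreover have "u2 * ((x \<bullet> b + 0) / N 0) * ((x \<bullet> b + 0) / N 0) +
      ((0 + 1) * N 0 - (x \<bullet> b + 0) * ((x \<bullet> b + 0) / N 0)) / (N 0 * N 0) * u' (N 0) =
     u2 * ((x \<bullet> b)\<^sup>2 / (norm x)\<^sup>2) + u' (norm x) * (1 / norm x - (x \<bullet> b)\<^sup>2 / norm x ^ 3)"
      unfolding N0[symmetric] using N0'(2) by (simp add: divide_simps power2_eq_square power3_eq_cube)
    ultimately show ?thesis by simp
  qed
  then have "deriv (deriv (\<lambda>t. u (N t))) 0 =
     u2 * ((x \<bullet> b)\<^sup>2 / (norm x)\<^sup>2) + u' (norm x) * (1 / norm x - (x \<bullet> b)\<^sup>2 / norm x ^ 3)"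
    unfolding deriv_cong_ev[OF d1 refl] by (rule DERIV_imp_deriv)
  then show ?thesis by (simp add: numeral_2_eq_2 N_def)
qed

lemma laplacian_radial:
  fixes x :: "'a::euclidean_space"
    and u u' :: "real \<Rightarrow> real"
  assumes x: "x \<noteq> 0" "norm x < R"
    and u': "\<And>r. 0 < r \<Longrightarrow> r < R \<Longrightarrow> (u has_real_derivative u' r) (at r)"
    and u'': "(u' has_real_derivative u2) (at (norm x))"
  shows "laplacian (\<lambda>y. u (norm y)) x = u2 + (real DIM('a) - 1) * u' (norm x) / norm x"
proof -
  have sq: "(\<Sum>b\<in>Basis. (x \<bullet> b)\<^sup>2) = (norm x)\<^sup>2"
    unfolding power2_norm_eq_inner[of x] euclidean_inner[of x x] by (simp add: power2_eq_square)
  have "laplacian (\<lambda>y. u (norm y)) x = (\<Sum>b\<in>Basis. u2 * ((x \<bullet> b)\<^sup>2 / (norm x)\<^sup>2)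
      + u' (norm x) * (1 / norm x - (x \<bullet> b)\<^sup>2 / norm x ^ 3))"
    unfolding laplacian_def by (intro sum.cong refl radial_second_derivative[OF _ x u' u'']) auto
  also have "\<dots> = u2 * ((\<Sum>b\<in>Basis. (x \<bullet> b)\<^sup>2) / (norm x)\<^sup>2)
      + u' (norm x) * (DIM('a) / norm x - (\<Sum>b\<in>Basis. (x \<bullet> b)\<^sup>2) / norm x ^ 3)"
    by (simp add: sum.distrib sum_subtractf flip: sum_distrib_left sum_divide_distrib)
  also have "\<dots> = u2 + (real DIM('a) - 1) * u' (norm x) / norm x"
    using x unfolding sq by (simp add: field_simps power2_eq_square power3_eq_cube)
  finally show ?thesis .
qed

subsection \<open>The singular initial value problem\<close>

text \<open>The truncation makes the nonlinearity globally Lipschitz without changing it on the range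
  \<open>(0, 1)\<close> of the positive part of the orbit; hence the orbit exists for all times, also beyond its
  first zero.\<close>

definition cut_pow :: "real \<Rightarrow> real \<Rightarrow> real" where
  "cut_pow p z = (min 1 (max 0 z)) powr p"

text \<open>By the mean value theorem the slope is \<open>p * z powr (p - 1)\<close> with
  \<open>z < 1\<close>. Truncation to \<open>[0, 1]\<close> turns this into a global Lipschitz
  constant \<open>p\<close>.\<close>

lemma powr_diff_le:
  fixes a b p :: real
  assumes "0 \<le> a" "a \<le> b" "b \<le> 1" "1 \<le> p"
  shows "b powr p - a powr p \<le> p * (b - a)"
proof (cases "a = b")
  case False
  with assms have ab: "a < b" by simp
  have "continuous_on {a..b} (\<lambda>x. x powr p)"
    using assms by (intro continuous_on_powr') (auto intro: continuous_intros)
  moreover have "((\<lambda>x. x powr p) has_real_derivative p * x powr (p - 1)) (at x)" if "a < x" for x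
    using that assms by (auto intro!: derivative_eq_intros)
  ultimately obtain l z where z: "a < z" "z < b" "((\<lambda>x. x powr p) has_real_derivative l) (at z)"
    "b powr p - a powr p = (b - a) * l"
    using MVT[OF ab, of "\<lambda>x. x powr p"] real_differentiable_def by metis
  have "l = p * z powr (p - 1)"
    using z assms by (intro DERIV_unique[OF z(3)]) (auto intro!: derivative_eq_intros)
  also have "\<dots> \<le> p * 1"
    using z assms by (intro mult_left_mono powr_le1) auto
  finally show ?thesis using z ab by (simp add: mult.commute mult_right_mono)
qed simp

lemma cut_pow_lipschitz:
  assumes "1 \<le> p"
  shows "\<bar>cut_pow p a - cut_pow p b\<bar> \<le> p * \<bar>a - b\<bar>"
proof -
  have *: "\<bar>cut_pow p a - cut_pow p b\<bar> \<le> p * \<bar>a - b\<bar>" if "a \<le> b" for a b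
  proof -
    let ?c = "\<lambda>z::real. min 1 (max 0 z)"
    have "?c a powr p \<le> ?c b powr p"
      using that assms by (intro powr_mono2) auto
    then have "\<bar>cut_pow p a - cut_pow p b\<bar> = ?c b powr p - ?c a powr p"
      by (simp add: cut_pow_def)
    also have "\<dots> \<le> p * (?c b - ?c a)"
      using that assms by (intro powr_diff_le) auto
    also have "\<dots> \<le> p * \<bar>a - b\<bar>"
      using that assms by (intro mult_left_mono) auto
    finally show ?thesis .
  qed
  show ?thesis using *[of a b] *[of b a] by (cases "a \<le> b") (auto simp: abs_minus_commute)
qed

lemma cut_pow_bounds: "0 \<le> p \<Longrightarrow> 0 \<le> cut_pow p z \<and> cut_pow p z \<le> 1"
  unfolding cut_pow_def using powr_le1 by auto

text \<open>In the variable \<open>\<sigma> = e\<^sup>k\<^sup>t\<close> the problem \<open>v'' + v' + e\<^sup>k\<^sup>t g(v) = 0\<close>, \<open>v(-\<infinity>) = 1\<close> is the Volterra equation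
  \<open>U = 1 - volterra k (g \<circ> U) / k\<close>, whose kernel is \<open>1 - (x / s)\<^sup>1\<^sup>/\<^sup>k\<close>.\<close>

definition volterra :: "real \<Rightarrow> (real \<Rightarrow> real) \<Rightarrow> real \<Rightarrow> real" where
  "volterra k G s = integral {0..s} G - s powr (- 1 / k) * integral {0..s} (\<lambda>x. x powr (1 / k) * G x)"

context
  fixes k :: real
  assumes k: "k > 0"
begin

lemma continuous_on_powr_mult [continuous_intros]:
  "continuous_on A G \<Longrightarrow> A \<subseteq> {0..} \<Longrightarrow> continuous_on A (\<lambda>x. x powr (1 / k) * G x)" for G :: "real \<Rightarrow> real"
  using k by (intro continuous_intros continuous_on_powr') auto

lemma moment_bounds:
  fixes G :: "real \<Rightarrow> real"
  assumes G: "continuous_on {0..} G" "\<And>x. 0 \<le> G x \<and> G x \<le> 1" and s: "s \<ge> 0"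
  shows "0 \<le> integral {0..s} G" "integral {0..s} G \<le> s"
    "0 \<le> integral {0..s} (\<lambda>x. x powr (1 / k) * G x)"
    "integral {0..s} (\<lambda>x. x powr (1 / k) * G x) \<le> s * s powr (1 / k)"
proof -
  have cG: "continuous_on {0..s} G" by (rule continuous_on_subset[OF G(1)]) auto
  have i1: "G integrable_on {0..s}" by (rule integrable_continuous_real[OF cG])
  have i2: "(\<lambda>x. x powr (1 / k) * G x) integrable_on {0..s}"
    by (intro integrable_continuous_real continuous_intros cG) auto
  show "0 \<le> integral {0..s} G" "0 \<le> integral {0..s} (\<lambda>x. x powr (1 / k) * G x)"
    using G by (auto intro!: integral_nonneg i1 i2)
  show "integral {0..s} G \<le> s"
    using integral_le[OF i1, of "\<lambda>x. 1"] G s by auto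
  have "integral {0..s} (\<lambda>x. x powr (1 / k) * G x) \<le> integral {0..s} (\<lambda>x. s powr (1 / k))"
  proof (intro integral_le i2)
    fix x assume "x \<in> {0..s}"
    then have "x powr (1 / k) * G x \<le> s powr (1 / k) * 1"
      using G k by (intro mult_mono powr_mono2) auto
    then show "x powr (1 / k) * G x \<le> s powr (1 / k)" by simp
  qed auto
  then show "integral {0..s} (\<lambda>x. x powr (1 / k) * G x) \<le> s * s powr (1 / k)" using s by simp
qed

lemma moment_derivs:
  fixes G :: "real \<Rightarrow> real"
  assumes G: "continuous_on {0..} G" and s: "s > 0"
  shows "((\<lambda>s. integral {0..s} G) has_real_derivative G s) (at s)"
    "((\<lambda>s. integral {0..s} (\<lambda>x. x powr (1 / k) * G x)) has_real_derivative s powr (1 / k) * G s) (at s)"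
proof -
  have cG: "continuous_on {0..s + 1} G" by (rule continuous_on_subset[OF G]) auto
  have eq: "at s within {0..s + 1} = at s" using s by (intro at_within_interior) auto
  show "((\<lambda>s. integral {0..s} G) has_real_derivative G s) (at s)"
    using integral_has_real_derivative[OF cG, of s] s unfolding eq by simp
  show "((\<lambda>s. integral {0..s} (\<lambda>x. x powr (1 / k) * G x)) has_real_derivative s powr (1 / k) * G s) (at s)"
    using integral_has_real_derivative[of 0 "s + 1" "\<lambda>x. x powr (1 / k) * G x" s] s unfolding eq
    by (simp add: continuous_intros cG)
qed

text \<open>Both terms lie in \<open>[0, s]\<close>, because \<open>x powr (1 / k)\<close> is at
  most \<open>s powr (1 / k)\<close> under the integral. The bound also supplies continuity at 0,
  near which the factor \<open>s powr (- 1 / k)\<close> blows up.\<close>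

lemma volterra_bound:
  fixes G :: "real \<Rightarrow> real"
  assumes G: "continuous_on {0..} G" "\<And>x. 0 \<le> G x \<and> G x \<le> 1" and s: "s \<ge> 0"
  shows "\<bar>volterra k G s\<bar> \<le> s"
proof (cases "s = 0")
  case False
  have "s powr (- 1 / k) * integral {0..s} (\<lambda>x. x powr (1 / k) * G x)
      \<le> s powr (- 1 / k) * (s * s powr (1 / k))"
    by (intro mult_left_mono moment_bounds[OF G s]) auto
  also have "\<dots> = s" using s False by (simp add: powr_minus field_simps)
  finally have "s powr (- 1 / k) * integral {0..s} (\<lambda>x. x powr (1 / k) * G x) \<le> s" .
  moreover have "0 \<le> s powr (- 1 / k) * integral {0..s} (\<lambda>x. x powr (1 / k) * G x)"
    by (intro mult_nonneg_nonneg moment_bounds[OF G s]) auto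
  ultimately show ?thesis
    using moment_bounds[OF G s] unfolding volterra_def by linarith
qed (simp add: volterra_def)

lemma continuous_on_volterra:
  fixes G :: "real \<Rightarrow> real"
  assumes G: "continuous_on {0..} G" "\<And>x. 0 \<le> G x \<and> G x \<le> 1"
  shows "continuous_on {0..} (volterra k G)"
  unfolding continuous_on_eq_continuous_within
proof
  fix s :: real assume s: "s \<in> {0..}"
  show "continuous (at s within {0..}) (volterra k G)"
  proof (cases "s = 0")
    case True
    have "((\<lambda>x. volterra k G x) \<longlongrightarrow> 0) (at 0 within {0..})"
    proof (rule Lim_null_comparison[where g = "\<lambda>x. x"])
      show "\<forall>\<^sub>F x in at 0 within {0..}. norm (volterra k G x) \<le> x"
        using volterra_bound[OF G] by (auto simp: eventually_at_filter)
    qed (rule tendsto_ident_at)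
    moreover have "volterra k G 0 = 0" by (simp add: volterra_def)
    ultimately show ?thesis using True by (simp add: continuous_within)
  next
    case False
    with s have "s > 0" by simp
    then have "isCont (volterra k G) s"
      unfolding volterra_def using moment_derivs[OF G(1) \<open>s > 0\<close>]
      by (intro continuous_intros) (auto intro: DERIV_isCont)
    then show ?thesis by (rule continuous_at_imp_continuous_within)
  qed
qed

text \<open>The kernel \<open>?K\<close> is bounded by 1 in absolute value, so only the integral of
  the exponential remains. It gains the factor \<open>1 / M\<close> that makes the Picard map
  contract.\<close>

lemma volterra_diff_bound:
  fixes G1 G2 :: "real \<Rightarrow> real"
  assumes G: "continuous_on {0..} G1" "continuous_on {0..} G2" and M: "M > 0" and s: "s \<ge> 0"
    and le: "\<And>x. 0 \<le> x \<Longrightarrow> \<bar>G1 x - G2 x\<bar> \<le> c * exp (M * x)"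
  shows "\<bar>volterra k G1 s - volterra k G2 s\<bar> \<le> c / M * (exp (M * s) - 1)"
proof (cases "s = 0")
  case False
  have cG: "continuous_on {0..s} G1" "continuous_on {0..s} G2"
    by (auto intro!: continuous_on_subset[OF G(1)] continuous_on_subset[OF G(2)])
  note i = integrable_continuous_real[OF cG(1)] integrable_continuous_real[OF cG(2)]
    integrable_continuous_real[OF continuous_on_powr_mult[OF cG(1)]]
    integrable_continuous_real[OF continuous_on_powr_mult[OF cG(2)]]
  let ?K = "\<lambda>x. 1 - s powr (- 1 / k) * x powr (1 / k)"
  have v: "volterra k H s = integral {0..s} (\<lambda>x. ?K x * H x)" if "continuous_on {0..s} H" for H
  proof -
    have "volterra k H s = integral {0..s} H - integral {0..s} (\<lambda>x. s powr (- 1 / k) * (x powr (1 / k) * H x))"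
      unfolding volterra_def by simp
    also have "\<dots> = integral {0..s} (\<lambda>x. H x - s powr (- 1 / k) * (x powr (1 / k) * H x))"
      by (intro integral_diff[symmetric] integrable_continuous_real continuous_intros that) auto
    finally show ?thesis by (simp add: algebra_simps)
  qed
  have cK: "continuous_on {0..s} ?K"
    using k by (intro continuous_intros continuous_on_powr') auto
  have E: "((\<lambda>x. c * exp (M * x)) has_integral c / M * exp (M * s) - c / M * exp (M * 0)) {0..s}"
    using M s by (intro fundamental_theorem_of_calculus)
      (auto intro!: derivative_eq_intros simp flip: has_real_derivative_iff_has_vector_derivative)
  have eq: "volterra k G1 s - volterra k G2 s = integral {0..s} (\<lambda>x. ?K x * G1 x - ?K x * G2 x)"
    unfolding v[OF cG(1)] v[OF cG(2)]
    by (intro integral_diff[symmetric] integrable_continuous_real continuous_on_mult cK cG)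
  have "norm (integral {0..s} (\<lambda>x. ?K x * G1 x - ?K x * G2 x)) \<le> integral {0..s} (\<lambda>x. c * exp (M * x))"
  proof (intro integral_norm_bound_integral)
    show "(\<lambda>x. ?K x * G1 x - ?K x * G2 x) integrable_on {0..s}"
      by (intro integrable_continuous_real continuous_on_diff continuous_on_mult cK cG)
    show "(\<lambda>x. c * exp (M * x)) integrable_on {0..s}" using E by blast
    fix x assume x: "x \<in> {0..s}"
    have "s powr (- 1 / k) * x powr (1 / k) \<le> s powr (- 1 / k) * s powr (1 / k)"
      using x k by (intro mult_left_mono powr_mono2) auto
    also have "\<dots> = 1" using s False by (simp add: powr_minus field_simps)
    finally have "\<bar>?K x\<bar> \<le> 1" by (simp add: abs_le_iff)
    then have "\<bar>?K x\<bar> * \<bar>G1 x - G2 x\<bar> \<le> 1 * (c * exp (M * x))"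
      using x le by (intro mult_mono) auto
    then show "norm (?K x * G1 x - ?K x * G2 x) \<le> c * exp (M * x)"
      by (simp flip: right_diff_distrib abs_mult)
  qed
  also have "\<dots> = c / M * (exp (M * s) - 1)"
    unfolding integral_unique[OF E] by (simp add: right_diff_distrib)
  finally show ?thesis unfolding eq by simp
qed (simp add: volterra_def)

text \<open>The solution is wanted on the whole half-line in one step, with no smallness of
  \<open>L\<close>. The fixed point is sought for \<open>exp (- M * s) * U s\<close>, which is
  bounded because \<open>U\<close> grows at most linearly.\<close>

lemma volterra_fixpoint:
  fixes g :: "real \<Rightarrow> real"
  assumes lip: "\<And>a b. \<bar>g a - g b\<bar> \<le> L * \<bar>a - b\<bar>" and g: "\<And>z. 0 \<le> g z \<and> g z \<le> 1"
  obtains U where "continuous_on {0..} U" "\<And>s. s \<ge> 0 \<Longrightarrow> U s = 1 - volterra k (\<lambda>x. g (U x)) s / k"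
proof -
  have L: "L \<ge> 0" using lip[of 1 0] by (auto intro: order_trans[OF abs_ge_zero])
  \<comment> \<open>the Picard operator is a contraction in the norm weighted by \<open>exp (- M s)\<close>\<close>
  define M where "M = 2 * L / k + 1"
  have M: "M > 0" "L / (k * M) \<le> 1 / 2"
    using L k by (auto simp: M_def field_simps add_pos_nonneg)
  have cg: "continuous_on UNIV g"
    using lip by (intro lipschitz_on_continuous_on[of L] lipschitz_onI) (auto simp: dist_real_def L)
  define G where "G F x = g (exp (M * x) * apply_bcontfun F x)" for F :: "real \<Rightarrow>\<^sub>C real" and x
  have cG: "continuous_on A (G F)" for F A
    unfolding G_def by (intro continuous_intros continuous_on_compose2[OF cg]) auto
  have G01: "0 \<le> G F x \<and> G F x \<le> 1" for F x unfolding G_def by (rule g)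
  \<comment> \<open>Bounded continuous functions form a type over all of \<open>real\<close>;
    \<open>max 0 s\<close> extends the image constantly to the negative axis.\<close>
  define Psi where "Psi F s = exp (- M * max 0 s) * (1 - volterra k (G F) (max 0 s) / k)" for F s
  have cPsi: "continuous_on UNIV (Psi F)" for F
    unfolding Psi_def
    using k by (intro continuous_intros continuous_on_compose2[OF continuous_on_volterra[OF cG G01]]) auto
  have "\<bar>Psi F s\<bar> \<le> 1 + 1 / (k * M)" for F s
  proof -
    define t where "t = max 0 s"
    have t: "t \<ge> 0" by (simp add: t_def)
    have "\<bar>volterra k (G F) t / k\<bar> \<le> t / k"
      using volterra_bound[OF cG G01 t] k by (simp add: divide_right_mono)
    then have "\<bar>1 - volterra k (G F) t / k\<bar> \<le> 1 + t / k" by linarith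
    then have "\<bar>Psi F s\<bar> \<le> exp (- M * t) * (1 + t / k)"
      unfolding Psi_def t_def[symmetric] by (simp add: abs_mult)
    also have "\<dots> = exp (- M * t) + exp (- M * t) * (M * t) * (1 / (k * M))"
      using M k by (simp add: field_simps)
    also have "\<dots> \<le> 1 + 1 * (1 / (k * M))"
    proof (intro add_mono mult_right_mono)
      have "M * t \<le> exp (M * t)" using exp_ge_add_one_self[of "M * t"] by linarith
      then have "exp (- M * t) * (M * t) \<le> exp (- M * t) * exp (M * t)"
        by (intro mult_left_mono) auto
      then show "exp (- M * t) * (M * t) \<le> 1" by (simp flip: exp_add)
    qed (use M t k in auto)
    finally show ?thesis by simp
  qed
  then have bPsi: "Psi F \<in> bcontfun" for F
    using cPsi by (intro bcontfun_normI) auto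
  define Phi where "Phi F = Bcontfun (Psi F)" for F
  have ap: "apply_bcontfun (Phi F) = Psi F" for F
    unfolding Phi_def using bPsi by (rule Bcontfun_inverse)
  have contr: "dist (Phi F1) (Phi F2) \<le> 1 / 2 * dist F1 F2" for F1 F2
  proof (rule dist_bound)
    fix s :: real
    define t where "t = max 0 s"
    have t: "t \<ge> 0" by (simp add: t_def)
    have "\<bar>volterra k (G F1) t - volterra k (G F2) t\<bar> \<le> (L * dist F1 F2) / M * (exp (M * t) - 1)"
    proof (intro volterra_diff_bound cG M t)
      fix x :: real
      have "\<bar>G F1 x - G F2 x\<bar> \<le> L * \<bar>exp (M * x) * apply_bcontfun F1 x - exp (M * x) * apply_bcontfun F2 x\<bar>"
        unfolding G_def by (rule lip)
      also have "\<dots> = L * exp (M * x) * dist (apply_bcontfun F1 x) (apply_bcontfun F2 x)"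
        by (simp add: dist_real_def abs_mult flip: right_diff_distrib)
      also have "\<dots> \<le> L * exp (M * x) * dist F1 F2"
        by (intro mult_left_mono dist_bounded) (use L in auto)
      finally show "\<bar>G F1 x - G F2 x\<bar> \<le> L * dist F1 F2 * exp (M * x)" by (simp add: mult_ac)
    qed
    also have "\<dots> \<le> (L * dist F1 F2) / M * exp (M * t)"
      using L M by (intro mult_left_mono) auto
    finally have *: "\<bar>volterra k (G F1) t - volterra k (G F2) t\<bar> \<le> (L * dist F1 F2) / M * exp (M * t)" .
    have "dist (Phi F1 s) (Phi F2 s) = exp (- M * t) / k * \<bar>volterra k (G F1) t - volterra k (G F2) t\<bar>"
      unfolding ap Psi_def t_def[symmetric] dist_real_def
      using k by (simp add: abs_mult abs_minus_commute flip: right_diff_distrib diff_divide_distrib)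
    also have "\<dots> \<le> exp (- M * t) / k * ((L * dist F1 F2) / M * exp (M * t))"
      using k by (intro mult_left_mono *) auto
    also have "\<dots> = L / (k * M) * dist F1 F2"
      by (simp add: exp_minus field_simps)
    also have "\<dots> \<le> 1 / 2 * dist F1 F2" by (intro mult_right_mono M) auto
    finally show "dist (Phi F1 s) (Phi F2 s) \<le> 1 / 2 * dist F1 F2" .
  qed
  obtain F where F: "Phi F = F"
    using banach_fix_type[of "1/2" Phi] contr by auto
  define U where "U s = exp (M * s) * apply_bcontfun F s" for s
  show ?thesis
  proof
    show "continuous_on {0..} U" unfolding U_def by (intro continuous_intros continuous_on_apply_bcontfun)
    fix s :: real assume s: "s \<ge> 0"
    have GF: "G F = (\<lambda>x. g (U x))" by (auto simp: G_def U_def)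
    have "apply_bcontfun F s = Psi F s" using ap[of F] F by simp
    then show "U s = 1 - volterra k (\<lambda>x. g (U x)) s / k"
      using s unfolding Psi_def GF by (simp add: U_def[of s] exp_minus field_simps)
  qed
qed

text \<open>Integrating \<open>(exp t * w t)' = - exp t * exp (k * t) * g (v t)\<close> from
  \<open>-\<infinity>\<close> and substituting \<open>exp (k * t)\<close> for the variable expresses
  \<open>w\<close> by the moment \<open>B\<close>; a second integration is the Volterra equation.
  The proof runs this backwards and differentiates the moments \<open>A\<close> and
  \<open>B\<close>, so that no improper integral occurs.\<close>

lemma singular_ivp_exists:
  fixes g :: "real \<Rightarrow> real"
  assumes lip: "\<And>a b. \<bar>g a - g b\<bar> \<le> L * \<bar>a - b\<bar>" and g: "\<And>z. 0 \<le> g z \<and> g z \<le> 1"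
  obtains v w where "\<And>t. (v has_real_derivative w t) (at t)"
    "\<And>t. (w has_real_derivative - w t - exp (k * t) * g (v t)) (at t)"
    "\<And>t. - w t \<le> exp (k * t) / k" "\<And>t. w t \<le> 0" "\<And>t. \<bar>v t - 1\<bar> \<le> exp (k * t) / k"
proof -
  obtain U where cU: "continuous_on {0..} U"
    and U: "\<And>s. s \<ge> 0 \<Longrightarrow> U s = 1 - volterra k (\<lambda>x. g (U x)) s / k"
    using volterra_fixpoint[OF lip g] by blast
  have L: "L \<ge> 0" using lip[of 1 0] by (auto intro: order_trans[OF abs_ge_zero])
  have cg: "continuous_on UNIV g"
    using lip by (intro lipschitz_on_continuous_on[of L] lipschitz_onI) (auto simp: dist_real_def L)
  define G where "G x = g (U x)" for x
  have cG: "continuous_on {0..} G"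
    unfolding G_def by (intro continuous_on_compose2[OF cg cU]) auto
  have G01: "0 \<le> G x \<and> G x \<le> 1" for x unfolding G_def by (rule g)
  define A where "A s = integral {0..s} G" for s
  define B where "B s = integral {0..s} (\<lambda>x. x powr (1 / k) * G x)" for s
  have dA: "(A has_real_derivative G s) (at s)" if "s > 0" for s
    using moment_derivs(1)[OF cG that] unfolding A_def .
  have dB: "(B has_real_derivative s powr (1 / k) * G s) (at s)" if "s > 0" for s
    using moment_derivs(2)[OF cG that] unfolding B_def .
  have G: "G = (\<lambda>x. g (U x))" by (auto simp: G_def)
  have e: "exp (k * t) powr (1 / k) = exp t" "exp (k * t) powr (- (1 / k)) = exp (- t)" for t
    using k by (auto simp: powr_def)
  define v where "v t = U (exp (k * t))" for t
  define w where "w t = - (exp (- t) * B (exp (k * t)) / k)" for t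
  have v: "v = (\<lambda>t. 1 - (A (exp (k * t)) - exp (- t) * B (exp (k * t))) / k)"
    unfolding v_def by (auto simp: U volterra_def e A_def B_def G)
  have dA': "((\<lambda>t. A (exp (k * t))) has_real_derivative G (exp (k * t)) * (exp (k * t) * k)) (at t)" for t
    by (rule DERIV_chain2[OF dA]) (auto intro!: derivative_eq_intros)
  have dB': "((\<lambda>t. B (exp (k * t))) has_real_derivative exp t * G (exp (k * t)) * (exp (k * t) * k)) (at t)" for t
    by (rule DERIV_chain2[where f = B and g = "\<lambda>t. exp (k * t)", OF dB[of "exp (k * t)", unfolded e]]) (auto intro!: derivative_eq_intros)
  have dE: "((\<lambda>t. exp (- t)) has_real_derivative - exp (- t)) (at t)" for t :: real
    by (auto intro!: derivative_eq_intros)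
  have B01: "0 \<le> B (exp (k * t))" "B (exp (k * t)) \<le> exp (k * t) * exp t" for t
    using moment_bounds(3,4)[OF cG G01, of "exp (k * t)"] unfolding B_def e by auto
  show ?thesis
  proof
    fix t :: real
    show "(v has_real_derivative w t) (at t)"
      unfolding v w_def
      by (rule DERIV_cong[OF DERIV_diff[OF DERIV_const DERIV_cdivide[OF
              DERIV_diff[OF dA'[of t] DERIV_mult[OF dE[of t] dB'[of t]]]]]])
        (use k in \<open>simp add: exp_minus field_simps\<close>)
    show "(w has_real_derivative - w t - exp (k * t) * g (v t)) (at t)"
      unfolding w_def v_def G_def[symmetric]
      by (rule DERIV_cong[OF DERIV_minus[OF DERIV_cdivide[OF DERIV_mult[OF dE[of t] dB'[of t]]]]])
        (use k in \<open>simp add: exp_minus field_simps\<close>)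
    show "w t \<le> 0" unfolding w_def using B01[of t] k by simp
    have "exp (- t) * B (exp (k * t)) \<le> exp (- t) * (exp (k * t) * exp t)"
      by (intro mult_left_mono B01) auto
    then show "- w t \<le> exp (k * t) / k"
      unfolding w_def using k by (simp add: exp_minus field_simps)
    have "\<bar>volterra k (\<lambda>x. g (U x)) (exp (k * t))\<bar> \<le> exp (k * t)"
      using volterra_bound[OF cG G01] unfolding G_def by simp
    then show "\<bar>v t - 1\<bar> \<le> exp (k * t) / k"
      unfolding v_def using k by (simp add: U divide_right_mono)
  qed
qed

end

subsection \<open>The planar system\<close>

text \<open>A difference quotient over a window of fixed length \<open>h\<close> tends to 0 and
  equals \<open>f'\<close> at some point of the window; the bound on \<open>f''\<close> transfers
  this to the left end at the cost of \<open>M * h\<close>. This replaces compactness arguments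
  about the limit set of the orbit.\<close>

lemma barbalat:
  fixes f f' f'' :: "real \<Rightarrow> real"
  assumes df: "\<And>t. (f has_real_derivative f' t) (at t)"
    and df': "\<And>t. (f' has_real_derivative f'' t) (at t)"
    and bound: "\<And>t. \<bar>f'' t\<bar> \<le> M" and lim: "(f \<longlongrightarrow> l) at_top"
  shows "(f' \<longlongrightarrow> 0) at_top"
proof (rule tendstoI)
  fix e :: real assume e: "e > 0"
  have M: "M \<ge> 0" using bound[of 0] by linarith
  define h where "h = e / (2 * (M + 1))"
  have h: "h > 0" "M * h \<le> e / 2"
    using e M by (auto simp: h_def field_simps)
  have "((\<lambda>t. f (t + h) - f t) \<longlongrightarrow> l - l) at_top"
    by (intro tendsto_diff lim filterlim_compose[OF lim] filterlim_tendsto_add_at_top[OF tendsto_const filterlim_ident, of h, simplified add.commute])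
  then have "((\<lambda>t. (f (t + h) - f t) / h) \<longlongrightarrow> 0) at_top"
    using tendsto_divide[OF _ tendsto_const[of h]] h by fastforce
  then have "\<forall>\<^sub>F t in at_top. dist ((f (t + h) - f t) / h) 0 < e / 2"
    using e by (intro tendstoD) auto
  then show "\<forall>\<^sub>F t in at_top. dist (f' t) 0 < e"
  proof eventually_elim
    case (elim t)
    obtain z where z: "t < z" "z < t + h" "f (t + h) - f t = (t + h - t) * f' z"
      using MVT2[of t "t + h" f f'] df h by auto
    obtain y where y: "t < y" "y < z" "f' z - f' t = (z - t) * f'' y"
      using MVT2[of t z f' f''] df' z by auto
    have "\<bar>f' z - f' t\<bar> \<le> h * M"
      unfolding y(3) abs_mult using z h bound by (intro mult_mono) auto
    moreover have "\<bar>f' z\<bar> < e / 2" using elim z h by (simp add: dist_real_def)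
    ultimately show ?case using h by (auto simp: dist_real_def mult.commute)
  qed
qed

text \<open>At the first return to a nonpositive value \<open>f\<close> would vanish after having
  been positive, contrary to its positive derivative there. If \<open>f a = 0\<close>, the argument
  starts slightly later, where \<open>f\<close> is already positive.\<close>

lemma positive_after_upcrossing:
  fixes f f' :: "real \<Rightarrow> real"
  assumes df: "\<And>t. a \<le> t \<Longrightarrow> t \<le> b \<Longrightarrow> (f has_real_derivative f' t) (at t)"
    and up: "\<And>t. a \<le> t \<Longrightarrow> t \<le> b \<Longrightarrow> f t = 0 \<Longrightarrow> f' t > 0"
    and ab: "a < b" and fa: "f a \<ge> 0"
  shows "f b > 0"
proof (rule ccontr)
  assume "\<not> f b > 0"
  then have fb: "f b \<le> 0" by simp
  obtain c where c: "a \<le> c" "c < b" "f c > 0"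
  proof (cases "f a = 0")
    case True
    obtain d where d: "d > 0" "\<And>h. 0 < h \<Longrightarrow> h < d \<Longrightarrow> f a < f (a + h)"
      using DERIV_pos_inc_right[OF df[of a] up[of a]] ab True by auto
    define h where "h = min (d / 2) ((b - a) / 2)"
    have "0 < h" "h < d" "a + h < b" using d ab by (auto simp: h_def min_def field_simps)
    with d(2)[of h] that[of "a + h"] True show ?thesis by auto
  qed (use that fa ab in force)
  have cont: "continuous_on {c..b} f"
    using c by (intro continuous_at_imp_continuous_on ballI) (auto intro: DERIV_isCont[OF df])
  define S where "S = {c..b} \<inter> f -` {..0}"
  have "b \<in> S" using fb c by (simp add: S_def)
  then have S: "S \<noteq> {}" by blast
  have bdd: "bdd_below S" by (auto simp: S_def intro!: bdd_belowI[of _ c])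
  have "closed S" unfolding S_def by (intro continuous_closed_preimage cont) auto
  then have "Inf S \<in> S" by (intro closed_contains_Inf S bdd)
  define s where "s = Inf S"
  have s: "c \<le> s" "s \<le> b" "f s \<le> 0" using \<open>Inf S \<in> S\<close> by (auto simp: S_def s_def)
  have pos: "f t > 0" if "c \<le> t" "t < s" for t
  proof (rule ccontr)
    assume "\<not> f t > 0"
    then have "t \<in> S" using that s by (auto simp: S_def)
    then have "s \<le> t" unfolding s_def by (intro cInf_lower bdd)
    with that show False by simp
  qed
  have "s \<noteq> c" using s c by auto
  then have cs: "c < s" using s by simp
  have "f s \<ge> 0"
  proof (rule tendsto_lowerbound)
    show "(f \<longlongrightarrow> f s) (at_left s)"
      using DERIV_isCont[OF df[of s]] s c by (auto simp: isCont_def intro: filterlim_mono[OF _ order_refl at_le])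
    show "\<forall>\<^sub>F t in at_left s. 0 \<le> f t"
      using eventually_at_left_real[OF cs] by eventually_elim (use pos less_imp_le in auto)
  qed simp
  then have "f s = 0" using s by simp
  obtain d where d: "d > 0" "\<And>h. 0 < h \<Longrightarrow> h < d \<Longrightarrow> f (s - h) < f s"
    using DERIV_pos_inc_left[OF df[of s] up[of s]] s c \<open>f s = 0\<close> by auto
  define h where "h = min (d / 2) (s - c)"
  have "0 < h" "h < d" "c \<le> s - h" using d cs by (auto simp: h_def min_def)
  with d(2)[of h] pos[of "s - h"] \<open>f s = 0\<close> show False by auto
qed

lemma antimono_bounded_below_tendsto:
  fixes f :: "real \<Rightarrow> real"
  assumes "\<And>s t. a \<le> s \<Longrightarrow> s \<le> t \<Longrightarrow> f t \<le> f s" "\<And>t. a \<le> t \<Longrightarrow> c \<le> f t"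
  obtains l where "(f \<longlongrightarrow> l) at_top" "c \<le> l" "\<And>t. a \<le> t \<Longrightarrow> l \<le> f t"
proof -
  define l where "l = (INF t\<in>{a..}. f t)"
  have bdd: "bdd_below (f ` {a..})" using assms(2) by (auto intro!: bdd_belowI2[of _ c])
  have le: "l \<le> f t" if "a \<le> t" for t unfolding l_def using that bdd by (intro cINF_lower) auto
  have "(f \<longlongrightarrow> l) at_top"
  proof (rule order_tendstoI)
    fix y assume "y < l"
    show "\<forall>\<^sub>F t in at_top. y < f t"
      using eventually_ge_at_top[of a] by eventually_elim (use le \<open>y < l\<close> order_less_le_trans in auto)
  next
    fix y assume "l < y"
    then obtain s where s: "s \<ge> a" "f s < y"
      unfolding l_def using cINF_less_iff[OF _ bdd, of y] by auto
    show "\<forall>\<^sub>F t in at_top. f t < y"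
      using eventually_ge_at_top[of s] by eventually_elim (use assms(1) s in force)
  qed
  moreover have "c \<le> l" unfolding l_def using assms(2) by (intro cINF_greatest) auto
  ultimately show ?thesis using le that by blast
qed

lemma mono_bounded_above_tendsto:
  fixes f :: "real \<Rightarrow> real"
  assumes "\<And>s t. a \<le> s \<Longrightarrow> s \<le> t \<Longrightarrow> f s \<le> f t" "\<And>t. a \<le> t \<Longrightarrow> f t \<le> c"
  obtains l where "(f \<longlongrightarrow> l) at_top" "l \<le> c" "\<And>t. a \<le> t \<Longrightarrow> f t \<le> l"
proof -
  obtain l where "((\<lambda>t. - f t) \<longlongrightarrow> l) at_top" "- c \<le> l" "\<And>t. a \<le> t \<Longrightarrow> l \<le> - f t"
    using antimono_bounded_below_tendsto[of a "\<lambda>t. - f t" "- c"] assms by auto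
  then show ?thesis using that[of "- l"] tendsto_minus[of "\<lambda>t. - f t" l] by force
qed

lemma exp_mult_at_bot: "((\<lambda>t. exp (c * t)) \<longlongrightarrow> 0) at_bot" if "c > 0" for c :: real
  using that by (intro filterlim_compose[OF exp_at_bot] filterlim_tendsto_pos_mult_at_bot[OF tendsto_const] filterlim_ident)

text \<open>The initial condition at \<open>-\<infinity>\<close> enters through exponential bounds
  on \<open>w\<close> and \<open>v - 1\<close>, which give all limits at \<open>at_bot\<close>
  without returning to the integral equation. The orbit is defined for all times, but
  \<open>q\<close>, \<open>Lam\<close> and \<open>y\<close> below have their intended meaning only
  while \<open>v\<close> is positive.\<close>

locale singular_orbit =
  fixes k p :: real and v w :: "real \<Rightarrow> real"
  assumes k: "k > 0" and p: "p > k + 1"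
    and dv: "\<And>t. (v has_real_derivative w t) (at t)"
    and dw: "\<And>t. (w has_real_derivative - w t - exp (k * t) * cut_pow p (v t)) (at t)"
    and w_lower: "\<And>t. - w t \<le> exp (k * t) / k"
    and w_nonpos: "\<And>t. w t \<le> 0"
    and v_near_1: "\<And>t. \<bar>v t - 1\<bar> \<le> exp (k * t) / k"
begin

text \<open>\<open>theta\<close> is the decay rate of an exact singular solution:
  \<open>c * exp (- theta * t)\<close> solves the equation without truncation when
  \<open>c > 0\<close> and \<open>c powr (p - 1) = theta * (1 - theta)\<close>. Dividing
  \<open>v\<close> by this exponential gives \<open>y\<close>, for which the equation becomes
  autonomous.\<close>

definition "theta = k / (p - 1)"
definition "q t = - w t / v t"
definition "Lam t = exp (k * t) * v t powr (p - 1)"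
definition "y t = exp (theta * t) * v t"

lemma theta: "0 < theta" "theta < 1" "theta * (p - 1) = k"
  using k p by (auto simp: theta_def field_simps)

lemma v_at_bot: "(v \<longlongrightarrow> 1) at_bot"
proof (rule LIM_zero_cancel, rule Lim_null_comparison)
  show "\<forall>\<^sub>F t in at_bot. norm (v t - 1) \<le> exp (k * t) / k" using v_near_1 by simp
  show "((\<lambda>t. exp (k * t) / k) \<longlongrightarrow> 0) at_bot" using tendsto_divide[OF exp_mult_at_bot[OF k] tendsto_const[of k]] k by simp
qed

lemma w_at_bot: "(w \<longlongrightarrow> 0) at_bot"
proof (rule Lim_null_comparison)
  show "\<forall>\<^sub>F t in at_bot. norm (w t) \<le> exp (k * t) / k" using w_lower w_nonpos by simp
  show "((\<lambda>t. exp (k * t) / k) \<longlongrightarrow> 0) at_bot" using tendsto_divide[OF exp_mult_at_bot[OF k] tendsto_const[of k]] k by simp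
qed

lemma cont_v: "isCont v t" and cont_w: "isCont w t"
  using dv dw by (blast intro: DERIV_isCont)+

lemma cut_nonneg: "0 \<le> cut_pow p z"
  using cut_pow_bounds[of p z] k p by simp

lemma deriv_exp_w: "((\<lambda>t. exp t * w t) has_real_derivative - (exp t * (exp (k * t) * cut_pow p (v t)))) (at t)"
  by (auto intro!: derivative_eq_intros dw simp: algebra_simps)

lemma exp_w_antimono: "s \<le> t \<Longrightarrow> exp t * w t \<le> exp s * w s"
proof (erule DERIV_nonpos_imp_nonincreasing)
  fix x
  have "- (exp x * (exp (k * x) * cut_pow p (v x))) \<le> 0" using cut_nonneg by simp
  then show "\<exists>y. ((\<lambda>t. exp t * w t) has_real_derivative y) (at x) \<and> y \<le> 0"
    using deriv_exp_w by blast
qed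

text \<open>Near \<open>-\<infinity>\<close> the orbit is positive, so \<open>exp t * w t\<close>
  decreases strictly there from a nonpositive value. As it never increases, it stays negative, even
  beyond a zero of \<open>v\<close>.\<close>

lemma w_neg: "w t < 0"
proof -
  have "\<forall>\<^sub>F s in at_bot. v s > 0"
    using v_at_bot by (rule order_tendstoD) simp
  then obtain b where b: "\<And>s. s \<le> b \<Longrightarrow> v s > 0" unfolding eventually_at_bot_linorder by blast
  define a where "a = min t b"
  have "exp a * w a < exp (a - 1) * w (a - 1)"
  proof (rule DERIV_neg_imp_decreasing[where f = "\<lambda>t. exp t * w t"])
    fix x assume "a - 1 \<le> x" "x \<le> a"
    then have "v x > 0" using b by (auto simp: a_def)
    then have "cut_pow p (v x) > 0" by (simp add: cut_pow_def)
    then show "\<exists>y. ((\<lambda>t. exp t * w t) has_real_derivative y) (at x) \<and> y < 0"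
      using deriv_exp_w[of x] by (intro exI[of _ "- (exp x * (exp (k * x) * cut_pow p (v x)))"]) auto
  qed simp
  also have "\<dots> \<le> 0" using w_nonpos[of "a - 1"] by (simp add: mult_le_0_iff)
  finally have "exp t * w t < 0" using exp_w_antimono[of a t] by (simp add: a_def)
  then show ?thesis by (simp add: mult_less_0_iff)
qed

lemma v_strict_antimono: "s < t \<Longrightarrow> v t < v s"
  by (rule DERIV_neg_imp_decreasing) (use dv w_neg in auto)

lemma v_less_1: "v t < 1"
proof -
  have "v (t - 1) \<le> 1"
  proof (rule tendsto_lowerbound[OF v_at_bot])
    show "\<forall>\<^sub>F s in at_bot. v (t - 1) \<le> v s"
      using eventually_le_at_bot[of "t - 1"]
      by eventually_elim (metis order_le_less v_strict_antimono)
  qed simp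
  then show ?thesis using v_strict_antimono[of "t - 1" t] by simp
qed

lemma v_pos_downward: "v t > 0 \<Longrightarrow> s \<le> t \<Longrightarrow> v s > 0"
  by (metis order_le_less order_less_trans v_strict_antimono)

lemma cut_pow_v: "v t > 0 \<Longrightarrow> cut_pow p (v t) = v t powr p"
  using v_less_1[of t] by (simp add: cut_pow_def)

lemma v_pos_at_bot: "\<forall>\<^sub>F t in at_bot. v t > 0"
  using v_at_bot by (rule order_tendstoD) simp

lemma first_zero:
  assumes "\<not> (\<forall>t. v t > 0)"
  obtains T where "v T = 0" "\<And>t. v t > 0 \<longleftrightarrow> t < T"
proof -
  obtain b where b: "v b \<le> 0" using assms by (auto simp: not_less)
  obtain a where a: "v a > 0" "a \<le> b"
    using eventually_happens'[OF _ eventually_conj[OF v_pos_at_bot eventually_le_at_bot[of b]]] by auto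
  obtain T where T: "v T = 0" using IVT2[of v b 0 a] a b cont_v by auto
  show ?thesis
  proof
    fix t show "v t > 0 \<longleftrightarrow> t < T"
      using v_strict_antimono[of t T] v_strict_antimono[of T t] T by (cases t T rule: linorder_cases) auto
  qed fact
qed

lemma Lam_pos: "v t > 0 \<Longrightarrow> Lam t > 0" and q_pos: "v t > 0 \<Longrightarrow> q t > 0"
  using w_neg[of t] by (auto simp: Lam_def q_def divide_neg_pos)

lemma deriv_q:
  assumes "v t > 0"
  shows "(q has_real_derivative Lam t - q t * (1 - q t)) (at t)"
proof -
  have "v t powr p = v t powr (p - 1) * v t"
    using assms by (metis powr_mult_base diff_add_cancel less_imp_le mult.commute add.commute)
  then show ?thesis
    unfolding q_def using assms
    by (auto intro!: derivative_eq_intros dv dw simp: cut_pow_v Lam_def field_simps)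
qed

lemma deriv_Lam:
  assumes "v t > 0"
  shows "(Lam has_real_derivative (p - 1) * Lam t * (theta - q t)) (at t)"
proof -
  have "((\<lambda>t. v t powr (p - 1)) has_real_derivative (p - 1) * v t powr (p - 1 - 1) * w t) (at t)"
    by (rule DERIV_chain2[where f = "\<lambda>z. z powr (p - 1)", OF has_real_derivative_powr[OF assms] dv])
  moreover have "v t powr (p - 1 - 1) = v t powr (p - 1) / v t"
    using assms powr_diff[of "v t" "p - 1" 1] by simp
  ultimately have d: "((\<lambda>t. v t powr (p - 1)) has_real_derivative v t powr (p - 1) * ((p - 1) * w t / v t)) (at t)"
    by (simp add: mult_ac)
  have "(Lam has_real_derivative k * Lam t + exp (k * t) * (v t powr (p - 1) * ((p - 1) * w t / v t))) (at t)"
    unfolding Lam_def by (rule DERIV_cong[OF DERIV_mult[OF _ d, of "\<lambda>t. exp (k * t)" "k * exp (k * t)"]])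
      (auto intro!: derivative_eq_intros)
  also have "k * Lam t + exp (k * t) * (v t powr (p - 1) * ((p - 1) * w t / v t)) = (p - 1) * Lam t * (theta - q t)"
  proof -
    have "(p - 1) * Lam t * (theta - q t) = theta * (p - 1) * Lam t - (p - 1) * Lam t * q t"
      by (simp add: algebra_simps)
    then show ?thesis unfolding theta(3) by (simp add: Lam_def q_def)
  qed
  finally show ?thesis .
qed

lemma q_at_bot: "(q \<longlongrightarrow> 0) at_bot"
  unfolding q_def using tendsto_divide[OF tendsto_minus[OF w_at_bot] v_at_bot] by simp

lemma Lam_at_bot: "(Lam \<longlongrightarrow> 0) at_bot"
  unfolding Lam_def using tendsto_mult[OF exp_mult_at_bot[OF k] tendsto_powr[OF v_at_bot tendsto_const]] by simp

lemma y_powr: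
  assumes "v t > 0"
  shows "y t powr (p - 1) = Lam t"
proof -
  have "theta * t * (p - 1) = k * t" using theta(3) by (metis mult.assoc mult.commute)
  then show ?thesis using assms by (simp add: y_def Lam_def powr_mult exp_powr_real)
qed

lemma deriv_y: "v t > 0 \<Longrightarrow> (y has_real_derivative y t * (theta - q t)) (at t)"
  unfolding y_def q_def by (auto intro!: derivative_eq_intros dv simp: field_simps)

lemma y_pos: "v t > 0 \<Longrightarrow> y t > 0" by (simp add: y_def)

lemma y_at_bot: "(y \<longlongrightarrow> 0) at_bot"
  unfolding y_def using tendsto_mult[OF exp_mult_at_bot[OF theta(1)] v_at_bot] by simp

text \<open>\<open>q \<le> 1\<close> says \<open>v + w \<ge> 0\<close>. At a first zero of
  \<open>v\<close> this would survive in the limit as \<open>w \<ge> 0\<close>, but \<open>w\<close>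
  is negative everywhere.\<close>

lemma positive_if_q_le_1:
  assumes "\<And>t. v t > 0 \<Longrightarrow> q t \<le> 1"
  shows "v t > 0"
proof (rule ccontr)
  assume "\<not> v t > 0"
  then obtain T where T: "v T = 0" "\<And>t. v t > 0 \<longleftrightarrow> t < T" using first_zero by blast
  have "v T + w T \<ge> 0"
  proof (rule tendsto_lowerbound)
    show "((\<lambda>t. v t + w t) \<longlongrightarrow> v T + w T) (at_left T)"
      using cont_v[of T] cont_w[of T]
      by (intro tendsto_add) (auto simp: isCont_def intro: filterlim_mono[OF _ order_refl at_le])
    show "\<forall>\<^sub>F t in at_left T. 0 \<le> v t + w t"
      unfolding eventually_at_filter
    proof (intro always_eventually allI impI)
      fix t assume "t \<in> {..<T}"
      then have "v t > 0" using T by simp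
      with assms[OF this] show "0 \<le> v t + w t" by (simp add: q_def field_simps)
    qed
  qed simp
  then show False using T w_neg[of T] by simp
qed

lemma q_le_1:
  assumes pos: "\<And>t. v t > 0"
  shows "q t \<le> 1"
proof (rule ccontr)
  assume "\<not> q t \<le> 1"
  \<comment> \<open>\<open>v + v'\<close> is nonincreasing, so once it is negative \<open>v\<close> reaches zero\<close>
  define Q where "Q = v t + w t"
  have Q: "Q < 0" using \<open>\<not> q t \<le> 1\<close> pos[of t] by (simp add: q_def Q_def field_simps)
  have w_le: "w s \<le> Q" if "t \<le> s" for s
  proof -
    have "v s + w s \<le> v t + w t"
    proof (rule DERIV_nonpos_imp_nonincreasing[OF that])
      fix x
      have "((\<lambda>t. v t + w t) has_real_derivative - exp (k * x) * cut_pow p (v x)) (at x)"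
        by (auto intro!: derivative_eq_intros dv dw)
      then show "\<exists>y. ((\<lambda>t. v t + w t) has_real_derivative y) (at x) \<and> y \<le> 0"
        using cut_nonneg by (intro exI[of _ "- exp (k * x) * cut_pow p (v x)"]) auto
    qed
    then show ?thesis using pos[of s] by (simp add: Q_def)
  qed
  \<comment> \<open>The time at which the line of slope \<open>Q\<close> through
    \<open>(t, v t)\<close> reaches zero; \<open>v\<close> lies below this line.\<close>
  define s where "s = t + v t / (- Q)"
  have ts: "t < s" using Q pos[of t] by (simp add: s_def divide_pos_neg)
  obtain z where z: "t < z" "z < s" "v s - v t = (s - t) * w z"
    using MVT2[OF ts, of v w] dv by blast
  have "(s - t) * w z \<le> (s - t) * Q" using w_le z by (intro mult_left_mono) auto
  also have "\<dots> = - v t" using Q by (simp add: s_def)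
  finally show False using z pos[of s] by simp
qed

definition "LamMax = 5 / 4 * exp (p - 1)"

text \<open>Over a unit of time \<open>q\<close> rises by at most 1, so some \<open>z\<close> in
  between has \<open>Lam z \<le> 1 + q z * (1 - q z) \<le> 5 / 4\<close>. Since
  \<open>Lam' \<ge> - (p - 1) * Lam\<close>, at most a factor \<open>exp (p - 1)\<close> is lost
  between \<open>t\<close> and \<open>z\<close>. This explains \<open>LamMax\<close>.\<close>

lemma Lam_le:
  assumes pos: "\<And>t. v t > 0"
  shows "Lam t \<le> LamMax"
proof -
  have p1: "p - 1 > 0" using k p by simp
  have L: "Lam t * exp (- (p - 1)) \<le> Lam s" if "t \<le> s" "s \<le> t + 1" for s
  proof -
    have "exp ((p - 1) * t) * Lam t \<le> exp ((p - 1) * s) * Lam s"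
    proof (rule DERIV_nonneg_imp_nondecreasing[OF that(1)])
      fix x
      have "((\<lambda>t. exp ((p - 1) * t) * Lam t) has_real_derivative
          exp ((p - 1) * x) * ((p - 1) * (Lam x * (theta + (1 - q x))))) (at x)"
        by (auto intro!: derivative_eq_intros deriv_Lam pos simp: algebra_simps)
      moreover have "exp ((p - 1) * x) * ((p - 1) * (Lam x * (theta + (1 - q x)))) \<ge> 0"
        using p1 q_le_1[OF pos, of x] theta Lam_pos[OF pos[of x]]
        by (intro mult_nonneg_nonneg) auto
      ultimately show "\<exists>y. ((\<lambda>t. exp ((p - 1) * t) * Lam t) has_real_derivative y) (at x) \<and> 0 \<le> y" by blast
    qed
    then have "Lam t * exp ((p - 1) * t - (p - 1) * s) \<le> Lam s"
      by (simp add: exp_diff pos_divide_le_eq mult.commute)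
    moreover have "Lam t * exp (- (p - 1)) \<le> Lam t * exp ((p - 1) * t - (p - 1) * s)"
    proof -
      have "(p - 1) * (s - t) \<le> (p - 1) * 1" using p1 that by (intro mult_left_mono) auto
      then have "- (p - 1) \<le> (p - 1) * t - (p - 1) * s" by (simp add: algebra_simps)
      then show ?thesis using Lam_pos[OF pos[of t]] by simp
    qed
    ultimately show ?thesis by linarith
  qed
  obtain z where z: "t < z" "z < t + 1" "q (t + 1) - q t = (t + 1 - t) * (Lam z - q z * (1 - q z))"
    using MVT2[of t "t + 1" q "\<lambda>z. Lam z - q z * (1 - q z)"] deriv_q pos by auto
  have "q z * (1 - q z) \<le> 1 / 4" using zero_le_square[of "q z - 1/2"] by (simp add: algebra_simps)
  then have "Lam t * exp (- (p - 1)) \<le> 5 / 4"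
    using L[of z] z q_le_1[OF pos, of "t + 1"] q_pos[OF pos[of t]] by simp
  then show ?thesis by (simp add: LamMax_def exp_minus field_simps exp_diff)
qed

text \<open>A bounded \<open>Lam\<close> keeps \<open>v\<close> below a multiple of
  \<open>exp (- theta * t)\<close>.\<close>

lemma v_at_top:
  assumes pos: "\<And>t. v t > 0"
  shows "(v \<longlongrightarrow> 0) at_top"
proof -
  have p1: "p - 1 > 0" using k p by simp
  have v: "v = (\<lambda>t. (Lam t * exp (- k * t)) powr (1 / (p - 1)))"
    by (rule ext) (use p1 in \<open>simp add: Lam_def powr_powr exp_minus field_simps abs_of_pos[OF pos]\<close>)
  have e: "((\<lambda>t. exp (- k * t)) \<longlongrightarrow> 0) at_top"
    using k by (intro filterlim_compose[OF exp_at_bot] filterlim_tendsto_neg_mult_at_bot[OF tendsto_const] filterlim_ident) auto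
  have "((\<lambda>t. Lam t * exp (- k * t)) \<longlongrightarrow> 0) at_top"
  proof (rule Lim_null_comparison)
    show "\<forall>\<^sub>F t in at_top. norm (Lam t * exp (- k * t)) \<le> LamMax * exp (- k * t)"
      using Lam_le[OF pos] Lam_pos[OF pos] by (intro always_eventually) (auto simp: abs_mult abs_of_pos)
    show "((\<lambda>t. LamMax * exp (- k * t)) \<longlongrightarrow> 0) at_top"
      using tendsto_mult[OF tendsto_const e, of LamMax] by simp
  qed
  then show ?thesis
    using p1 Lam_pos[OF pos] by (subst v, intro tendsto_zero_powrI[OF _ tendsto_const])
      (auto intro!: always_eventually simp: less_imp_le)
qed

end

context singular_orbit begin

subsection \<open>Energy and convergence\<close>

text \<open>Twice the mechanical energy of \<open>y'' + (1 - 2 \<theta>) y' - \<theta> (1 - \<theta>) y + y\<^sup>p = 0\<close>, divided by \<open>y\<^sup>2\<close>.\<close>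

definition "H t = (theta - q t)\<^sup>2 - theta * (1 - theta) + 2 / (p + 1) * Lam t"

definition "energy t = (y t)\<^sup>2 * H t"

lemma p_gt_1: "p > 1" using k p by simp

lemma theta_sq: "theta * (1 - theta) > 0" using theta by simp

text \<open>This is the equation for \<open>y\<close> multiplied by \<open>2 * y'\<close>, where
  \<open>y' = y * (theta - q)\<close>: the conservative terms cancel and the friction term remains.
  The factor \<open>2 / (p + 1)\<close> in \<open>H\<close> is what removes
  \<open>Lam * (theta - q)\<close>.\<close>

lemma deriv_energy:
  assumes "v t > 0"
  shows "(energy has_real_derivative 2 * (2 * theta - 1) * (y t)\<^sup>2 * (theta - q t)\<^sup>2) (at t)"
proof -
  define d where "d = Lam t - q t * (1 - q t)"
  define e where "e = (p - 1) * Lam t * (theta - q t)"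
  define c where "c = 2 / (p + 1)"
  have c: "c * (p + 1) = 2" using p_gt_1 by (simp add: c_def field_simps)
  have dH: "(H has_real_derivative - 2 * (theta - q t) * d + c * e) (at t)"
    unfolding H_def d_def e_def c_def[symmetric]
    by (auto intro!: derivative_eq_intros deriv_q[OF assms] deriv_Lam[OF assms] simp: algebra_simps)
  have dy: "((\<lambda>t. (y t)\<^sup>2) has_real_derivative 2 * (y t)\<^sup>2 * (theta - q t)) (at t)"
    by (auto intro!: derivative_eq_intros deriv_y[OF assms] simp: power2_eq_square)
  have "2 * (theta - q t) * H t + (- 2 * (theta - q t) * d + c * e) - 2 * (2 * theta - 1) * (theta - q t)\<^sup>2
      = (c * (p + 1) - 2) * (Lam t * (theta - q t))"
    unfolding H_def d_def e_def c_def[symmetric] by (simp add: algebra_simps power2_eq_square)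
  then have "2 * (theta - q t) * H t + (- 2 * (theta - q t) * d + c * e)
      = 2 * (2 * theta - 1) * (theta - q t)\<^sup>2"
    unfolding c by simp
  moreover have "2 * (y t)\<^sup>2 * (theta - q t) * H t + (- 2 * (theta - q t) * d + c * e) * (y t)\<^sup>2
      = (y t)\<^sup>2 * (2 * (theta - q t) * H t + (- 2 * (theta - q t) * d + c * e))"
    by (simp only: distrib_left distrib_right mult_ac)
  ultimately have "2 * (y t)\<^sup>2 * (theta - q t) * H t + (- 2 * (theta - q t) * d + c * e) * (y t)\<^sup>2
      = 2 * (2 * theta - 1) * (y t)\<^sup>2 * (theta - q t)\<^sup>2"
    by simp
  then show ?thesis
    unfolding energy_def using DERIV_mult[OF dy dH] by simp
qed

lemma energy_at_bot: "(energy \<longlongrightarrow> 0) at_bot"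
proof -
  have "((\<lambda>t. (y t)\<^sup>2 * H t) \<longlongrightarrow> 0\<^sup>2 * ((theta - 0)\<^sup>2 - theta * (1 - theta) + 2 / (p + 1) * 0)) at_bot"
    unfolding H_def by (intro tendsto_intros y_at_bot q_at_bot Lam_at_bot)
  then show ?thesis by (simp add: energy_def[abs_def])
qed

text \<open>The friction coefficient \<open>1 - 2 * theta\<close> is nonpositive here, so the energy
  cannot fall below its limit 0 at \<open>-\<infinity>\<close>.\<close>

lemma H_nonneg:
  assumes "theta \<ge> 1 / 2" "v t > 0"
  shows "H t \<ge> 0"
proof -
  have "energy s \<le> energy t" if "s \<le> t" for s
  proof (rule DERIV_nonneg_imp_nondecreasing[OF that])
    fix x assume "x \<le> t"
    then have "v x > 0" using v_pos_downward assms by blast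
    from deriv_energy[OF this] assms(1)
    show "\<exists>y. (energy has_real_derivative y) (at x) \<and> 0 \<le> y" by fastforce
  qed
  then have "0 \<le> energy t"
    by (intro tendsto_upperbound[OF energy_at_bot]) (auto simp: eventually_at_bot_linorder)
  then show ?thesis using y_pos[OF assms(2)] by (simp add: energy_def zero_le_mult_iff)
qed

lemma energy_antimono:
  assumes "theta < 1 / 2" "v t > 0" "s \<le> t"
  shows "energy t \<le> energy s"
proof (rule DERIV_nonpos_imp_nonincreasing[OF assms(3)])
  fix x assume "x \<le> t"
  then have "v x > 0" using v_pos_downward assms by blast
  from deriv_energy[OF this] assms(1)
  show "\<exists>y. (energy has_real_derivative y) (at x) \<and> y \<le> 0"
    by (auto intro!: exI mult_nonpos_nonneg)
qed

text \<open>Monotonicity alone gives only a nonpositive energy. Strictness comes from a stretch near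
  \<open>-\<infinity>\<close> on which \<open>q < theta\<close>, so that the dissipation is
  nonzero.\<close>

lemma energy_neg:
  assumes "theta < 1 / 2" "v t > 0"
  shows "energy t < 0"
proof -
  obtain b where b: "\<And>s. s \<le> b \<Longrightarrow> q s < theta"
    using order_tendstoD(2)[OF q_at_bot theta(1)] unfolding eventually_at_bot_linorder by blast
  define a where "a = min t b"
  have vp: "v x > 0" if "x \<le> t" for x using v_pos_downward assms that by blast
  have "energy a < energy (a - 1)"
  proof (rule DERIV_neg_imp_decreasing[where f = energy])
    fix x assume "a - 1 \<le> x" "x \<le> a"
    then have x: "v x > 0" "q x < theta" using vp b by (auto simp: a_def)
    then have "2 * (2 * theta - 1) * (y x)\<^sup>2 * (theta - q x)\<^sup>2 < 0"
      using assms y_pos[of x] by (intro mult_neg_pos[OF mult_neg_pos]) auto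
    with deriv_energy[OF x(1)] show "\<exists>y. (energy has_real_derivative y) (at x) \<and> y < 0" by blast
  qed simp
  also have "energy (a - 1) \<le> 0"
  proof (rule tendsto_lowerbound[OF energy_at_bot])
    show "\<forall>\<^sub>F s in at_bot. energy (a - 1) \<le> energy s"
      using eventually_le_at_bot[of "a - 1"]
      by eventually_elim (rule energy_antimono, use assms vp in \<open>auto simp: a_def\<close>)
  qed simp
  finally show ?thesis using energy_antimono[OF assms, of a] by (simp add: a_def)
qed

text \<open>Negative energy confines \<open>q\<close> to the strip
  \<open>(theta - q)\<^sup>2 < theta * (1 - theta)\<close>. As \<open>theta < 1 - theta\<close>, the
  strip ends before \<open>q = 1\<close>.\<close>

lemma v_pos_supercritical:
  assumes "theta < 1 / 2"
  shows "v t > 0"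
proof (rule positive_if_q_le_1)
  fix t assume t: "v t > 0"
  have "H t < 0" using energy_neg[OF assms t] by (auto simp: energy_def mult_less_0_iff)
  moreover have "2 / (p + 1) * Lam t > 0" using Lam_pos[OF t] p_gt_1 by simp
  ultimately have "(theta - q t)\<^sup>2 < theta * (1 - theta)"
    unfolding H_def by linarith
  also have "\<dots> < (1 - theta) * (1 - theta)"
    using assms theta by (intro mult_strict_right_mono) auto
  also have "\<dots> = (theta - 1)\<^sup>2" by (simp add: power2_eq_square algebra_simps)
  finally have "\<bar>theta - q t\<bar> < \<bar>theta - 1\<bar>" using abs_le_square_iff linorder_not_le by blast
  then show "q t \<le> 1" using theta by linarith
qed

section \<open>Limits along an orbit that stays positive\<close>

context
  assumes pos: "\<And>t. v t > 0"
begin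

lemma bounds: "0 < q t" "q t \<le> 1" "0 < Lam t" "Lam t \<le> LamMax" "\<bar>q t\<bar> \<le> 1" "\<bar>Lam t\<bar> \<le> LamMax"
  "\<bar>theta - q t\<bar> \<le> 1" "\<bar>1 - 2 * q t\<bar> \<le> 1" "\<bar>1 - q t\<bar> \<le> 1"
  using q_pos[OF pos, of t] q_le_1[OF pos, of t] Lam_pos[OF pos, of t] Lam_le[OF pos, of t] theta by auto

lemma LamMax_pos: "LamMax > 0" by (simp add: LamMax_def)

lemma q_deriv_bound: "\<bar>Lam t - q t * (1 - q t)\<bar> \<le> LamMax + 1"
proof -
  have "\<bar>q t * (1 - q t)\<bar> \<le> 1 * 1" unfolding abs_mult by (intro mult_mono bounds) auto
  then show ?thesis using bounds(6)[of t] by linarith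
qed

text \<open>Barbalat's lemma for \<open>q\<close> gives \<open>q' \<rightarrow> 0\<close>, and
  \<open>Lam\<close> equals \<open>q' + q * (1 - q)\<close>.\<close>

lemma Lam_tendsto:
  assumes "(q \<longlongrightarrow> theta) at_top"
  shows "(Lam \<longlongrightarrow> theta * (1 - theta)) at_top"
proof -
  let ?q' = "\<lambda>t. Lam t - q t * (1 - q t)"
  have "(?q' \<longlongrightarrow> 0) at_top"
  proof (rule barbalat[OF deriv_q[OF pos] _ _ assms])
    fix t
    show "(?q' has_real_derivative (p - 1) * (Lam t * (theta - q t)) - (1 - 2 * q t) * ?q' t) (at t)"
      by (auto intro!: derivative_eq_intros deriv_q[OF pos] deriv_Lam[OF pos] simp: algebra_simps)
    have "\<bar>(p - 1) * (Lam t * (theta - q t))\<bar> \<le> (p - 1) * (LamMax * 1)"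
      unfolding abs_mult using p_gt_1 LamMax_pos by (intro mult_mono bounds) (auto intro: mult_nonneg_nonneg)
    moreover have "\<bar>(1 - 2 * q t) * ?q' t\<bar> \<le> 1 * (LamMax + 1)"
      unfolding abs_mult by (intro mult_mono bounds q_deriv_bound) auto
    ultimately show "\<bar>(p - 1) * (Lam t * (theta - q t)) - (1 - 2 * q t) * ?q' t\<bar>
        \<le> (p - 1) * (LamMax * 1) + 1 * (LamMax + 1)"
      by (intro order_trans[OF abs_triangle_ineq4 add_mono])
  qed
  then have "((\<lambda>t. ?q' t + q t * (1 - q t)) \<longlongrightarrow> 0 + theta * (1 - theta)) at_top"
    by (intro tendsto_add tendsto_mult tendsto_diff tendsto_const assms)
  then show ?thesis by simp
qed

text \<open>Barbalat's lemma for \<open>Lam\<close> gives \<open>Lam' \<rightarrow> 0\<close>; the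
  factor \<open>Lam\<close> in \<open>Lam'\<close> can be divided out because its limit is
  positive.\<close>

lemma q_tendsto_if_Lam_tendsto:
  assumes lim: "(Lam \<longlongrightarrow> l) at_top" and l: "l > 0"
  shows "(q \<longlongrightarrow> theta) at_top"
proof -
  let ?L' = "\<lambda>t. (p - 1) * Lam t * (theta - q t)"
  have L': "(?L' \<longlongrightarrow> 0) at_top"
  proof (rule barbalat[OF deriv_Lam[OF pos] _ _ lim])
    fix t
    show "(?L' has_real_derivative (p - 1) * (?L' t * (theta - q t) - Lam t * (Lam t - q t * (1 - q t)))) (at t)"
      by (auto intro!: derivative_eq_intros deriv_q[OF pos] deriv_Lam[OF pos] simp: algebra_simps)
    have L0: "\<bar>(p - 1) * Lam t\<bar> \<le> (p - 1) * LamMax"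
      using p_gt_1 bounds(6)[of t] by (simp add: abs_mult)
    have L1: "\<bar>?L' t\<bar> \<le> (p - 1) * LamMax * 1"
      unfolding abs_mult[of "(p - 1) * Lam t"] using p_gt_1 LamMax_pos
      by (intro mult_mono L0 bounds) auto
    have "\<bar>?L' t * (theta - q t)\<bar> \<le> ((p - 1) * LamMax * 1) * 1"
      unfolding abs_mult[of "?L' t"] using p_gt_1 LamMax_pos
      by (intro mult_mono bounds L1) auto
    moreover have "\<bar>Lam t * (Lam t - q t * (1 - q t))\<bar> \<le> LamMax * (LamMax + 1)"
      unfolding abs_mult[of "Lam t"] using LamMax_pos
      by (intro mult_mono bounds q_deriv_bound) auto
    ultimately have "\<bar>?L' t * (theta - q t) - Lam t * (Lam t - q t * (1 - q t))\<bar>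
      \<le> (p - 1) * LamMax * 1 * 1 + LamMax * (LamMax + 1)"
      by (intro order_trans[OF abs_triangle_ineq4 add_mono])
    then have "(p - 1) * \<bar>?L' t * (theta - q t) - Lam t * (Lam t - q t * (1 - q t))\<bar>
        \<le> (p - 1) * ((p - 1) * LamMax * 1 * 1 + LamMax * (LamMax + 1))"
      using p_gt_1 by (intro mult_left_mono) auto
    then show "\<bar>(p - 1) * (?L' t * (theta - q t) - Lam t * (Lam t - q t * (1 - q t)))\<bar>
        \<le> (p - 1) * ((p - 1) * LamMax * 1 * 1 + LamMax * (LamMax + 1))"
      using p_gt_1 by (simp add: abs_mult)
  qed
  have "((\<lambda>t. theta - ?L' t / ((p - 1) * Lam t)) \<longlongrightarrow> theta - 0 / ((p - 1) * l)) at_top"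
    using l p_gt_1 by (intro tendsto_intros L' lim) auto
  moreover have "theta - ?L' t / ((p - 1) * Lam t) = q t" for t
    using bounds(3)[of t] p_gt_1 by simp
  ultimately show ?thesis by simp
qed

text \<open>A positive limit would force convergence to the equilibrium, where \<open>H\<close>
  equals \<open>- (p - 1) / (p + 1) * theta * (1 - theta)\<close>. The sign of the energy forbids
  this.\<close>

lemma Lam_not_tendsto_subcritical:
  assumes "theta \<ge> 1 / 2" and lim: "(Lam \<longlongrightarrow> l) at_top" and l: "l > 0"
  shows False
proof -
  note q = q_tendsto_if_Lam_tendsto[OF lim l]
  have "(H \<longlongrightarrow> (theta - theta)\<^sup>2 - theta * (1 - theta) + 2 / (p + 1) * (theta * (1 - theta))) at_top"
    unfolding H_def by (intro tendsto_intros q Lam_tendsto)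
  then have "0 \<le> (theta - theta)\<^sup>2 - theta * (1 - theta) + 2 / (p + 1) * (theta * (1 - theta))"
    by (rule tendsto_lowerbound) (use H_nonneg[OF assms(1) pos] in auto)
  also have "\<dots> = (2 / (p + 1) - 1) * (theta * (1 - theta))" by (simp add: algebra_simps)
  also have "\<dots> < 0" using p_gt_1 theta_sq by (intro mult_neg_pos) (auto simp: field_simps)
  finally show False by simp
qed

lemma y_le: "y t \<le> LamMax powr (1 / (p - 1))"
proof -
  have "y t = Lam t powr (1 / (p - 1))"
    using y_powr[OF pos[of t]] y_pos[OF pos[of t]] p_gt_1 by (simp add: powr_powr flip: y_powr[OF pos[of t]])
  then show ?thesis using bounds[of t] p_gt_1 by (auto intro!: powr_mono2)
qed

text \<open>The energy decreases and is bounded below, so it converges, and Barbalat's lemma makes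
  the dissipation, a multiple of \<open>(y t)\<^sup>2 * (theta - q t)\<^sup>2\<close>, tend to 0. It
  remains to keep \<open>y\<close> away from 0.\<close>

lemma q_tendsto_supercritical:
  assumes th: "theta < 1 / 2"
  shows "(q \<longlongrightarrow> theta) at_top"
proof -
  define Y where "Y = (LamMax powr (1 / (p - 1)))\<^sup>2"
  have Y: "(y t)\<^sup>2 \<le> Y" for t
    unfolding Y_def using y_le[of t] y_pos[OF pos[of t]] by (intro power_mono) auto
  have Y0: "Y \<ge> 0" by (simp add: Y_def)
  have H: "- (theta * (1 - theta)) \<le> H t" for t
    using bounds(3)[of t] p_gt_1 unfolding H_def by simp
  have yH: "- ((y t)\<^sup>2 * (theta * (1 - theta))) \<le> energy t" for t
    unfolding energy_def using mult_left_mono[OF H[of t], of "(y t)\<^sup>2"] by simp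
  have "- (Y * (theta * (1 - theta))) \<le> energy t" for t
    using yH[of t] mult_right_mono[OF Y[of t] less_imp_le[OF theta_sq]] by linarith
  then obtain l where lim: "(energy \<longlongrightarrow> l) at_top"
    using antimono_bounded_below_tendsto[of 0 energy] energy_antimono[OF th pos] by metis
  let ?E' = "\<lambda>t. 2 * (2 * theta - 1) * (y t)\<^sup>2 * (theta - q t)\<^sup>2"
  let ?q' = "\<lambda>t. Lam t - q t * (1 - q t)"
  have "(?E' \<longlongrightarrow> 0) at_top"
  proof (rule barbalat[OF deriv_energy[OF pos] _ _ lim])
    fix t
    let ?E'' = "2 * (2 * theta - 1) * ((y t)\<^sup>2 * (2 * (theta - q t) * ((theta - q t)\<^sup>2 - ?q' t)))"
    show "(?E' has_real_derivative ?E'') (at t)"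
      by (auto intro!: derivative_eq_intros deriv_y[OF pos] deriv_q[OF pos]) (simp add: algebra_simps power2_eq_square power3_eq_cube)
    have "\<bar>(theta - q t)\<^sup>2\<bar> \<le> 1" using bounds(7)[of t] by (simp add: abs_square_le_1)
    then have 1: "\<bar>(theta - q t)\<^sup>2 - ?q' t\<bar> \<le> LamMax + 2" using q_deriv_bound[of t] by linarith
    have 2: "\<bar>2 * (theta - q t)\<bar> \<le> 2" using bounds(7)[of t] by (simp add: abs_mult)
    have "\<bar>?E''\<bar> = \<bar>2 * (2 * theta - 1)\<bar> * ((y t)\<^sup>2 * (\<bar>2 * (theta - q t)\<bar> * \<bar>(theta - q t)\<^sup>2 - ?q' t\<bar>))"
      by (simp add: abs_mult)
    also have "\<dots> \<le> \<bar>2 * (2 * theta - 1)\<bar> * (Y * (2 * (LamMax + 2)))"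
      using 1 2 Y LamMax_pos Y0 by (intro mult_left_mono mult_mono) auto
    finally show "\<bar>?E''\<bar> \<le> \<bar>2 * (2 * theta - 1)\<bar> * (Y * (2 * (LamMax + 2)))" .
  qed
  \<comment> \<open>The chain \<open>- (y t)\<^sup>2 * (theta * (1 - theta)) \<le> energy t \<le>
    energy 0 < 0\<close> makes \<open>c\<close> a positive lower bound of
    \<open>(y t)\<^sup>2\<close> for \<open>t \<ge> 0\<close>.\<close>
  define c where "c = - energy 0 / (theta * (1 - theta))"
  have c: "c > 0" using energy_neg[OF th pos, of 0] theta_sq by (simp add: c_def divide_neg_pos)
  have yc: "c \<le> (y t)\<^sup>2" if "t \<ge> 0" for t
    unfolding c_def pos_divide_le_eq[OF theta_sq]
    using yH[of t] energy_antimono[OF th pos that] by linarith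
  define b where "b = 2 * (1 - 2 * theta) * c"
  have b: "b > 0" using th c by (simp add: b_def)
  have "((\<lambda>t. (theta - q t)\<^sup>2) \<longlongrightarrow> 0) at_top"
  proof (rule Lim_null_comparison)
    show "((\<lambda>t. - ?E' t / b) \<longlongrightarrow> 0) at_top"
      using tendsto_divide[OF tendsto_minus[OF \<open>(?E' \<longlongrightarrow> 0) at_top\<close>] tendsto_const[of b]] b by simp
    show "\<forall>\<^sub>F t in at_top. norm ((theta - q t)\<^sup>2) \<le> - ?E' t / b"
      using eventually_ge_at_top[of 0]
    proof eventually_elim
      case (elim t)
      have "2 * (1 - 2 * theta) * (theta - q t)\<^sup>2 * c \<le> 2 * (1 - 2 * theta) * (theta - q t)\<^sup>2 * (y t)\<^sup>2"
        using th by (intro mult_left_mono yc elim) auto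
      then show ?case using b by (simp add: pos_le_divide_eq b_def algebra_simps)
    qed
  qed
  then have "((\<lambda>t. sqrt ((theta - q t)\<^sup>2)) \<longlongrightarrow> sqrt 0) at_top" by (rule tendsto_real_sqrt)
  then have "((\<lambda>t. theta - q t) \<longlongrightarrow> 0) at_top" by (simp add: tendsto_rabs_zero_iff)
  then have "((\<lambda>t. theta - (theta - q t)) \<longlongrightarrow> theta - 0) at_top" by (intro tendsto_diff tendsto_const)
  then show ?thesis by simp
qed

text \<open>Backward uniqueness by Gronwall's argument: \<open>exp (K * t) * Phi t\<close> does not
  decrease, so a zero of the squared distance \<open>Phi\<close> propagates to all earlier times.
  Then \<open>q\<close> would be constantly \<open>theta\<close> near \<open>-\<infinity>\<close>,
  where its limit is 0.\<close>

lemma not_equilibrium: "\<not> (Lam t1 = theta * (1 - theta) \<and> q t1 = theta)"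
proof
  assume eq: "Lam t1 = theta * (1 - theta) \<and> q t1 = theta"
  define X where "X t = Lam t - theta * (1 - theta)" for t
  define Y where "Y t = q t - theta" for t
  define Phi where "Phi t = (X t)\<^sup>2 + (Y t)\<^sup>2" for t
  \<comment> \<open>The derivative of \<open>Phi\<close> is at least
    \<open>- ((p - 1) * LamMax + 3) * Phi\<close>: the coupling in \<open>X'\<close> costs the first
    term, the product \<open>X * Y\<close> costs 1 and the square of \<open>Y\<close> costs
    2.\<close>
  define K where "K = (p - 1) * LamMax + 5"
  have dX: "(X has_real_derivative - (p - 1) * Lam t * Y t) (at t)" for t
    unfolding X_def Y_def by (auto intro!: derivative_eq_intros deriv_Lam[OF pos] simp: algebra_simps)
  have dY: "(Y has_real_derivative X t - Y t * (1 - theta - q t)) (at t)" for t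
    unfolding X_def Y_def by (auto intro!: derivative_eq_intros deriv_q[OF pos] simp: algebra_simps)
  have Phi_le: "exp (K * t) * Phi t \<le> exp (K * t1) * Phi t1" if "t \<le> t1" for t
  proof (rule DERIV_nonneg_imp_nondecreasing[where f = "\<lambda>t. exp (K * t) * Phi t", OF that])
    fix x
    define D where "D = 2 * X x * (- (p - 1) * Lam x * Y x) + 2 * Y x * (X x - Y x * (1 - theta - q x))"
    have "((\<lambda>t. exp (K * t) * Phi t) has_real_derivative exp (K * x) * (K * Phi x + D)) (at x)"
      unfolding Phi_def D_def by (auto intro!: derivative_eq_intros dX dY simp: algebra_simps)
    moreover have "K * Phi x + D \<ge> 0"
    proof -
      have XY: "\<bar>2 * X x * Y x\<bar> \<le> Phi x"
        using sum_squares_bound[of "\<bar>X x\<bar>" "\<bar>Y x\<bar>"] by (simp add: Phi_def abs_mult)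
      have "\<bar>((p - 1) * Lam x) * (2 * X x * Y x)\<bar> \<le> ((p - 1) * LamMax) * Phi x"
        unfolding abs_mult[of "(p - 1) * Lam x"] using XY p_gt_1 LamMax_pos bounds(3,4)[of x]
        by (intro mult_mono) (auto simp: abs_mult)
      moreover have "\<bar>(2 * (Y x)\<^sup>2) * (1 - theta - q x)\<bar> \<le> (2 * Phi x) * 1"
        unfolding abs_mult[of "2 * (Y x)\<^sup>2"] using bounds(1,2)[of x] theta
        by (intro mult_mono) (auto simp: Phi_def abs_le_iff)
      moreover have "D = - (((p - 1) * Lam x) * (2 * X x * Y x)) + 2 * X x * Y x - (2 * (Y x)\<^sup>2) * (1 - theta - q x)"
        by (simp add: D_def algebra_simps power2_eq_square)
      moreover have "K * Phi x = ((p - 1) * LamMax) * Phi x + 5 * Phi x" by (simp add: K_def algebra_simps)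
      moreover have "Phi x \<ge> 0" by (simp add: Phi_def)
      ultimately show ?thesis using XY by (simp only:)
    qed
    ultimately show "\<exists>y. ((\<lambda>t. exp (K * t) * Phi t) has_real_derivative y) (at x) \<and> 0 \<le> y"
      by (intro exI[of _ "exp (K * x) * (K * Phi x + D)"]) auto
  qed
  have "Phi t1 = 0" using eq by (simp add: Phi_def X_def Y_def)
  have q_eq: "q t = theta" if "t \<le> t1" for t
  proof -
    have "exp (K * t) * Phi t \<le> 0" using Phi_le[OF that] \<open>Phi t1 = 0\<close> by simp
    then have "Phi t \<le> 0" by (simp add: mult_le_0_iff)
    then have "(Y t)\<^sup>2 \<le> 0" unfolding Phi_def using zero_le_power2[of "X t"] by linarith
    then show ?thesis by (simp add: Y_def)
  qed
  have "(q \<longlongrightarrow> theta) at_bot"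
    by (rule tendsto_eventually) (use q_eq in \<open>auto simp: eventually_at_bot_linorder\<close>)
  then show False using tendsto_unique[OF _ q_at_bot] theta(1) by fastforce
qed

end

end

subsection \<open>Oscillation and monotonicity\<close>

lemma alternating_signs:
  fixes f :: "real \<Rightarrow> real"
  assumes "\<And>T. \<exists>t>T. f t > 0" "\<And>T. \<exists>t>T. f t < 0"
  obtains b :: "nat \<Rightarrow> real" where "strict_mono b" "\<And>n. f (b n) * f (b (Suc n)) < 0"
proof -
  have "\<exists>b. \<forall>n. (if even n then f (b n) > 0 else f (b n) < 0) \<and> b n < b (Suc n)"
    by (rule dependent_nat_choice) (use assms in auto)
  then obtain b where b: "\<And>n. if even n then f (b n) > 0 else f (b n) < 0" "\<And>n. b n < b (Suc n)"
    by blast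
  show ?thesis
  proof (rule that)
    show "strict_mono b" using b(2) by (rule strict_monoI_Suc)
    fix n show "f (b n) * f (b (Suc n)) < 0"
      using b(1)[of n] b(1)[of "Suc n"] by (cases "even n") (auto intro: mult_pos_neg mult_neg_pos)
  qed
qed

text \<open>The maximum over an interval with negative end values and a positive value inside is
  attained in the interior.\<close>

lemma oscillation_local_max:
  fixes f :: "real \<Rightarrow> real"
  assumes pos: "\<And>T. \<exists>t>T. f t > 0" and neg: "\<And>T. \<exists>t>T. f t < 0" and cont: "continuous_on UNIV f"
  obtains t where "t > T" "\<forall>\<^sub>F s in nhds t. f s \<le> f t"
proof -
  obtain a where a: "a > T" "f a < 0" using neg by blast
  obtain b where b: "b > a" "f b > 0" using pos by blast
  obtain c where c: "c > b" "f c < 0" using neg by blast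
  obtain t where t: "t \<in> {a..c}" "\<And>s. s \<in> {a..c} \<Longrightarrow> f s \<le> f t"
    using continuous_attains_sup[of "{a..c}" f] b c continuous_on_subset[OF cont] by auto
  have "f t > 0" using t(2)[of b] b c by auto
  then have "t \<in> {a<..<c}" using t(1) a c by (auto simp: less_le)
  then have "\<forall>\<^sub>F s in nhds t. s \<in> {a<..<c}" by (intro eventually_nhds_in_open) auto
  then have "\<forall>\<^sub>F s in nhds t. f s \<le> f t" by eventually_elim (use t in auto)
  then show ?thesis using \<open>t \<in> {a<..<c}\<close> a by (intro that[of t]) auto
qed

text \<open>The first hypothesis makes the discriminant of
  \<open>(1 - d) - B * z + (A - d) * z\<^sup>2\<close> nonpositive. Completing the square with
  respect to the constant term requires no division by \<open>A - d\<close>.\<close>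

lemma quadratic_form_lower_bound:
  fixes A B d z :: real
  assumes "B\<^sup>2 \<le> 4 * (A - d) * (1 - d)" "d < 1"
  shows "d * (1 + z\<^sup>2) \<le> 1 - B * z + A * z\<^sup>2"
proof -
  have "0 \<le> (2 * (1 - d) - B * z)\<^sup>2 + z\<^sup>2 * (4 * (A - d) * (1 - d) - B\<^sup>2)"
    using assms by simp
  also have "\<dots> = 4 * (1 - d) * (1 - B * z + A * z\<^sup>2 - d * (1 + z\<^sup>2))"
    by (simp add: power2_eq_square algebra_simps)
  finally show ?thesis using assms(2) by (simp add: zero_le_mult_iff)
qed

section \<open>Crossings of \<open>q = theta\<close>, rotation and trapping\<close>

context singular_orbit begin

lemma cont_q: "v t > 0 \<Longrightarrow> isCont q t" and cont_Lam: "v t > 0 \<Longrightarrow> isCont Lam t"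
  using deriv_q deriv_Lam by (blast intro: DERIV_isCont)+

lemma q_below_theta_at_bot:
  obtains b where "b \<le> c" "\<And>s. s \<le> b \<Longrightarrow> q s < theta"
proof -
  obtain b where "\<And>s. s \<le> b \<Longrightarrow> q s < theta"
    using order_tendstoD(2)[OF q_at_bot theta(1)] unfolding eventually_at_bot_linorder by blast
  then show ?thesis using that[of "min b c"] by auto
qed

lemma Lam_strict_mono:
  assumes "a < b" "v b > 0" "\<And>t. a < t \<Longrightarrow> t < b \<Longrightarrow> q t < theta"
  shows "Lam a < Lam b"
proof (rule DERIV_pos_imp_increasing_open[OF assms(1)])
  fix t assume t: "a < t" "t < b"
  then have "v t > 0" using v_pos_downward assms(2) by auto
  from deriv_Lam[OF this] Lam_pos[OF this] assms(3)[OF t] p_gt_1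
  show "\<exists>y. (Lam has_real_derivative y) (at t) \<and> 0 < y" by (auto intro!: exI mult_pos_pos)
qed (use cont_Lam v_pos_downward assms(2) in \<open>auto intro!: continuous_at_imp_continuous_on\<close>)

lemma Lam_strict_antimono:
  assumes "a < b" "v b > 0" "\<And>t. a < t \<Longrightarrow> t < b \<Longrightarrow> q t > theta"
  shows "Lam b < Lam a"
proof (rule DERIV_neg_imp_decreasing_open[OF assms(1)])
  fix t assume t: "a < t" "t < b"
  then have "v t > 0" using v_pos_downward assms(2) by auto
  from deriv_Lam[OF this] Lam_pos[OF this] assms(3)[OF t] p_gt_1
  show "\<exists>y. (Lam has_real_derivative y) (at t) \<and> y < 0" by (auto intro!: exI mult_pos_neg)
qed (use cont_Lam v_pos_downward assms(2) in \<open>auto intro!: continuous_at_imp_continuous_on\<close>)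

lemma Lam_at_zero:
  assumes "v T = 0"
  shows "(Lam \<longlongrightarrow> 0) (at_left T)"
proof -
  have v: "v t > 0" if "t < T" for t using v_strict_antimono[OF that] assms by simp
  have "(v \<longlongrightarrow> 0) (at_left T)"
    using cont_v[of T] assms by (auto simp: isCont_def intro: filterlim_mono[OF _ order_refl at_le])
  then have "((\<lambda>t. v t powr (p - 1)) \<longlongrightarrow> 0) (at_left T)"
    using p_gt_1 v by (intro tendsto_zero_powrI[OF _ tendsto_const])
      (auto simp: eventually_at_filter less_imp_le intro!: always_eventually)
  then have "((\<lambda>t. exp (k * t) * v t powr (p - 1)) \<longlongrightarrow> exp (k * T) * 0) (at_left T)"
    by (intro tendsto_intros)
  then show ?thesis by (simp add: Lam_def[abs_def])
qed

text \<open>If \<open>q\<close> stayed below \<open>theta\<close>, then \<open>v\<close> would stay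
  positive and \<open>Lam\<close> would increase to a positive limit, which is excluded. At any
  crossing \<open>H \<ge> 0\<close> yields
  \<open>theta * (1 - theta) \<le> 2 / (p + 1) * Lam < Lam\<close>, hence \<open>q' > 0\<close>:
  every crossing is upward, so there is only one.\<close>

lemma turning_time:
  assumes th: "theta \<ge> 1 / 2"
  shows "\<exists>t0. v t0 > 0 \<and> (\<forall>t<t0. q t < theta) \<and> (\<forall>t>t0. v t > 0 \<longrightarrow> theta < q t)"
proof -
  have "\<exists>t. v t > 0 \<and> q t \<ge> theta"
  proof (rule ccontr)
    assume "\<not> (\<exists>t. v t > 0 \<and> q t \<ge> theta)"
    then have less: "q t < theta" if "v t > 0" for t using that by force
    have pos: "v t > 0" for t
    proof (rule positive_if_q_le_1)
      show "q s \<le> 1" if "v s > 0" for s using less[OF that] theta(2) by simp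
    qed
    have mono: "Lam s \<le> Lam t" if "s \<le> t" for s t
    proof (cases "s = t")
      case False
      then have "Lam s < Lam t" using that less pos by (intro Lam_strict_mono) auto
      then show ?thesis by simp
    qed simp
    obtain l where l: "(Lam \<longlongrightarrow> l) at_top" "\<And>t. 0 \<le> t \<Longrightarrow> Lam t \<le> l"
      by (rule mono_bounded_above_tendsto[of 0 Lam LamMax]) (use mono Lam_le[OF pos] in auto)
    have "l > 0" using l(2)[of 0] Lam_pos[OF pos[of 0]] by simp
    with Lam_not_tendsto_subcritical[OF pos th l(1)] show False .
  qed
  then obtain c where c: "v c > 0" "q c \<ge> theta" by blast
  obtain b where b: "b \<le> c" "\<And>s. s \<le> b \<Longrightarrow> q s < theta" using q_below_theta_at_bot by blast
  have "\<exists>t. b \<le> t \<and> t \<le> c \<and> q t = theta"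
    using b c v_pos_downward by (intro IVT[of q b theta c]) (auto intro!: cont_q less_imp_le)
  then obtain t0 where t0: "t0 \<le> c" "q t0 = theta" by blast
  have v0: "v t0 > 0" using v_pos_downward c t0 by blast
  have up: "Lam t - q t * (1 - q t) > 0" if "v t > 0" "q t = theta" for t
  proof -
    have "theta * (1 - theta) \<le> 2 / (p + 1) * Lam t"
      using H_nonneg[OF th that(1)] that(2) by (simp add: H_def)
    also have "\<dots> < 1 * Lam t"
      using p_gt_1 Lam_pos[OF that(1)] by (intro mult_strict_right_mono) auto
    finally show ?thesis using that by simp
  qed
  have cross: "q t2 > theta" if "t1 < t2" "v t2 > 0" "q t1 \<ge> theta" for t1 t2
  proof -
    have "q t2 - theta > 0"
    proof (rule positive_after_upcrossing[OF _ _ that(1)])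
      fix t assume "t1 \<le> t" "t \<le> t2"
      then have vt: "v t > 0" using v_pos_downward that by blast
      show "((\<lambda>t. q t - theta) has_real_derivative Lam t - q t * (1 - q t)) (at t)"
        by (auto intro!: derivative_eq_intros deriv_q[OF vt])
      show "Lam t - q t * (1 - q t) > 0" if "q t - theta = 0" using up[OF vt] that by simp
    qed (use that in simp)
    then show ?thesis by simp
  qed
  have "q t < theta" if "t < t0" for t
  proof (rule ccontr)
    assume "\<not> q t < theta"
    then show False using cross[OF that v0] t0 by simp
  qed
  then show ?thesis using v0 cross[of t0] t0 by auto
qed

lemma Lam_at_top_subcritical:
  assumes th: "theta \<ge> 1 / 2" and pos: "\<And>t. v t > 0"
  shows "(Lam \<longlongrightarrow> 0) at_top"
proof -
  obtain t0 where t0: "\<And>t. t0 < t \<Longrightarrow> v t > 0 \<Longrightarrow> theta < q t"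
    using turning_time[OF th] by auto
  have anti: "Lam t \<le> Lam s" if "t0 \<le> s" "s \<le> t" for s t
  proof (cases "s = t")
    case False
    then have "Lam t < Lam s" using that t0 pos by (intro Lam_strict_antimono) auto
    then show ?thesis by simp
  qed simp
  obtain l where l: "(Lam \<longlongrightarrow> l) at_top" "0 \<le> l"
    by (rule antimono_bounded_below_tendsto[of t0 Lam 0]) (use anti less_imp_le[OF Lam_pos[OF pos]] in auto)
  then show ?thesis using Lam_not_tendsto_subcritical[OF pos th l(1)] by (cases "l = 0") auto
qed

text \<open>In the deviations \<open>X\<close>, \<open>Y\<close> from the equilibrium,
  \<open>z = Y / X\<close> is the tangent of the polar angle, and the angular speed is
  \<open>Z / (1 + z\<^sup>2)\<close> with a quadratic polynomial \<open>Z\<close> in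
  \<open>z\<close>. Negative discriminant makes it uniformly positive at late times, so
  \<open>X\<close> must vanish again and again.\<close>

lemma Lam_oscillates:
  assumes th: "theta < 1 / 2" and disc: "(1 - 2 * theta)\<^sup>2 < 4 * k * (1 - theta)"
  shows "\<exists>t>T. Lam t > theta * (1 - theta)" "\<exists>t>T. Lam t < theta * (1 - theta)"
proof -
  note pos = v_pos_supercritical[OF th]
  define X where "X t = Lam t - theta * (1 - theta)" for t
  define Y where "Y t = q t - theta" for t
  have dX: "(X has_real_derivative - (p - 1) * Lam t * Y t) (at t)" for t
    unfolding X_def Y_def by (auto intro!: derivative_eq_intros deriv_Lam[OF pos] simp: algebra_simps)
  have dY: "(Y has_real_derivative X t - Y t * (1 - theta - q t)) (at t)" for t
    unfolding X_def Y_def by (auto intro!: derivative_eq_intros deriv_q[OF pos] simp: algebra_simps)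
  note q = q_tendsto_supercritical[OF pos th]
  note Lam = Lam_tendsto[OF pos q]
  define A0 where "A0 = k * (1 - theta)"
  define a where "a = 1 - 2 * theta"
  have A0: "A0 > 0" using k theta by (simp add: A0_def)
  have aA0: "a\<^sup>2 < 4 * A0" using disc by (simp add: A0_def a_def)
  \<comment> \<open>Chosen to spend half of the gap: \<open>4 * (A0 - d) * (1 - d)\<close> still
    exceeds \<open>a\<^sup>2\<close> by at least \<open>(4 * A0 - a\<^sup>2) / 2\<close>. The strict
    inequality in the limit then holds for all late times.\<close>
  define d where "d = (4 * A0 - a\<^sup>2) / (8 * (A0 + 1))"
  have d: "d > 0" "d < 1" "8 * d * (A0 + 1) = 4 * A0 - a\<^sup>2"
  proof -
    have "8 * (A0 + 1) > 0" using A0 by simp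
    moreover have "4 * A0 - s < 8 * (A0 + 1)" if "s \<ge> 0" for s using A0 that by simp
    then have "4 * A0 - a\<^sup>2 < 8 * (A0 + 1)" by simp
    ultimately show "d > 0" "d < 1" using aA0 by (auto simp: d_def)
    have "d * (8 * (A0 + 1)) = 4 * A0 - a\<^sup>2"
      using nonzero_eq_divide_eq[of "8 * (A0 + 1)" d "4 * A0 - a\<^sup>2"] A0 by (simp add: d_def)
    then show "8 * d * (A0 + 1) = 4 * A0 - a\<^sup>2" by (simp add: algebra_simps)
  qed
  have "4 * (A0 - d) * (1 - d) = 4 * A0 - 4 * d * (A0 + 1) + 4 * d\<^sup>2"
    by (simp add: algebra_simps power2_eq_square)
  then have gap: "a\<^sup>2 - 4 * (A0 - d) * (1 - d) < 0" using d aA0 zero_le_power2[of d] by linarith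
  have lim: "((\<lambda>t. (1 - theta - q t)\<^sup>2 - 4 * ((p - 1) * Lam t - d) * (1 - d)) \<longlongrightarrow>
      (1 - theta - theta)\<^sup>2 - 4 * ((p - 1) * (theta * (1 - theta)) - d) * (1 - d)) at_top"
    by (intro tendsto_intros q Lam)
  have eqs: "(p - 1) * (theta * (1 - theta)) = A0" "1 - theta - theta = a"
    unfolding A0_def a_def by (metis theta(3) mult.assoc mult.commute, simp)
  have "\<forall>\<^sub>F t in at_top. (1 - theta - q t)\<^sup>2 - 4 * ((p - 1) * Lam t - d) * (1 - d) < 0"
    using lim gap unfolding eqs by (rule order_tendstoD)
  then obtain S where S: "\<And>t. t \<ge> S \<Longrightarrow> (1 - theta - q t)\<^sup>2 \<le> 4 * ((p - 1) * Lam t - d) * (1 - d)"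
    unfolding eventually_at_top_linorder by force
  have zero: "\<exists>t>T. X t = 0"
  proof (rule ccontr)
    assume "\<not> (\<exists>t>T. X t = 0)"
    then have nz: "X t \<noteq> 0" if "t > T" for t using that by blast
    define a where "a = max S (T + 1)"
    \<comment> \<open>During a time \<open>4 / d\<close> the arctangent would grow by 4, more than
      the length \<open>pi\<close> of its range.\<close>
    define b where "b = a + 4 / d"
    have ab: "a < b" using d by (simp add: b_def)
    \<comment> \<open>the angle of the orbit around the equilibrium has derivative at least \<open>d\<close>\<close>
    define z where "z t = Y t / X t" for t
    define Z where "Z t = 1 - (1 - theta - q t) * z t + ((p - 1) * Lam t) * (z t)\<^sup>2" for t
    have dz: "(z has_real_derivative Z t) (at t)" if "t \<ge> a" for t
    proof -
      have "X t \<noteq> 0" using nz that by (simp add: a_def)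
      then have "((X t - Y t * (1 - theta - q t)) * X t - Y t * (- (p - 1) * Lam t * Y t)) / (X t * X t) = Z t"
        by (simp add: Z_def z_def field_simps power2_eq_square)
      then show ?thesis
        unfolding z_def using DERIV_divide[OF dY[of t] dX[of t] \<open>X t \<noteq> 0\<close>] by simp
    qed
    have "\<exists>x>a. x < b \<and> arctan (z b) - arctan (z a) = (b - a) * (inverse (1 + (z x)\<^sup>2) * Z x)"
      using dz by (intro MVT2[OF ab]) (auto intro!: derivative_eq_intros)
    then obtain x where x: "a < x" "arctan (z b) - arctan (z a) = (b - a) * (inverse (1 + (z x)\<^sup>2) * Z x)" by blast
    have Zx: "d * (1 + (z x)\<^sup>2) \<le> Z x"
      unfolding Z_def using x d by (intro quadratic_form_lower_bound S) (auto simp: a_def)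
    have "1 + (z x)\<^sup>2 > 0" by (simp add: add_pos_nonneg)
    with Zx have "d \<le> inverse (1 + (z x)\<^sup>2) * Z x" by (simp add: field_simps)
    then have "(b - a) * d \<le> (b - a) * (inverse (1 + (z x)\<^sup>2) * Z x)" using ab by (intro mult_left_mono) auto
    moreover have "(b - a) * d = 4" using d by (simp add: b_def)
    ultimately have "4 \<le> arctan (z b) - arctan (z a)" using x by simp
    then show False using arctan_bounded[of "z a"] arctan_bounded[of "z b"] pi_less_4 by linarith
  qed
  then obtain t1 where t1: "t1 > T" "X t1 = 0" by blast
  \<comment> \<open>Zeros of \<open>X\<close> are transversal: \<open>X'\<close> is a nonzero
    multiple of \<open>Y\<close>, and both deviations cannot vanish at once. So \<open>X\<close>
    takes both signs near \<open>t1\<close>, still after \<open>T\<close>.\<close>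
  have "Y t1 \<noteq> 0" using not_equilibrium[OF pos, of t1] t1 by (auto simp: X_def Y_def)
  have "(\<exists>t>T. X t > 0) \<and> (\<exists>t>T. X t < 0)"
  proof (cases "Y t1 > 0")
    case True
    then have neg: "- (p - 1) * Lam t1 * Y t1 < 0"
      using Lam_pos[OF pos[of t1]] p_gt_1 by (intro mult_neg_pos mult_neg_pos) auto
    obtain h1 where h1: "h1 > 0" "\<And>h. 0 < h \<Longrightarrow> h < h1 \<Longrightarrow> X t1 < X (t1 - h)"
      using DERIV_neg_dec_left[OF dX neg] by blast
    obtain h2 where h2: "h2 > 0" "\<And>h. 0 < h \<Longrightarrow> h < h2 \<Longrightarrow> X t1 > X (t1 + h)"
      using DERIV_neg_dec_right[OF dX neg] by blast
    have "T < t1 - min (h1 / 2) ((t1 - T) / 2)" "min (h1 / 2) ((t1 - T) / 2) < h1" "0 < min (h1 / 2) ((t1 - T) / 2)"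
      using t1 h1 by (auto simp: min_def field_simps)
    then have "\<exists>t>T. X t > 0" using h1(2) t1 by metis
    moreover have "\<exists>t>T. X t < 0" using h2(2)[of "h2 / 2"] h2(1) t1 by (intro exI[of _ "t1 + h2 / 2"]) auto
    ultimately show ?thesis by blast
  next
    case False
    with \<open>Y t1 \<noteq> 0\<close> have "Y t1 < 0" by simp
    then have po: "- (p - 1) * Lam t1 * Y t1 > 0"
      using Lam_pos[OF pos[of t1]] p_gt_1 by (intro mult_neg_neg mult_neg_pos) auto
    obtain h1 where h1: "h1 > 0" "\<And>h. 0 < h \<Longrightarrow> h < h1 \<Longrightarrow> X (t1 - h) < X t1"
      using DERIV_pos_inc_left[OF dX po] by blast
    obtain h2 where h2: "h2 > 0" "\<And>h. 0 < h \<Longrightarrow> h < h2 \<Longrightarrow> X t1 < X (t1 + h)"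
      using DERIV_pos_inc_right[OF dX po] by blast
    have "T < t1 - min (h1 / 2) ((t1 - T) / 2)" "min (h1 / 2) ((t1 - T) / 2) < h1" "0 < min (h1 / 2) ((t1 - T) / 2)"
      using t1 h1 by (auto simp: min_def field_simps)
    then have "\<exists>t>T. X t < 0" using h1(2) t1 by metis
    moreover have "\<exists>t>T. X t > 0" using h2(2)[of "h2 / 2"] h2(1) t1 by (intro exI[of _ "t1 + h2 / 2"]) auto
    ultimately show ?thesis by blast
  qed
  then show "\<exists>t>T. Lam t > theta * (1 - theta)" "\<exists>t>T. Lam t < theta * (1 - theta)"
    by (auto simp: X_def)
qed

text \<open>Here the deviations are taken as equilibrium minus orbit. At a first exit through
  \<open>Y = 0\<close> one has \<open>Y' = X > 0\<close>, since \<open>X = 0\<close> would be the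
  equilibrium; at a first exit through \<open>R = 0\<close> with \<open>Y > 0\<close> one has
  \<open>R' > 0\<close>. Either sign contradicts an exit from positive values.\<close>

lemma q_less_theta:
  assumes th: "theta < 1 / 2" and disc: "4 * k * (1 - theta) \<le> (1 - 2 * theta)\<^sup>2"
  shows "q t < theta"
proof -
  note pos = v_pos_supercritical[OF th]
  define A0 where "A0 = k * (1 - theta)"
  define a where "a = 1 - 2 * theta"
  \<comment> \<open>the triangle \<open>0 < Y < m X\<close> is invariant if \<open>m A0 + 1 / m \<le> a\<close>, and \<open>m = 2 / a\<close> is optimal\<close>
  define m where "m = 2 / a"
  have a: "a > 0" using th by (simp add: a_def)
  have m: "m > 0" "m * a = 2" using a by (auto simp: m_def)
  have "m * A0 + 1 / m \<le> a"
  proof -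
    have "4 * A0 \<le> a\<^sup>2" using disc by (simp add: A0_def a_def)
    then have "m * A0 + 1 / m \<le> 2 / a * (a\<^sup>2 / 4) + 1 / m"
      unfolding m_def using a by (intro add_right_mono mult_left_mono) auto
    also have "\<dots> = a" using a by (simp add: m_def power2_eq_square)
    finally show ?thesis .
  qed
  define X where "X t = theta * (1 - theta) - Lam t" for t
  define Y where "Y t = theta - q t" for t
  define R where "R t = m * X t - Y t" for t
  have dX: "(X has_real_derivative - (p - 1) * Lam t * Y t) (at t)" for t
    unfolding X_def Y_def by (auto intro!: derivative_eq_intros deriv_Lam[OF pos] simp: algebra_simps)
  have dY: "(Y has_real_derivative X t - Y t * (a + Y t)) (at t)" for t
    unfolding X_def Y_def a_def by (auto intro!: derivative_eq_intros deriv_q[OF pos] simp: algebra_simps)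
  have dR: "(R has_real_derivative m * (- (p - 1) * Lam t * Y t) - (X t - Y t * (a + Y t))) (at t)" for t
    unfolding R_def by (auto intro!: derivative_eq_intros dX dY)
  have contY: "continuous_on UNIV Y" and contR: "continuous_on UNIV R"
    using dY dR by (auto intro!: continuous_at_imp_continuous_on DERIV_isCont)
  have "(X \<longlongrightarrow> theta * (1 - theta) - 0) at_bot" unfolding X_def by (intro tendsto_intros Lam_at_bot)
  moreover have Yb: "(Y \<longlongrightarrow> theta - 0) at_bot" unfolding Y_def by (intro tendsto_intros q_at_bot)
  ultimately have "(R \<longlongrightarrow> m * (theta * (1 - theta) - 0) - (theta - 0)) at_bot"
    unfolding R_def by (intro tendsto_intros)
  \<comment> \<open>The orbit starts inside the region: \<open>m * (1 - theta) > 1\<close>, because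
    \<open>m * (a / 2) = 1\<close> and \<open>a / 2 < 1 - theta\<close>.\<close>
  moreover have "m * (theta * (1 - theta) - 0) - (theta - 0) > 0"
  proof -
    have "m * (1 - theta) > m * (a / 2)" using m theta by (intro mult_strict_left_mono) (auto simp: a_def)
    then have "theta * (m * (1 - theta)) > theta * 1" using m theta by (intro mult_strict_left_mono) auto
    then show ?thesis by (simp add: mult_ac)
  qed
  ultimately have "\<forall>\<^sub>F t in at_bot. R t > 0" by (rule order_tendstoD)
  moreover have "\<forall>\<^sub>F t in at_bot. Y t > 0" using order_tendstoD(1)[OF Yb, of 0] theta by simp
  ultimately have "\<forall>\<^sub>F t in at_bot. R t > 0 \<and> Y t > 0" by (rule eventually_conj)
  then obtain c where c: "\<And>t. t \<le> c \<Longrightarrow> R t > 0 \<and> Y t > 0" unfolding eventually_at_bot_linorder by blast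
  have "R t > 0 \<and> Y t > 0" for t
  proof (rule ccontr)
    assume nt: "\<not> (R t > 0 \<and> Y t > 0)"
    define S where "S = R -` {..0} \<union> Y -` {..0}"
    have "closed S" unfolding S_def
      using continuous_closed_preimage[OF contR closed_UNIV closed_atMost, of 0]
        continuous_closed_preimage[OF contY closed_UNIV closed_atMost, of 0] by (intro closed_Un) auto
    moreover have bdd: "bdd_below S"
    proof (rule bdd_belowI[of _ c], rule ccontr)
      fix x assume "x \<in> S" "\<not> c \<le> x"
      then show False using c[of x] by (auto simp: S_def)
    qed
    moreover have "t \<in> S" using nt by (auto simp: S_def)
    ultimately have "Inf S \<in> S" by (intro closed_contains_Inf) auto
    define s where "s = Inf S"
    have sS: "R s \<le> 0 \<or> Y s \<le> 0" using \<open>Inf S \<in> S\<close> by (auto simp: s_def S_def)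
    have before: "R x > 0 \<and> Y x > 0" if "x < s" for x
    proof (rule ccontr)
      assume "\<not> (R x > 0 \<and> Y x > 0)"
      then have "x \<in> S" by (auto simp: S_def)
      then show False using cInf_lower[OF _ bdd] that by (force simp: s_def)
    qed
    have lb: "f s \<ge> 0" if "continuous_on UNIV f" "\<And>x. x < s \<Longrightarrow> f x > 0" for f :: "real \<Rightarrow> real"
    proof (rule tendsto_lowerbound)
      have "isCont f s" using that(1) by (simp add: continuous_on_eq_continuous_at)
      then show "(f \<longlongrightarrow> f s) (at_left s)"
        by (auto simp: isCont_def intro: filterlim_mono[OF _ order_refl at_le])
      show "\<forall>\<^sub>F t in at_left s. 0 \<le> f t"
        using that(2) by (auto simp: eventually_at_filter less_imp_le intro!: always_eventually)
    qed simp
    have Rs: "R s \<ge> 0" and Ys: "Y s \<ge> 0" using lb contR contY before by blast+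
    have nonneg_deriv: False if d: "(f has_real_derivative l) (at s)" "l > 0" "f s = 0" "\<And>x. x < s \<Longrightarrow> f x > 0" for f l
    proof -
      obtain h where h: "h > 0" "\<And>e. 0 < e \<Longrightarrow> e < h \<Longrightarrow> f (s - e) < f s"
        using DERIV_pos_inc_left[OF d(1,2)] by blast
      show False using h(2)[of "h / 2"] h(1) d(3) d(4)[of "s - h / 2"] by simp
    qed
    show False
    proof (cases "Y s = 0")
      case True
      have "X s \<ge> 0" using Rs True m by (simp add: R_def zero_le_mult_iff)
      show False
      proof (cases "X s = 0")
        case True
        then show False using \<open>Y s = 0\<close> not_equilibrium[OF pos, of s] by (simp add: X_def Y_def)
      next
        case False
        then show False using nonneg_deriv[OF dY[of s]] \<open>X s \<ge> 0\<close> \<open>Y s = 0\<close> before by simp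
      qed
    next
      case False
      then have Y: "Y s > 0" and R: "R s = 0" using Ys Rs sS by auto
      have X: "X s = Y s / m" using R m by (simp add: R_def field_simps)
      have L: "(p - 1) * Lam s = A0 - (p - 1) * (Y s / m)"
      proof -
        have "(p - 1) * Lam s = (p - 1) * (theta * (1 - theta)) - (p - 1) * X s"
          by (simp add: X_def algebra_simps)
        moreover have "(p - 1) * (theta * (1 - theta)) = A0"
          unfolding A0_def by (metis theta(3) mult.assoc mult.commute)
        ultimately show ?thesis using X by simp
      qed
      have "m * (- (p - 1) * Lam s * Y s) - (X s - Y s * (a + Y s))
          = Y s * (a + Y s - 1 / m - m * ((p - 1) * Lam s))"
        unfolding X by (simp add: algebra_simps)
      \<comment> \<open>The nonlinear terms help: \<open>Y\<^sup>2\<close> from \<open>Y'\<close>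
        and \<open>(p - 1) * Y\<^sup>2\<close> from the drop of \<open>Lam\<close> below its
        equilibrium value add up to \<open>p * Y\<^sup>2\<close>. This settles the borderline case
        of zero discriminant as well.\<close>
      also have "\<dots> = Y s * ((a - (m * A0 + 1 / m)) + p * Y s)"
        unfolding L using m(1) by (simp add: field_simps)
      also have "\<dots> > 0"
        using Y p_gt_1 \<open>m * A0 + 1 / m \<le> a\<close> by (intro mult_pos_pos add_nonneg_pos) auto
      finally show False using nonneg_deriv[OF dR[of s] _ R] before by blast
    qed
  qed
  then show ?thesis using Y_def[of t] by (metis diff_gt_0_iff_gt)
qed

end

subsection \<open>Uniqueness\<close>

lemma nonneg_from_at_bot:
  fixes f f' :: "real \<Rightarrow> real"
  assumes df: "\<And>t. t < T \<Longrightarrow> (f has_real_derivative f' t) (at t)" and f': "\<And>t. t < T \<Longrightarrow> f' t \<ge> 0"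
    and lim: "(f \<longlongrightarrow> c) at_bot" and c: "c \<ge> 0" and t: "t < T"
  shows "f t \<ge> 0"
proof -
  have "f s \<le> f t" if "s \<le> t" for s
  proof (rule DERIV_nonneg_imp_nondecreasing[OF that])
    fix x assume "x \<le> t"
    with t df[of x] f'[of x] show "\<exists>y. (f has_real_derivative y) (at x) \<and> 0 \<le> y" by auto
  qed
  then have "c \<le> f t"
    by (intro tendsto_upperbound[OF lim]) (auto simp: eventually_at_bot_linorder)
  with c show ?thesis by simp
qed

lemma exp_exp_at_bot:
  fixes k M :: real
  assumes "k > 0"
  shows "((\<lambda>t. exp (M * exp (k * t))) \<longlongrightarrow> 1) at_bot"
proof -
  have "((\<lambda>t. exp (k * t)) \<longlongrightarrow> 0) at_bot"
    by (rule exp_mult_at_bot[OF assms])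
  then have "((\<lambda>t. exp (M * exp (k * t))) \<longlongrightarrow> exp (M * 0)) at_bot" by (intro tendsto_intros)
  then show ?thesis by simp
qed

text \<open>The weighted contraction of the existence proof, applied to a difference of solutions
  and carried out by differential comparison instead of integrals; \<open>e\<close> is the same
  weight written in the time \<open>t\<close>. At \<open>-\<infinity>\<close> only
  \<open>exp t * w \<rightarrow> 0\<close> is required, which is all that is available for an
  arbitrary radial solution.\<close>

lemma singular_ivp_unique:
  fixes g v1 v2 w1 w2 :: "real \<Rightarrow> real"
  assumes k: "k > 0" and lip: "\<And>a b. \<bar>g a - g b\<bar> \<le> L * \<bar>a - b\<bar>"
    and d1: "\<And>t. t < T \<Longrightarrow> (v1 has_real_derivative w1 t) (at t)"
      "\<And>t. t < T \<Longrightarrow> (w1 has_real_derivative - w1 t - exp (k * t) * g (v1 t)) (at t)"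
    and d2: "\<And>t. t < T \<Longrightarrow> (v2 has_real_derivative w2 t) (at t)"
      "\<And>t. t < T \<Longrightarrow> (w2 has_real_derivative - w2 t - exp (k * t) * g (v2 t)) (at t)"
    and lim: "(v1 \<longlongrightarrow> 1) at_bot" "(v2 \<longlongrightarrow> 1) at_bot"
      "((\<lambda>t. exp t * w1 t) \<longlongrightarrow> 0) at_bot" "((\<lambda>t. exp t * w2 t) \<longlongrightarrow> 0) at_bot"
    and bdd: "\<And>t. t < T \<Longrightarrow> \<bar>v1 t - v2 t\<bar> \<le> C"
    and t: "t < T"
  shows "v1 t = v2 t"
proof -
  have L: "L \<ge> 0" using lip[of 1 0] by (auto intro: order_trans[OF abs_ge_zero])
  define M where "M = 2 * L / k + 1"
  have M: "M > 0" "L / (k * M) \<le> 1 / 2" using L k by (auto simp: M_def field_simps add_pos_nonneg)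
  define e where "e t = exp (M * exp (k * t))" for t
  have e1: "e t \<ge> 1" for t using M by (simp add: e_def)
  have elim: "(e \<longlongrightarrow> 1) at_bot" unfolding e_def by (rule exp_exp_at_bot[OF k])
  have de: "(e has_real_derivative k * M * exp (k * t) * e t) (at t)" for t
    unfolding e_def by (auto intro!: derivative_eq_intros)
  define D where "D t = v1 t - v2 t" for t
  define P where "P t = exp t * (w1 t - w2 t)" for t
  have dD: "(D has_real_derivative exp (- t) * P t) (at t)" if "t < T" for t
    unfolding D_def P_def using d1(1)[OF that] d2(1)[OF that]
    by (auto intro!: derivative_eq_intros simp: exp_minus field_simps)
  have dP: "(P has_real_derivative - (exp t * exp (k * t) * (g (v1 t) - g (v2 t)))) (at t)" if "t < T" for t
    unfolding P_def using d1(2)[OF that] d2(2)[OF that]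
    by (auto intro!: derivative_eq_intros simp: algebra_simps)
  have Dlim: "(D \<longlongrightarrow> 0) at_bot" unfolding D_def using tendsto_diff[OF lim(1,2)] by simp
  have Plim: "(P \<longlongrightarrow> 0) at_bot"
    unfolding P_def using tendsto_diff[OF lim(3,4)] by (simp add: right_diff_distrib)
  have improve: "\<bar>D t\<bar> \<le> m / 2 * e t" if D: "\<And>t. t < T \<Longrightarrow> \<bar>D t\<bar> \<le> m * e t" and t: "t < T" for m t
  proof -
    have m: "m \<ge> 0" using D[OF t] e1[of t] by (smt (verit) zero_le_mult_iff)
    \<comment> \<open>A majorant of the integral of \<open>exp t * exp (k * t) * e t\<close>: its
      logarithmic derivative is at least 1, and it vanishes at \<open>-\<infinity>\<close>.\<close>
    define F where "F t = exp ((k + 1) * t) * e t" for t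
    have dF: "(F has_real_derivative F t * (k + 1 + k * M * exp (k * t))) (at t)" for t
      unfolding F_def by (auto intro!: derivative_eq_intros de simp: algebra_simps)
    have F0: "F t \<ge> 0" for t using e1[of t] by (simp add: F_def)
    have "((\<lambda>t. exp ((k + 1) * t)) \<longlongrightarrow> 0) at_bot"
      using k by (intro exp_mult_at_bot) simp
    then have Flim: "(F \<longlongrightarrow> 0) at_bot" unfolding F_def using tendsto_mult[OF _ elim] by fastforce
    have P: "\<bar>P t\<bar> \<le> L * m * F t" if t: "t < T" for t
    proof -
      have bound: "\<bar>exp t * exp (k * t) * (g (v1 t) - g (v2 t))\<bar> \<le> L * m * (F t * (k + 1 + k * M * exp (k * t)))"
        if "t < T" for t
      proof -
        have "\<bar>g (v1 t) - g (v2 t)\<bar> \<le> L * (m * e t)"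
          using lip[of "v1 t" "v2 t"] mult_left_mono[OF D[OF that] L] by (simp add: D_def)
        then have "exp t * exp (k * t) * \<bar>g (v1 t) - g (v2 t)\<bar> \<le> exp t * exp (k * t) * (L * (m * e t))"
          by (intro mult_left_mono) auto
        also have "\<dots> = L * m * F t * 1" by (simp add: F_def algebra_simps exp_add)
        also have "\<dots> \<le> L * m * F t * (k + 1 + k * M * exp (k * t))"
          using k M L m F0 by (intro mult_left_mono) auto
        finally show ?thesis by (simp add: abs_mult mult.assoc)
      qed
      have "L * m * F t + P t \<ge> 0"
      proof -
        have 1: "((\<lambda>t. L * m * F t + P t) has_real_derivative
            L * m * (F t * (k + 1 + k * M * exp (k * t))) + - (exp t * exp (k * t) * (g (v1 t) - g (v2 t)))) (at t)" if t: "t < T" for t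
          by (intro DERIV_add DERIV_cmult dF dP t)
        have 2: "0 \<le> L * m * (F t * (k + 1 + k * M * exp (k * t))) + - (exp t * exp (k * t) * (g (v1 t) - g (v2 t)))" if t: "t < T" for t
          using bound[OF t] by (simp only: abs_le_iff) linarith
        have 3: "((\<lambda>t. L * m * F t + P t) \<longlongrightarrow> 0) at_bot"
          using tendsto_add[OF tendsto_mult[OF tendsto_const Flim] Plim, of "L * m"] by simp
        show ?thesis by (rule nonneg_from_at_bot[OF 1 2 3 order_refl t])
      qed
      moreover have "L * m * F t - P t \<ge> 0"
      proof -
        have 1: "((\<lambda>t. L * m * F t - P t) has_real_derivative
            L * m * (F t * (k + 1 + k * M * exp (k * t))) - - (exp t * exp (k * t) * (g (v1 t) - g (v2 t)))) (at t)" if t: "t < T" for t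
          by (intro DERIV_diff DERIV_cmult dF dP t)
        have 2: "0 \<le> L * m * (F t * (k + 1 + k * M * exp (k * t))) - - (exp t * exp (k * t) * (g (v1 t) - g (v2 t)))" if t: "t < T" for t
          using bound[OF t] by (simp only: abs_le_iff) linarith
        have 3: "((\<lambda>t. L * m * F t - P t) \<longlongrightarrow> 0) at_bot"
          using tendsto_diff[OF tendsto_mult[OF tendsto_const Flim] Plim, of "L * m"] by simp
        show ?thesis by (rule nonneg_from_at_bot[OF 1 2 3 order_refl t])
      qed
      ultimately show ?thesis by (simp add: abs_le_iff)
    qed
    define c where "c = L * m / (k * M)"
    have c: "c \<ge> 0" "c * (k * M) = L * m" using L m k M by (auto simp: c_def)
    have ce: "c * (k * M * exp (k * t) * e t) = exp (- t) * (L * m * F t)" for t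
    proof -
      have "exp (- t) * (L * m * F t) = c * (k * M) * (exp (- t) * F t)"
        unfolding c(2) by (simp only: mult_ac)
      also have "exp (- t) * F t = exp (k * t) * e t"
        by (simp add: F_def exp_add exp_minus algebra_simps)
      finally show ?thesis by (simp only: mult_ac)
    qed
    have bound: "\<bar>exp (- t) * P t\<bar> \<le> c * (k * M * exp (k * t) * e t)" if "t < T" for t
      unfolding ce using P[OF that] by (simp add: abs_mult)
    have "c * e t + D t \<ge> 0"
    proof -
      have 1: "((\<lambda>t. c * e t + D t) has_real_derivative c * (k * M * exp (k * t) * e t) + exp (- t) * P t) (at t)" if t: "t < T" for t
        by (intro DERIV_add DERIV_cmult de dD t)
      have 2: "0 \<le> c * (k * M * exp (k * t) * e t) + exp (- t) * P t" if t: "t < T" for t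
        using bound[OF t] by linarith
      have 3: "((\<lambda>t. c * e t + D t) \<longlongrightarrow> c) at_bot"
        using tendsto_add[OF tendsto_mult[OF tendsto_const elim] Dlim, of c] by simp
      show ?thesis by (rule nonneg_from_at_bot[OF 1 2 3 c(1) t])
    qed
    moreover have "c * e t - D t \<ge> 0"
    proof -
      have 1: "((\<lambda>t. c * e t - D t) has_real_derivative c * (k * M * exp (k * t) * e t) - exp (- t) * P t) (at t)" if t: "t < T" for t
        by (intro DERIV_diff DERIV_cmult de dD t)
      have 2: "0 \<le> c * (k * M * exp (k * t) * e t) - exp (- t) * P t" if t: "t < T" for t
        using bound[OF t] by linarith
      have 3: "((\<lambda>t. c * e t - D t) \<longlongrightarrow> c) at_bot"
        using tendsto_diff[OF tendsto_mult[OF tendsto_const elim] Dlim, of c] by simp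
      show ?thesis by (rule nonneg_from_at_bot[OF 1 2 3 c(1) t])
    qed
    ultimately have "\<bar>D t\<bar> \<le> c * e t" by (simp add: abs_le_iff)
    also have "\<dots> = L / (k * M) * (m * e t)" by (simp add: c_def)
    also have "\<dots> \<le> 1 / 2 * (m * e t)" using m e1[of t] by (intro mult_right_mono M) auto
    finally show ?thesis by simp
  qed
  \<comment> \<open>The best constant in the weighted bound. By \<open>improve\<close> its half is
    admissible too, so it cannot be positive.\<close>
  define m where "m = (SUP t\<in>{..<T}. \<bar>D t\<bar> / e t)"
  have ub: "\<bar>D t\<bar> / e t \<le> C" if "t < T" for t
    using bdd[OF that] e1[of t] by (smt (verit) D_def abs_ge_zero divide_le_eq_1_pos frac_le div_by_1)
  then have bdd': "bdd_above ((\<lambda>t. \<bar>D t\<bar> / e t) ` {..<T})" by (auto intro!: bdd_aboveI2[of _ _ C])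
  have "\<bar>D t\<bar> \<le> m * e t" if "t < T" for t
  proof -
    have "\<bar>D t\<bar> / e t \<le> m" unfolding m_def using that bdd' by (intro cSUP_upper) auto
    then show ?thesis using e1[of t] by (simp add: divide_le_eq)
  qed
  note Dm = this
  from improve[OF this] have "m \<le> m / 2"
    unfolding m_def using t e1 by (intro cSUP_least[where A = "{..<T}", folded m_def]) (auto simp: pos_divide_le_eq less_le_trans[OF zero_less_one])
  then have "m \<le> 0" by simp
  then have "m * e t \<le> 0" using e1[of t] by (intro mult_nonpos_nonneg) auto
  then show ?thesis using Dm[OF t] by (simp add: D_def)
qed

text \<open>\<open>exp t * W t\<close> is nonincreasing, so it can only fail to vanish at
  \<open>-\<infinity>\<close> by staying beyond some nonzero \<open>c\<close> of either sign. Then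
  \<open>V\<close> would contain a multiple of \<open>exp (- t)\<close>, the planar fundamental
  solution \<open>- ln r\<close> in disguise, against \<open>V \<rightarrow> 1\<close>. The
  inequality \<open>c\<^sup>2 \<le> c * P x\<close> treats both signs together.\<close>

lemma regular_solution_bounds:
  fixes V W :: "real \<Rightarrow> real"
  assumes dV: "\<And>t. t < T \<Longrightarrow> (V has_real_derivative W t) (at t)"
    and dW: "\<And>t. t < T \<Longrightarrow> (W has_real_derivative - W t - N t) (at t)"
    and N: "\<And>t. t < T \<Longrightarrow> N t \<ge> 0" and lim: "(V \<longlongrightarrow> 1) at_bot"
  shows "t < T \<Longrightarrow> W t \<le> 0" "t < T \<Longrightarrow> V t \<le> 1" "((\<lambda>t. exp t * W t) \<longlongrightarrow> 0) at_bot"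
proof -
  define P where "P t = exp t * W t" for t
  have dP: "(P has_real_derivative - (exp t * N t)) (at t)" if "t < T" for t
    unfolding P_def using dW[OF that] by (auto intro!: derivative_eq_intros simp: algebra_simps)
  have P: "P t \<le> P s" if "s \<le> t" "t < T" for s t
  proof (rule DERIV_nonpos_imp_nonincreasing[OF that(1)])
    fix x assume "x \<le> t"
    with that(2) have "x < T" by simp
    from dP[OF this] N[OF this] show "\<exists>y. (P has_real_derivative y) (at x) \<and> y \<le> 0" by auto
  qed
  \<comment> \<open>otherwise \<open>V\<close> grows like \<open>e\<^sup>-\<^sup>t\<close> towards \<open>-\<infinity>\<close>\<close>
  have blowup: False if c: "c \<noteq> 0" and s: "s < T" and cP: "\<And>x. x \<le> s \<Longrightarrow> c\<^sup>2 \<le> c * P x" for c s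
  proof -
    define f where "f t = c * V t + c\<^sup>2 * exp (- t)" for t
    have mono: "f x \<le> f s" if "x \<le> s" for x
    proof (rule DERIV_nonneg_imp_nondecreasing[OF that])
      fix z assume "z \<le> s"
      then have z: "z < T" "c\<^sup>2 \<le> c * P z" using s cP by auto
      have "(f has_real_derivative c * W z - c\<^sup>2 * exp (- z)) (at z)"
        unfolding f_def using dV[OF z(1)] by (auto intro!: derivative_eq_intros)
      moreover have "c * W z - c\<^sup>2 * exp (- z) = exp (- z) * (c * P z - c\<^sup>2)"
        by (simp add: P_def exp_minus field_simps)
      ultimately show "\<exists>y. (f has_real_derivative y) (at z) \<and> 0 \<le> y" using z(2) by fastforce
    qed
    have "LIM t at_bot. exp (- t) :> (at_top :: real filter)"
      by (intro filterlim_compose[OF exp_at_top] filterlim_uminus_at_top_at_bot)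
    then have "LIM t at_bot. c\<^sup>2 * exp (- t) :> at_top"
      using c by (intro filterlim_tendsto_pos_mult_at_top[OF tendsto_const]) auto
    then have "LIM t at_bot. c * V t + c\<^sup>2 * exp (- t) :> at_top"
      by (rule filterlim_tendsto_add_at_top[OF tendsto_mult[OF tendsto_const lim]])
    then have "\<forall>\<^sub>F t in at_bot. f t > f s" unfolding f_def filterlim_at_top_dense by blast
    then have "\<forall>\<^sub>F t in at_bot. f t > f s \<and> t \<le> s" using eventually_le_at_bot by (rule eventually_conj)
    then obtain x where "f x > f s" "x \<le> s"
      using eventually_happens'[OF trivial_limit_at_bot_linorder] by blast
    with mono show False by fastforce
  qed
  have P0: "P t \<le> 0" if "t < T" for t
  proof (rule ccontr)
    assume "\<not> P t \<le> 0"
    then show False using blowup[of "P t" t] P[OF _ that] that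
      by (auto simp: power2_eq_square intro: mult_left_mono)
  qed
  show W0: "W t \<le> 0" if "t < T" for t using P0[OF that] by (simp add: P_def mult_le_0_iff)
  show "V t \<le> 1" if t: "t < T"
  proof -
    have "0 \<le> 1 - V t"
    proof (rule nonneg_from_at_bot[where f = "\<lambda>t. 1 - V t" and f' = "\<lambda>t. - W t", OF _ _ _ order_refl t])
      show "((\<lambda>t. 1 - V t) has_real_derivative - W x) (at x)" if "x < T" for x
        using dV[OF that] by (auto intro!: derivative_eq_intros)
      show "- W x \<ge> 0" if "x < T" for x using W0[OF that] by simp
      show "((\<lambda>t. 1 - V t) \<longlongrightarrow> 0) at_bot" using tendsto_diff[OF tendsto_const lim, of 1] by simp
    qed
    then show ?thesis by simp
  qed
  show "((\<lambda>t. exp t * W t) \<longlongrightarrow> 0) at_bot"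
    unfolding P_def[symmetric]
  proof (rule order_tendstoI)
    fix a :: real assume a: "a < 0"
    obtain s where s: "s < T" "P s > a"
    proof (rule ccontr)
      assume "\<not> thesis"
      then have le: "P x \<le> a" if "x < T" for x using that \<open>\<And>s. s < T \<Longrightarrow> a < P s \<Longrightarrow> thesis\<close> by force
      have "a\<^sup>2 \<le> a * P x" if "x \<le> T - 1" for x
        using mult_left_mono_neg[OF le[of x], of a] a that by (simp add: power2_eq_square)
      then show False using blowup[of a "T - 1"] a by auto
    qed
    show "\<forall>\<^sub>F t in at_bot. a < P t"
      using eventually_le_at_bot[of s] by eventually_elim (use P s in force)
  next
    fix a :: real assume a: "0 < a"
    show "\<forall>\<^sub>F t in at_bot. P t < a"
      using eventually_gt_at_bot[of T] by eventually_elim (use P0 a in force)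
  qed
qed

subsection \<open>Radial solutions as segments of the orbit\<close>

lemma weight_eq: "r > 0 \<Longrightarrow> weight k r = 1 / (r\<^sup>2 * (1 - ln r) powr (2 + k))"
  by (simp add: weight_def ln_div)

lemma radial_solutionD:
  assumes "radial_solution k p l u"
  shows "\<exists>u' u2. l > 0 \<and> continuous_on {0..1} u \<and>
    (\<forall>r\<in>{0<..<1}. (u has_real_derivative u' r) (at r) \<and> (u' has_real_derivative u2 r) (at r) \<and>
      u2 r + u' r / r = - (l * weight k r * (1 + u r) powr p)) \<and>
    (\<forall>r\<in>{0..<1}. u r > 0) \<and> u 1 = 0"
proof -
  from assms obtain u' u2 where c2: "\<And>r. r \<in> {0<..1} \<Longrightarrow> (u has_real_derivative u' r) (at r within {0<..1})"
    "\<And>r. r \<in> {0<..1} \<Longrightarrow> (u' has_real_derivative u2 r) (at r within {0<..1})"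
    unfolding radial_solution_def C2_on_def by blast
  have at: "at r within {0<..1} = at r" if "0 < r" "r < 1" for r :: real
    using that by (intro at_within_interior) (auto simp: interior_atLeastAtMost_real
        intro!: interiorI[of "{0<..<1}"])
  have d: "(u has_real_derivative u' r) (at r)" "(u' has_real_derivative u2 r) (at r)" if "0 < r" "r < 1" for r
    using c2[of r] that by (auto simp: at)
  have eq: "u2 r + u' r / r = - (l * weight k r * (1 + u r) powr p)" if r: "0 < r" "r < 1" for r
  proof -
    obtain x :: "real^2" where x: "norm x = r" using vector_choose_size[of r] r by auto
    have "- laplacian (\<lambda>y. u (norm y)) x = l * weight k r * (1 + u r) powr p"
      using assms x r unfolding radial_solution_def by force
    moreover have "laplacian (\<lambda>y. u (norm y)) x = u2 r + u' r / r"
      using laplacian_radial[of x 1 u u' "u2 r"] d x r by auto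
    ultimately show ?thesis by simp
  qed
  have pos: "u r > 0" if r: "0 \<le> r" "r < 1" for r
  proof -
    obtain x :: "real^2" where x: "norm x = r" using vector_choose_size[of r] r by auto
    then show ?thesis using assms r unfolding radial_solution_def by force
  qed
  have one: "u 1 = 0"
  proof -
    obtain x :: "real^2" where x: "norm x = 1" using vector_choose_size[of 1] by auto
    then show ?thesis using assms unfolding radial_solution_def by force
  qed
  show ?thesis
    using d eq pos one assms unfolding radial_solution_def by (intro exI[of _ u'] exI[of _ u2]) auto
qed

text \<open>Differentiability is asked for beyond the radius 1, which yields the one-sided
  derivatives that \<open>C2_on {0<..1}\<close> demands at the boundary.\<close>

lemma radial_solutionI:
  assumes "l > 0" "continuous_on {0..1} u" "1 < R"
    and d: "\<And>r. 0 < r \<Longrightarrow> r < R \<Longrightarrow> (u has_real_derivative u' r) (at r)"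
      "\<And>r. 0 < r \<Longrightarrow> r < R \<Longrightarrow> (u' has_real_derivative u2 r) (at r)"
    and cont: "continuous_on {0<..<R} u2"
    and eq: "\<And>r. 0 < r \<Longrightarrow> r < 1 \<Longrightarrow> u2 r + u' r / r = - (l * weight k r * (1 + u r) powr p)"
    and pos: "\<And>r. 0 \<le> r \<Longrightarrow> r < 1 \<Longrightarrow> u r > 0" and one: "u 1 = 0"
  shows "radial_solution k p l u"
proof -
  have "C2_on {0<..1} u"
    unfolding C2_on_def
  proof (intro exI conjI ballI)
    fix r :: real assume "r \<in> {0<..1}"
    then have r: "0 < r" "r < R" using \<open>1 < R\<close> by auto
    show "(u has_real_derivative u' r) (at r within {0<..1})"
      "(u' has_real_derivative u2 r) (at r within {0<..1})"
      using d[OF r] by (auto intro: has_field_derivative_at_within)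
  next
    show "continuous_on {0<..1} u2"
      by (rule continuous_on_subset[OF cont]) (use \<open>1 < R\<close> in auto)
  qed
  moreover have "- laplacian (\<lambda>y. u (norm y)) x = l * weight k (norm x) * (1 + u (norm x)) powr p"
    if "x \<in> ball 0 1" "x \<noteq> 0" for x :: "real^2"
  proof -
    have x: "0 < norm x" "norm x < 1" using that by auto
    have "laplacian (\<lambda>y. u (norm y)) x = u2 (norm x) + u' (norm x) / norm x"
      using laplacian_radial[of x R u u' "u2 (norm x)"] d x that \<open>1 < R\<close> by auto
    then show ?thesis using eq[OF x] by simp
  qed
  ultimately show ?thesis using assms unfolding radial_solution_def by auto
qed

lemma continuous_cut_pow: "1 \<le> p \<Longrightarrow> continuous_on A (cut_pow p)"
  using cut_pow_lipschitz[of p]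
  by (intro lipschitz_on_continuous_on[of p] lipschitz_onI) (auto simp: dist_real_def)

context singular_orbit begin

text \<open>The centre corresponds to the time \<open>-\<infinity>\<close>, where the orbit has the
  limit 1; hence the separate value there.\<close>

definition "prof T r = (if r \<le> 0 then 1 / v T - 1 else v (T - ln (1 - ln r)) / v T - 1)"

lemma log_time_at_bot: "filterlim (\<lambda>r. T - ln (1 - ln r)) at_bot (at_right (0::real))"
proof -
  have "filterlim (\<lambda>r. 1 + - ln r) at_top (at_right (0::real))"
    by (intro filterlim_tendsto_add_at_top[OF tendsto_const] filterlim_compose[OF filterlim_uminus_at_top_at_bot] ln_at_0)
  then have "filterlim (\<lambda>r. ln (1 + - ln r)) at_top (at_right (0::real))"
    by (rule filterlim_compose[OF ln_at_top])
  then have "filterlim (\<lambda>r. - ln (1 + - ln r)) at_bot (at_right (0::real))"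
    by (rule filterlim_compose[OF filterlim_uminus_at_bot_at_top])
  then have "filterlim (\<lambda>r. T + - ln (1 + - ln r)) at_bot (at_right (0::real))"
    by (rule filterlim_tendsto_add_at_bot_iff[OF tendsto_const, THEN iffD2])
  then show ?thesis by simp
qed

lemma prof_radial_solution:
  assumes vT: "v T > 0"
  shows "radial_solution k p (Lam T) (prof T)"
proof -
  define s where "s r = 1 - ln r" for r :: real
  define \<tau> where "\<tau> r = T - ln (s r)" for r
  define u' where "u' r = w (\<tau> r) / (s r * r) / v T" for r
  define w' where "w' t = - w t - exp (k * t) * cut_pow p (v t)" for t
  define u2 where "u2 r = (w' (\<tau> r) - w (\<tau> r) * (s r - 1)) / (s r * r)\<^sup>2 / v T" for r
  have s: "s r > 0" if "0 < r" "r < exp 1" for r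
    using that ln_less_cancel_iff[of r "exp 1"] by (simp add: s_def)
  have ds: "(s has_real_derivative - 1 / r) (at r)" if "0 < r" for r
    unfolding s_def using that by (auto intro!: derivative_eq_intros)
  have d\<tau>: "(\<tau> has_real_derivative 1 / (s r * r)) (at r)" if "0 < r" "r < exp 1" for r
    unfolding \<tau>_def using s[OF that] that
    by (auto intro!: derivative_eq_intros ds simp: field_simps)
  have dv\<tau>: "((\<lambda>r. v (\<tau> r)) has_real_derivative w (\<tau> r) * (1 / (s r * r))) (at r)" if "0 < r" "r < exp 1" for r
    by (rule DERIV_chain2[where f = v, OF dv d\<tau>[OF that]])
  have dw\<tau>: "((\<lambda>r. w (\<tau> r)) has_real_derivative w' (\<tau> r) * (1 / (s r * r))) (at r)" if "0 < r" "r < exp 1" for r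
    unfolding w'_def by (rule DERIV_chain2[where f = w, OF dw d\<tau>[OF that]])
  have prof: "prof T r = v (\<tau> r) / v T - 1" if "0 < r" for r
    using that by (simp add: prof_def \<tau>_def s_def)
  have du: "(prof T has_real_derivative u' r) (at r)" if r: "0 < r" "r < exp 1" for r
  proof -
    have "((\<lambda>r. v (\<tau> r) / v T - 1) has_real_derivative u' r) (at r)"
      using DERIV_diff[OF DERIV_cdivide[OF dv\<tau>[OF r], of "v T"] DERIV_const[of 1]] by (simp add: u'_def)
    then show ?thesis
      using r by (rule_tac has_field_derivative_transform_within_open[where S = "{0<..}"]) (auto simp: prof)
  qed
  have du': "(u' has_real_derivative u2 r) (at r)" if r: "0 < r" "r < exp 1" for r
  proof -
    have sr: "s r * r \<noteq> 0" using s[OF r] r by simp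
    have "((\<lambda>r. s r * r) has_real_derivative s r - 1) (at r)"
      using r by (auto intro!: derivative_eq_intros ds)
    from DERIV_cdivide[OF DERIV_divide[OF dw\<tau>[OF r] this sr], of "v T"]
    have "(u' has_real_derivative (w' (\<tau> r) * (1 / (s r * r)) * (s r * r) - w (\<tau> r) * (s r - 1)) / (s r * r * (s r * r)) / v T) (at r)"
      unfolding u'_def .
    moreover have "(w' (\<tau> r) * (1 / (s r * r)) * (s r * r) - w (\<tau> r) * (s r - 1)) / (s r * r * (s r * r)) / v T = u2 r"
      using sr by (simp add: u2_def power2_eq_square)
    ultimately show ?thesis by simp
  qed
  show ?thesis
  \<comment> \<open>\<open>1 - ln r\<close> is positive up to \<open>exp 1\<close>, and the orbit
    also exists after the time \<open>T\<close>, so the profile continues past the boundary.\<close>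
  proof (rule radial_solutionI[where u' = u' and ?u2.0 = u2 and R = "exp 1"])
    show "Lam T > 0" by (rule Lam_pos[OF vT])
    show "1 < exp (1::real)" by simp
    show "(prof T has_real_derivative u' r) (at r)" "(u' has_real_derivative u2 r) (at r)"
      if "0 < r" "r < exp 1" for r using du[OF that] du'[OF that] .
    show "continuous_on {0..1} (prof T)"
      unfolding continuous_on_eq_continuous_within
    proof
      fix r :: real assume r: "r \<in> {0..1}"
      show "continuous (at r within {0..1}) (prof T)"
      proof (cases "r = 0")
        case False
        have "r < exp 1" using r by (intro le_less_trans[of r 1]) auto
        with du[of r] r False have "isCont (prof T) r" by (auto intro: DERIV_isCont)
        then show ?thesis by (rule continuous_at_imp_continuous_within)
      next
        case True
        have "((\<lambda>r. v (T - ln (1 - ln r)) / v T - 1) \<longlongrightarrow> 1 / v T - 1) (at_right 0)"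
          using vT by (intro tendsto_intros filterlim_compose[OF v_at_bot] log_time_at_bot) auto
        then have "(prof T \<longlongrightarrow> prof T 0) (at_right 0)"
          by (rule Lim_transform_eventually[THEN tendsto_eq_rhs])
            (auto simp: prof_def eventually_at_filter)
        then show ?thesis using True by (simp add: continuous_within at_within_Icc_at_right)
      qed
    qed
    show "continuous_on {0<..<exp 1} u2"
    proof (intro continuous_at_imp_continuous_on ballI)
      fix r :: real assume "r \<in> {0<..<exp 1}"
      then have r: "0 < r" "r < exp 1" by auto
      have "isCont (cut_pow p) z" for z
        using continuous_cut_pow[of p UNIV] p_gt_1 by (simp add: continuous_on_eq_continuous_at)
      then have "isCont (\<lambda>r. cut_pow p (v (\<tau> r))) r"
        by (rule isCont_o2[OF DERIV_isCont[OF dv\<tau>[OF r]]])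
      moreover have "(s r * r)\<^sup>2 \<noteq> 0" using s[OF r] r by simp
      ultimately show "isCont u2 r"
        unfolding u2_def w'_def using vT
        by (intro continuous_intros DERIV_isCont[OF d\<tau>[OF r]] DERIV_isCont[OF dw\<tau>[OF r]]
            DERIV_isCont[OF ds[OF r(1)]]) auto
    qed
    show "prof T 1 = 0" using vT by (simp add: prof_def)
    show "prof T r > 0" if r: "0 \<le> r" "r < 1" for r
    proof (cases "r = 0")
      case True
      then show ?thesis using vT v_less_1[of T] by (simp add: prof_def)
    next
      case False
      then have "ln r < 0" using r by simp
      then have "ln (1 - ln r) > 0" by (intro ln_gt_zero) simp
      then have "\<tau> r < T" by (simp add: \<tau>_def s_def)
      then have "v T < v (\<tau> r)" by (rule v_strict_antimono)
      then show ?thesis using vT r False by (simp add: prof)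
    qed
    show "u2 r + u' r / r = - (Lam T * weight k r * (1 + prof T r) powr p)" if r: "0 < r" "r < 1" for r
    proof -
      have "r < exp 1" using r one_less_exp_iff[of 1] by linarith
      then have sp: "s r > 0" using s r by simp
      have "ln r < 0" using r by simp
      then have "ln (1 - ln r) > 0" by (intro ln_gt_zero) simp
      then have "\<tau> r \<le> T" by (simp add: \<tau>_def s_def)
      then have v\<tau>: "v (\<tau> r) > 0" by (rule v_pos_downward[OF vT])
      \<comment> \<open>The term \<open>u' / r\<close> contributes \<open>w * s\<close> over the
        common denominator and cancels \<open>- w * (s - 1)\<close> up to a single
        \<open>w\<close>.\<close>
      have "u2 r + u' r / r = (w' (\<tau> r) + w (\<tau> r)) / (s r * r)\<^sup>2 / v T"
        using sp r vT by (simp add: u2_def u'_def field_simps power2_eq_square)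
      also have "\<dots> = - (exp (k * \<tau> r) * v (\<tau> r) powr p / v T / (s r * r)\<^sup>2)"
        using cut_pow_v[OF v\<tau>] by (simp add: w'_def)
      also have "exp (k * \<tau> r) = exp (k * T) * s r powr (- k)"
        using sp by (simp add: \<tau>_def powr_def algebra_simps flip: exp_add)
      also have "v (\<tau> r) powr p = v T powr p * (1 + prof T r) powr p"
        using v\<tau> vT r by (simp add: prof flip: powr_mult)
      also have "exp (k * T) * s r powr - k * (v T powr p * (1 + prof T r) powr p) / v T / (s r * r)\<^sup>2
          = (exp (k * T) * (v T powr p / v T)) * (s r powr - k / (s r)\<^sup>2 / r\<^sup>2) * (1 + prof T r) powr p"
        by (simp add: power_mult_distrib)
      also have "v T powr p / v T = v T powr (p - 1)" using vT by (simp add: powr_diff)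
      also have "s r powr - k / (s r)\<^sup>2 / r\<^sup>2 = weight k r"
        using sp r unfolding weight_eq[OF r(1)] s_def[symmetric]
        by (simp add: powr_minus powr_add field_simps)
      finally show ?thesis by (simp add: Lam_def)
    qed
  qed
qed

text \<open>After division by \<open>c = u 0 + 1\<close>, the time \<open>T\<close> is chosen so
  that \<open>exp (k * T)\<close> absorbs \<open>l * c powr (p - 1)\<close>; then \<open>V\<close>
  solves the problem of \<open>v\<close> on \<open>t < T\<close>. The boundary condition enters
  last: it gives \<open>v T = 1 / c\<close>, which turns the choice of \<open>T\<close> into
  \<open>l = Lam T\<close>.\<close>

lemma radial_solution_eq_prof:
  assumes "radial_solution k p l u"
  obtains T where "v T > 0" "l = Lam T" "\<And>r. 0 \<le> r \<Longrightarrow> r \<le> 1 \<Longrightarrow> u r = prof T r"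
proof -
  obtain u' u2 where l: "l > 0" and cont: "continuous_on {0..1} u" and one: "u 1 = 0"
    and ode: "\<forall>r\<in>{0<..<1}. (u has_real_derivative u' r) (at r) \<and> (u' has_real_derivative u2 r) (at r) \<and>
      u2 r + u' r / r = - (l * weight k r * (1 + u r) powr p)"
    and u_pos: "\<forall>r\<in>{0..<1}. u r > 0"
    using radial_solutionD[OF assms] by auto
  have du: "(u has_real_derivative u' r) (at r)"
    and du': "(u' has_real_derivative u2 r) (at r)"
    and eq: "u2 r + u' r / r = - (l * weight k r * (1 + u r) powr p)" if "0 < r" "r < 1" for r
    using ode that by auto
  have pos: "u r > 0" if "0 \<le> r" "r < 1" for r using u_pos that by auto
  define c where "c = u 0 + 1"
  have c: "c > 0" using pos[of 0] by (simp add: c_def)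
  define T where "T = (ln l + (p - 1) * ln c) / k"
  have eT: "exp (k * T) = l * c powr (p - 1)"
    using l c k by (simp add: T_def exp_add powr_def)
  define s where "s t = exp (T - t)" for t
  define \<rho> where "\<rho> t = exp (1 - s t)" for t
  define V where "V t = (u (\<rho> t) + 1) / c" for t
  define W where "W t = u' (\<rho> t) * (\<rho> t * s t) / c" for t
  have ds: "(s has_real_derivative - s t) (at t)" for t
    unfolding s_def by (auto intro!: derivative_eq_intros)
  have d\<rho>: "(\<rho> has_real_derivative \<rho> t * s t) (at t)" for t
    unfolding \<rho>_def by (auto intro!: derivative_eq_intros ds)
  have \<rho>: "0 < \<rho> t" "t < T \<Longrightarrow> \<rho> t < 1" for t by (auto simp: \<rho>_def s_def)
  have Vpos: "V t > 0" if "t < T" for t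
    using pos[of "\<rho> t"] \<rho>[of t] that c by (simp add: V_def add_pos_pos)
  have dV: "(V has_real_derivative W t) (at t)" if "t < T" for t
    unfolding V_def W_def
    using DERIV_cdivide[OF DERIV_add[OF DERIV_chain2[where f = u, OF du[OF \<rho>(1) \<rho>(2)[OF that]] d\<rho>[of t]]
          DERIV_const[of 1]], of c] by simp
  have dW: "(W has_real_derivative - W t - exp (k * t) * V t powr p) (at t)" if t: "t < T" for t
  proof -
    note r = \<rho>(1)[of t] \<rho>(2)[OF t]
    have s0: "s t > 0" by (simp add: s_def)
    have "((\<lambda>t. \<rho> t * s t) has_real_derivative \<rho> t * s t * s t - \<rho> t * s t) (at t)"
      using DERIV_mult[OF d\<rho>[of t] ds[of t]] by (simp add: algebra_simps)
    from DERIV_cdivide[OF DERIV_mult[OF DERIV_chain2[where f = u', OF du'[OF r] d\<rho>[of t]] this], of c]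
    have "(W has_real_derivative (u2 (\<rho> t) * (\<rho> t * s t) * (\<rho> t * s t) +
        (\<rho> t * s t * s t - \<rho> t * s t) * u' (\<rho> t)) / c) (at t)"
      unfolding W_def .
    also have "(u2 (\<rho> t) * (\<rho> t * s t) * (\<rho> t * s t) + (\<rho> t * s t * s t - \<rho> t * s t) * u' (\<rho> t)) / c
        = - W t + (u2 (\<rho> t) + u' (\<rho> t) / \<rho> t) * ((\<rho> t)\<^sup>2 * (s t)\<^sup>2) / c"
      using r c by (simp add: W_def field_simps power2_eq_square)
    also have "(u2 (\<rho> t) + u' (\<rho> t) / \<rho> t) * ((\<rho> t)\<^sup>2 * (s t)\<^sup>2) / c
        = - (l * ((\<rho> t)\<^sup>2 * weight k (\<rho> t) * (s t)\<^sup>2) * (1 + u (\<rho> t)) powr p / c)"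
      unfolding eq[OF r] by simp
    also have "(\<rho> t)\<^sup>2 * weight k (\<rho> t) * (s t)\<^sup>2 = exp (k * t) / exp (k * T)"
    proof -
      have "1 - ln (\<rho> t) = s t" by (simp add: \<rho>_def)
      then have "weight k (\<rho> t) = 1 / ((\<rho> t)\<^sup>2 * s t powr (2 + k))"
        using weight_eq[OF r(1)] by simp
      then have "(\<rho> t)\<^sup>2 * weight k (\<rho> t) * (s t)\<^sup>2 = s t powr (- k)"
        using r s0 by (simp add: powr_add powr_minus field_simps)
      also have "\<dots> = exp (k * t - k * T)" by (simp add: s_def powr_def algebra_simps)
      finally show ?thesis by (simp add: exp_diff)
    qed
    also have "(1 + u (\<rho> t)) powr p = c powr p * V t powr p"
      using c Vpos[OF t] pos[of "\<rho> t"] r by (simp add: V_def add.commute flip: powr_mult)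
    also have "- W t + - (l * (exp (k * t) / exp (k * T)) * (c powr p * V t powr p) / c)
        = - W t - exp (k * t) * V t powr p"
      unfolding eT using l c by (simp add: powr_diff)
    finally show ?thesis .
  qed
  have filt: "filterlim \<rho> (at 0 within {0..1}) at_bot"
    unfolding filterlim_at
  proof
    have "LIM t at_bot. s t :> at_top"
      unfolding s_def using filterlim_tendsto_add_at_top[OF tendsto_const[of T] filterlim_uminus_at_top_at_bot]
      by (intro filterlim_compose[OF exp_at_top]) simp
    then have "LIM t at_bot. 1 + - s t :> at_bot"
      by (intro filterlim_tendsto_add_at_bot_iff[OF tendsto_const, THEN iffD2] filterlim_compose[OF filterlim_uminus_at_bot_at_top])
    then show "(\<rho> \<longlongrightarrow> 0) at_bot" unfolding \<rho>_def using filterlim_compose[OF exp_at_bot] by simp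
    show "\<forall>\<^sub>F t in at_bot. \<rho> t \<in> {0..1} \<and> \<rho> t \<noteq> 0"
      using eventually_gt_at_bot[of T]
    proof eventually_elim
      case (elim t)
      then show ?case using \<rho>(1)[of t] \<rho>(2)[of t] by simp
    qed
  qed
  have "(u \<longlongrightarrow> u 0) (at 0 within {0..1})" using cont by (simp add: continuous_on_def)
  then have "(V \<longlongrightarrow> (u 0 + 1) / c) at_bot"
    unfolding V_def using c by (intro tendsto_intros filterlim_compose[OF _ filt]) auto
  then have Vlim: "(V \<longlongrightarrow> 1) at_bot" using c by (simp add: c_def)
  note reg = regular_solution_bounds[where T = T and N = "\<lambda>t. exp (k * t) * V t powr p", OF dV dW _ Vlim]
  have V1: "V t \<le> 1" if "t < T" for t by (rule reg(2)) (simp_all add: that)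
  have Wlim: "((\<lambda>t. exp t * W t) \<longlongrightarrow> 0) at_bot" by (rule reg(3)) simp_all
  have cutV: "cut_pow p (V t) = V t powr p" if "t < T" for t
    using V1[OF that] Vpos[OF that] by (simp add: cut_pow_def)
  have wlim: "((\<lambda>t. exp t * w t) \<longlongrightarrow> 0) at_bot"
    using tendsto_mult[OF Transcendental.exp_at_bot w_at_bot] by simp
  have Veq: "V t = v t" if t: "t < T" for t
  proof (rule singular_ivp_unique[OF k cut_pow_lipschitz dV _ dv dw Vlim v_at_bot Wlim wlim _ t])
    show "1 \<le> p" using p_gt_1 by simp
    show "(W has_real_derivative - W t - exp (k * t) * cut_pow p (V t)) (at t)" if "t < T" for t
      using dW[OF that] cutV[OF that] by simp
    \<comment> \<open>\<open>V\<close> lies in \<open>(0, 1]\<close>, but \<open>v\<close> is so far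
      only known to lie between \<open>v T\<close> and 1, and the sign of \<open>v T\<close> is
      still open.\<close>
    show "\<bar>V t - v t\<bar> \<le> 2 + \<bar>v T\<bar>" if "t < T" for t
      using V1[OF that] Vpos[OF that] v_less_1[of t] v_strict_antimono[OF that] by linarith
  qed
  have vT: "v T = 1 / c"
  proof (rule tendsto_unique)
    show "(v \<longlongrightarrow> v T) (at_left T)"
      using cont_v[of T] by (auto simp: isCont_def intro: filterlim_mono[OF _ order_refl at_le])
    have f1: "filterlim \<rho> (at 1 within {0..1}) (at_left T)"
      unfolding filterlim_at
    proof
      have "(\<rho> \<longlongrightarrow> \<rho> T) (at T)" using d\<rho>[of T] DERIV_isCont by (auto simp: isCont_def)
      then show "(\<rho> \<longlongrightarrow> 1) (at_left T)" by (auto simp: \<rho>_def s_def intro: filterlim_mono[OF _ order_refl at_le])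
      show "\<forall>\<^sub>F t in at_left T. \<rho> t \<in> {0..1} \<and> \<rho> t \<noteq> 1"
        unfolding eventually_at_filter
      proof (intro always_eventually allI impI)
        fix t assume "t \<in> {..<T}"
        then show "\<rho> t \<in> {0..1} \<and> \<rho> t \<noteq> 1" using \<rho>(1)[of t] \<rho>(2)[of t] by simp
      qed
    qed
    have "(u \<longlongrightarrow> u 1) (at 1 within {0..1})" using cont by (simp add: continuous_on_def)
    then have "(V \<longlongrightarrow> (u 1 + 1) / c) (at_left T)"
      unfolding V_def using c by (intro tendsto_intros filterlim_compose[OF _ f1]) auto
    then have "(V \<longlongrightarrow> 1 / c) (at_left T)" by (simp add: one)
    then show "(v \<longlongrightarrow> 1 / c) (at_left T)"
      by (rule Lim_transform_eventually) (auto simp: eventually_at_filter Veq)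
  qed simp
  show ?thesis
  proof (rule that)
    show "v T > 0" using vT c by simp
    show "l = Lam T" unfolding Lam_def eT vT using c by (simp add: powr_divide)
    fix r :: real assume r: "0 \<le> r" "r \<le> 1"
    consider "r = 0" | "r = 1" | "0 < r" "r < 1" using r by force
    then show "u r = prof T r"
    proof cases
      case 1
      then show ?thesis by (simp add: prof_def vT c_def)
    next
      case 2
      then show ?thesis using vT c by (simp add: prof_def one)
    next
      case 3
      define t where "t = T - ln (1 - ln r)"
      have "ln r < 0" using 3 by simp
      then have "t < T" "s t = 1 - ln r" by (auto simp: t_def s_def)
      then have "\<rho> t = r" using 3 by (simp add: \<rho>_def)
      then have "(u r + 1) / c = v t" using Veq[OF \<open>t < T\<close>] by (simp add: V_def)
      then show ?thesis using 3 c by (simp add: prof_def vT t_def field_simps)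
    qed
  qed
qed

end

context singular_orbit begin

subsection \<open>The bifurcation curve\<close>

text \<open>\<open>Lam T powr (1 / (p - 1))\<close> is \<open>y T\<close> and \<open>u 0 + 1\<close>
  is \<open>1 / v T\<close>, so their product is the exponential factor of \<open>y\<close>.\<close>

lemma solution_at_exp:
  assumes "v T > 0"
  shows "solution_at k p (exp (theta * T)) (Lam T) (prof T)"
proof -
  have "Lam T powr (1 / (p - 1)) = y T"
    using y_pos[OF assms] p_gt_1 by (simp add: powr_powr flip: y_powr[OF assms])
  then show ?thesis
    using prof_radial_solution[OF assms] assms by (simp add: solution_at_def prof_def y_def)
qed

lemma solution_at_cases:
  assumes "solution_at k p \<beta> l u"
  shows "\<exists>T. v T > 0 \<and> \<beta> = exp (theta * T) \<and> l = Lam T \<and> (\<forall>r\<in>{0..1}. u r = prof T r)"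
proof -
  have sol: "radial_solution k p l u" and \<beta>: "\<beta> = l powr (1 / (p - 1)) * (u 0 + 1)"
    using assms by (auto simp: solution_at_def)
  obtain T where T: "v T > 0" "l = Lam T" "\<And>r. 0 \<le> r \<Longrightarrow> r \<le> 1 \<Longrightarrow> u r = prof T r"
    using radial_solution_eq_prof[OF sol] by metis
  have "\<beta> = exp (theta * T)"
    using solution_at_exp[OF T(1)] \<beta> T by (simp add: solution_at_def)
  with T show ?thesis by auto
qed

lemma theta_mult_less: "theta * s < theta * t \<longleftrightarrow> s < t" using theta by simp

text \<open>\<open>beta_dom\<close> excludes the supremum, so the supremum must not be attained: the
  times with \<open>v T > 0\<close> form an open set, closed under passing to earlier times.\<close>

lemma mem_beta_dom: "\<beta> \<in> beta_dom k p \<longleftrightarrow> (\<exists>T. v T > 0 \<and> \<beta> = exp (theta * T))"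
proof -
  have less_iff: "ereal \<beta> < beta_star k p \<longleftrightarrow> (\<exists>T. v T > 0 \<and> \<beta> < exp (theta * T))"
    unfolding beta_star_def less_Sup_iff using solution_at_exp solution_at_cases by fastforce
  show ?thesis
  proof
    assume "\<beta> \<in> beta_dom k p"
    then obtain T where T: "0 < \<beta>" "v T > 0" "\<beta> < exp (theta * T)"
      using less_iff by (auto simp: beta_dom_def)
    define t where "t = ln \<beta> / theta"
    have \<beta>: "\<beta> = exp (theta * t)" using T theta by (simp add: t_def)
    then have "t < T" using T theta_mult_less by simp
    then show "\<exists>T. v T > 0 \<and> \<beta> = exp (theta * T)" using \<beta> T v_pos_downward by (intro exI[of _ t]) auto
  next
    assume "\<exists>T. v T > 0 \<and> \<beta> = exp (theta * T)"
    then obtain T where T: "v T > 0" "\<beta> = exp (theta * T)" by blast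
    have "\<forall>\<^sub>F t in at_right T. v t > 0"
      using order_tendstoD(1)[OF _ T(1), of v "at_right T"] cont_v[of T]
      by (auto simp: isCont_def intro: filterlim_mono[OF _ order_refl at_le])
    then have "\<forall>\<^sub>F t in at_right T. v t > 0 \<and> T < t"
      using eventually_at_right_less by (rule eventually_conj)
    then obtain t where "v t > 0" "T < t" using eventually_happens'[OF trivial_limit_at_right_real] by blast
    then show "\<beta> \<in> beta_dom k p"
      using less_iff T theta_mult_less by (auto simp: beta_dom_def)
  qed
qed

lemmas beta_domD = mem_beta_dom[THEN iffD1]

lemma exp_in_beta_dom: "v T > 0 \<Longrightarrow> exp (theta * T) \<in> beta_dom k p"
  using mem_beta_dom by blast

lemma lam_exp:
  assumes "v T > 0"
  shows "lam k p (exp (theta * T)) = Lam T"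
  unfolding lam_def
proof (rule the_equality)
  show "\<exists>u. solution_at k p (exp (theta * T)) (Lam T) u" using solution_at_exp[OF assms] by blast
  show "l = Lam T" if "\<exists>u. solution_at k p (exp (theta * T)) l u" for l
    using that solution_at_cases theta by fastforce
qed

lemma alpha_exp:
  assumes "v T > 0"
  shows "alpha k p (exp (theta * T)) = 1 / v T - 1"
  unfolding alpha_def
proof (rule the_equality)
  show "\<exists>l u. solution_at k p (exp (theta * T)) l u \<and> 1 / v T - 1 = u 0"
    using solution_at_exp[OF assms] by (intro exI[of _ "Lam T"] exI[of _ "prof T"]) (simp add: prof_def)
  show "a = 1 / v T - 1" if ex: "\<exists>l u. solution_at k p (exp (theta * T)) l u \<and> a = u 0" for a
  proof -
    obtain l u where "solution_at k p (exp (theta * T)) l u" "a = u 0" using ex by blast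
    then show ?thesis using solution_at_cases[of "exp (theta * T)" l u] theta by (auto simp: prof_def)
  qed
qed

lemma well_parameterized: "well_parameterized k p"
proof -
  obtain t where t: "v t > 0" using eventually_happens'[OF trivial_limit_at_bot_linorder v_pos_at_bot] by blast
  then have "exp (theta * t) \<in> beta_dom k p" by (rule exp_in_beta_dom)
  then have "ereal 0 < beta_star k p" by (auto simp: beta_dom_def intro: less_trans[of _ "ereal (exp (theta * t))"])
  moreover have "\<exists>l u. solution_at k p \<beta> l u \<and>
      (\<forall>l' u'. solution_at k p \<beta> l' u' \<longrightarrow> l' = l \<and> (\<forall>r\<in>{0..1}. u' r = u r))" if dom: "\<beta> \<in> beta_dom k p" for \<beta>
  proof -
    obtain T where T: "v T > 0" "\<beta> = exp (theta * T)" using beta_domD[OF dom] by blast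
    have "l' = Lam T \<and> (\<forall>r\<in>{0..1}. u' r = prof T r)" if "solution_at k p \<beta> l' u'" for l' u'
      using solution_at_cases[OF that] T theta by auto
    then show ?thesis using solution_at_exp[OF T(1)] T(2) by blast
  qed
  ultimately show ?thesis
    unfolding well_parameterized_def
    using solution_at_cases exp_in_beta_dom by (metis zero_ereal_def)
qed

lemma lam_eq: "0 < \<beta> \<Longrightarrow> v (ln \<beta> / theta) > 0 \<Longrightarrow> lam k p \<beta> = Lam (ln \<beta> / theta)"
  and alpha_eq: "0 < \<beta> \<Longrightarrow> v (ln \<beta> / theta) > 0 \<Longrightarrow> alpha k p \<beta> = 1 / v (ln \<beta> / theta) - 1"
  using lam_exp[of "ln \<beta> / theta"] alpha_exp[of "ln \<beta> / theta"] theta by auto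

lemma tendsto_lam_alpha:
  assumes time: "filterlim (\<lambda>\<beta>. ln \<beta> / theta) F E" and F: "\<forall>\<^sub>F t in F. v t > 0" and E: "\<forall>\<^sub>F \<beta> in E. 0 < \<beta>"
  shows "filterlim Lam G F \<Longrightarrow> filterlim (lam k p) G E"
    "filterlim (\<lambda>t. 1 / v t - 1) G' F \<Longrightarrow> filterlim (alpha k p) G' E"
proof -
  have ev: "\<forall>\<^sub>F \<beta> in E. 0 < \<beta> \<and> v (ln \<beta> / theta) > 0"
    using E eventually_compose_filterlim[OF F time] by (rule eventually_conj)
  show "filterlim (lam k p) G E" if "filterlim Lam G F"
    using filterlim_compose[OF that time]
    by (rule filterlim_mono_eventually[OF _ order_refl order_refl])
      (use ev in eventually_elim, simp add: lam_eq)
  show "filterlim (alpha k p) G' E" if "filterlim (\<lambda>t. 1 / v t - 1) G' F"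
    using filterlim_compose[OF that time]
    by (rule filterlim_mono_eventually[OF _ order_refl order_refl])
      (use ev in eventually_elim, simp add: alpha_eq)
qed

lemma emanates: "emanates_from_origin k p"
proof -
  have time: "filterlim (\<lambda>\<beta>. ln \<beta> / theta) at_bot (at_right 0)"
    using filterlim_tendsto_pos_mult_at_bot[OF tendsto_const _ ln_at_0, of "1 / theta"] theta by simp
  have "((\<lambda>t. 1 / v t - 1) \<longlongrightarrow> 1 / 1 - 1) at_bot" by (intro tendsto_intros v_at_bot) auto
  then show ?thesis
    unfolding emanates_from_origin_def
    using tendsto_lam_alpha[OF time v_pos_at_bot eventually_at_right_less] Lam_at_bot by auto
qed

lemma converges_toI:
  assumes time: "filterlim (\<lambda>\<beta>. ln \<beta> / theta) F (curve_end k p)" and F: "\<forall>\<^sub>F t in F. v t > 0"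
    and E: "\<forall>\<^sub>F \<beta> in curve_end k p. 0 < \<beta>" and lim: "(Lam \<longlongrightarrow> L) F" "(v \<longlongrightarrow> 0) F"
  shows "converges_to k p L"
proof -
  have "filterlim (\<lambda>t. inverse (v t)) at_top F" using filterlim_inverse_at_top[OF lim(2) F] .
  then have "filterlim (\<lambda>t. - 1 + inverse (v t)) at_top F"
    by (rule filterlim_tendsto_add_at_top[OF tendsto_const])
  then have "filterlim (\<lambda>t. 1 / v t - 1) at_top F" by (simp add: inverse_eq_divide)
  then show ?thesis unfolding converges_to_def using tendsto_lam_alpha[OF time F E] lim by blast
qed

lemma converges_to_global:
  assumes pos: "\<And>t. v t > 0" and lim: "(Lam \<longlongrightarrow> L) at_top"
  shows "converges_to k p L"
proof -
  have less: "ereal \<beta> < beta_star k p" if "\<beta> > 0" for \<beta>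
  proof -
    have "\<beta> \<in> beta_dom k p" using exp_in_beta_dom[OF pos, of "ln \<beta> / theta"] that theta by simp
    then show ?thesis by (simp add: beta_dom_def)
  qed
  have "beta_star k p = \<infinity>"
  proof (rule ereal_top)
    fix B :: real
    show "ereal B \<le> beta_star k p"
      using less[of "max B 1"] by (auto intro: order_trans[OF _ less_imp_le])
  qed
  then have E: "curve_end k p = at_top" by (simp add: curve_end_def)
  show ?thesis
  proof (rule converges_toI)
    show "filterlim (\<lambda>\<beta>. ln \<beta> / theta) at_top (curve_end k p)"
      unfolding E using filterlim_tendsto_pos_mult_at_top[OF tendsto_const _ ln_at_top, of "1 / theta"] theta by simp
    show "\<forall>\<^sub>F \<beta> in curve_end k p. 0 < \<beta>" unfolding E by (rule eventually_gt_at_top)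
  qed (use pos lim v_at_top[OF pos] in auto)
qed

text \<open>The curve ends at \<beta> = \<open>exp (theta * T)\<close> for the zero \<open>T\<close>
  of \<open>v\<close>, and \<alpha> tends to infinity there because \<open>v\<close> tends to 0 from
  above.\<close>

lemma converges_to_finite:
  assumes T: "v T = 0" and lim: "(Lam \<longlongrightarrow> L) (at_left T)"
  shows "converges_to k p L"
proof -
  have pos: "v t > 0 \<longleftrightarrow> t < T" for t
    using v_strict_antimono[of t T] v_strict_antimono[of T t] T by (cases t T rule: linorder_cases) auto
  have dom: "\<beta> \<in> beta_dom k p \<longleftrightarrow> 0 < \<beta> \<and> \<beta> < exp (theta * T)" for \<beta>
  proof
    assume "0 < \<beta> \<and> \<beta> < exp (theta * T)"
    then have "ln \<beta> < theta * T" using ln_less_cancel_iff[of \<beta> "exp (theta * T)"] by simp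
    then have "ln \<beta> / theta < T" using theta by (simp add: pos_divide_less_eq mult.commute)
    then have "exp (theta * (ln \<beta> / theta)) \<in> beta_dom k p" by (intro exp_in_beta_dom) (simp add: pos)
    then show "\<beta> \<in> beta_dom k p" using theta \<open>0 < \<beta> \<and> _\<close> by simp
  next
    assume "\<beta> \<in> beta_dom k p"
    then obtain t where "t < T" "\<beta> = exp (theta * t)" using beta_domD[of \<beta>] pos by blast
    then show "0 < \<beta> \<and> \<beta> < exp (theta * T)" using theta_mult_less by simp
  qed
  have "beta_star k p = ereal (exp (theta * T))"
  proof (rule antisym)
    show "beta_star k p \<le> ereal (exp (theta * T))"
      using dom[of "exp (theta * T)"] by (auto simp: beta_dom_def not_less)
    show "ereal (exp (theta * T)) \<le> beta_star k p"
    proof (rule ccontr)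
      assume "\<not> ?thesis"
      then have "beta_star k p < ereal (exp (theta * T))" by simp
      then obtain z where "beta_star k p < ereal z" "ereal z < ereal (exp (theta * T))"
        using ereal_dense2 by blast
      then have z: "beta_star k p < ereal z" "z < exp (theta * T)" by auto
      have "0 < beta_star k p" using well_parameterized by (simp add: well_parameterized_def)
      then have "0 < z" using z(1) by (metis ereal_less(2) less_trans)
      then have "z \<in> beta_dom k p" using dom z by simp
      then show False using z(1) by (auto simp: beta_dom_def)
    qed
  qed
  then have E: "curve_end k p = at_left (exp (theta * T))" by (simp add: curve_end_def)
  have Epos: "\<forall>\<^sub>F \<beta> in at_left (exp (theta * T)). \<beta> \<in> {0<..<exp (theta * T)}"
    by (rule eventually_at_left_real) simp
  show ?thesis
  proof (rule converges_toI)
    show "filterlim (\<lambda>\<beta>. ln \<beta> / theta) (at_left T) (curve_end k p)"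
      unfolding E filterlim_at
    proof
      have "((\<lambda>\<beta>. ln \<beta> / theta) \<longlongrightarrow> ln (exp (theta * T)) / theta) (at_left (exp (theta * T)))"
        using theta by (intro tendsto_intros) auto
      then show "((\<lambda>\<beta>. ln \<beta> / theta) \<longlongrightarrow> T) (at_left (exp (theta * T)))" using theta by simp
      show "\<forall>\<^sub>F \<beta> in at_left (exp (theta * T)). ln \<beta> / theta \<in> {..<T} \<and> ln \<beta> / theta \<noteq> T"
        using Epos
      proof eventually_elim
        case (elim \<beta>)
        then have "ln \<beta> < theta * T" using ln_less_cancel_iff[of \<beta> "exp (theta * T)"] by simp
        then show ?case using theta by (simp add: field_simps)
      qed
    qed
    show "\<forall>\<^sub>F \<beta> in curve_end k p. 0 < \<beta>" unfolding E using Epos by eventually_elim simp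
    show "\<forall>\<^sub>F t in at_left T. v t > 0" by (simp add: eventually_at_filter pos)
    show "(v \<longlongrightarrow> 0) (at_left T)"
      using cont_v[of T] T by (auto simp: isCont_def intro: filterlim_mono[OF _ order_refl at_le])
  qed (rule lim)
qed

lemma globally_parameterized: "globally_parameterized_by_alpha k p"
proof -
  have inj: "inj_on (alpha k p) (beta_dom k p)"
  proof (rule inj_onI)
    fix b1 b2 assume b: "b1 \<in> beta_dom k p" "b2 \<in> beta_dom k p" "alpha k p b1 = alpha k p b2"
    then obtain s t where st: "v s > 0" "b1 = exp (theta * s)" "v t > 0" "b2 = exp (theta * t)"
      using beta_domD[of b1] beta_domD[of b2] by blast
    then have "v s = v t" using b by (simp add: alpha_exp)
    then have "s = t" using v_strict_antimono by (metis linorder_neqE_linordered_idom order_less_irrefl)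
    then show "b1 = b2" using st by simp
  qed
  show ?thesis
    unfolding globally_parameterized_by_alpha_def bif_curve_def
    by (rule exI[of _ "alpha k p ` beta_dom k p"], rule exI[of _ "\<lambda>a. lam k p (the_inv_into (beta_dom k p) (alpha k p) a)"])
      (auto simp: the_inv_into_f_f[OF inj])
qed

text \<open>The change of parameter is a local homeomorphism, so eventual inequalities transfer in
  both directions.\<close>

lemma local_extremum_lam_iff:
  assumes "v t > 0"
  shows "local_extremum (lam k p) (exp (theta * t)) \<longleftrightarrow> local_extremum Lam t"
proof -
  have ev: "\<forall>\<^sub>F s in nhds t. v s > 0"
    using cont_v[of t] assms by (intro order_tendstoD(1)) (auto simp: isCont_def tendsto_at_iff_tendsto_nhds)
  have to_exp: "filterlim (\<lambda>s. exp (theta * s)) (nhds (exp (theta * t))) (nhds t)"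
    using isCont_exp[of "theta * t"]
    by (intro tendsto_exp tendsto_mult tendsto_const filterlim_ident)
  have from_exp: "filterlim (\<lambda>\<beta>. ln \<beta> / theta) (nhds t) (nhds (exp (theta * t)))"
    using tendsto_divide[OF tendsto_ln[OF filterlim_ident, of "exp (theta * t)"] tendsto_const[of theta]] theta by simp
  have pos: "\<forall>\<^sub>F \<beta> in nhds (exp (theta * t)). 0 < \<beta> \<and> v (ln \<beta> / theta) > 0"
    using eventually_nhds_in_open[of "{0<..}" "exp (theta * t)"] eventually_compose_filterlim[OF ev from_exp]
    by (auto intro: eventually_conj)
  have *: "(\<forall>\<^sub>F \<beta> in nhds (exp (theta * t)). Q (lam k p \<beta>)) \<longleftrightarrow> (\<forall>\<^sub>F s in nhds t. Q (Lam s))" for Q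
  proof
    assume "\<forall>\<^sub>F \<beta> in nhds (exp (theta * t)). Q (lam k p \<beta>)"
    from eventually_compose_filterlim[OF this to_exp] ev
    show "\<forall>\<^sub>F s in nhds t. Q (Lam s)" by eventually_elim (simp add: lam_exp)
  next
    assume "\<forall>\<^sub>F s in nhds t. Q (Lam s)"
    from eventually_compose_filterlim[OF this from_exp] pos
    show "\<forall>\<^sub>F \<beta> in nhds (exp (theta * t)). Q (lam k p \<beta>)" by eventually_elim (simp add: lam_eq)
  qed
  show ?thesis
    unfolding local_extremum_def lam_exp[OF assms]
    using *[of "\<lambda>x. x \<le> Lam t"] *[of "\<lambda>x. Lam t \<le> x"] by simp
qed

section \<open>The three types of diagram\<close>

lemma type_0:
  assumes "theta \<ge> 1 / 2"
  shows "type_0 k p"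
proof -
  obtain t0 where t0: "v t0 > 0" "\<And>t. t < t0 \<Longrightarrow> q t < theta" "\<And>t. t0 < t \<Longrightarrow> v t > 0 \<Longrightarrow> theta < q t"
    using turning_time[OF assms] by auto
  have conv: "converges_to k p 0"
  proof (cases "\<forall>t. v t > 0")
    case True
    then show ?thesis using converges_to_global Lam_at_top_subcritical[OF assms] by blast
  next
    case False
    then obtain T where "v T = 0" using first_zero by metis
    then show ?thesis using converges_to_finite Lam_at_zero by blast
  qed
  have "strict_mono_on {\<beta> \<in> beta_dom k p. \<beta> \<le> exp (theta * t0)} (lam k p)"
  proof (rule strict_mono_onI)
    fix b1 b2 assume b: "b1 \<in> {\<beta> \<in> beta_dom k p. \<beta> \<le> exp (theta * t0)}"
      "b2 \<in> {\<beta> \<in> beta_dom k p. \<beta> \<le> exp (theta * t0)}" "b1 < b2"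
    then obtain s t where st: "v s > 0" "b1 = exp (theta * s)" "v t > 0" "b2 = exp (theta * t)"
      using beta_domD[of b1] beta_domD[of b2] by blast
    then have "s < t" "t \<le> t0" using b theta by auto
    then show "lam k p b1 < lam k p b2" using st t0 by (simp add: lam_exp Lam_strict_mono)
  qed
  moreover have "strict_antimono_on {\<beta> \<in> beta_dom k p. exp (theta * t0) \<le> \<beta>} (lam k p)"
  proof (rule monotone_onI)
    fix b1 b2 assume b: "b1 \<in> {\<beta> \<in> beta_dom k p. exp (theta * t0) \<le> \<beta>}"
      "b2 \<in> {\<beta> \<in> beta_dom k p. exp (theta * t0) \<le> \<beta>}" "b1 < b2"
    then obtain s t where st: "v s > 0" "b1 = exp (theta * s)" "v t > 0" "b2 = exp (theta * t)"
      using beta_domD[of b1] beta_domD[of b2] by blast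
    then have "s < t" "t0 \<le> s" using b theta by auto
    then have "Lam t < Lam s"
      using st t0 v_pos_downward by (intro Lam_strict_antimono) (auto intro: less_imp_le)
    then show "lam k p b1 > lam k p b2" using st by (simp add: lam_exp)
  qed
  moreover have "lam k p (exp (theta * t0)) > 0" using t0 by (simp add: lam_exp Lam_pos)
  moreover have "exp (theta * t0) \<in> beta_dom k p" using t0(1) by (rule exp_in_beta_dom)
  ultimately show ?thesis unfolding type_0_def using emanates conv by blast
qed

lemma converges_supercritical:
  assumes "theta < 1 / 2"
  shows "converges_to k p (theta * (1 - theta))"
proof -
  note pos = v_pos_supercritical[OF assms]
  show ?thesis
    by (rule converges_to_global[OF pos Lam_tendsto[OF pos q_tendsto_supercritical[OF pos assms]]])
qed

lemma type_I:
  assumes th: "theta < 1 / 2" and disc: "(1 - 2 * theta)\<^sup>2 < 4 * k * (1 - theta)"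
  shows "type_I k p"
proof -
  note pos = v_pos_supercritical[OF th]
  let ?X = "\<lambda>t. Lam t - theta * (1 - theta)"
  have X: "\<exists>t>T. ?X t > 0" "\<exists>t>T. ?X t < 0" for T
    using Lam_oscillates[OF th disc, of T] by auto
  obtain b :: "nat \<Rightarrow> real" where b: "strict_mono b" "\<And>n. ?X (b n) * ?X (b (Suc n)) < 0"
    using alternating_signs[of ?X] X by blast
  have "changes_sign_infinitely_often (\<lambda>\<beta>. lam k p \<beta> - theta * (1 - theta)) (beta_dom k p)"
    unfolding changes_sign_infinitely_often_def
  proof (intro exI[of _ "\<lambda>n. exp (theta * b n)"] conjI allI)
    show "strict_mono (\<lambda>n. exp (theta * b n))"
      using b(1) theta by (auto simp: strict_mono_def)
    show "range (\<lambda>n. exp (theta * b n)) \<subseteq> beta_dom k p" using exp_in_beta_dom pos by auto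
    show "(lam k p (exp (theta * b n)) - theta * (1 - theta)) *
        (lam k p (exp (theta * b (Suc n))) - theta * (1 - theta)) < 0" for n
      using b(2)[of n] by (simp add: lam_exp pos)
  qed
  moreover have "infinite (turning_points k p)"
  proof
    assume fin: "finite (turning_points k p)"
    \<comment> \<open>Turning points are points of the plane, so finiteness is first carried over to
      extremal times; the second coordinate, injective in time, permits this. Local maxima beyond
      every bound then contradict it.\<close>
    define S where "S = {t. local_extremum Lam t}"
    have "(\<lambda>t. (Lam t, 1 / v t - 1)) ` S \<subseteq> turning_points k p"
    proof clarify
      fix t assume "t \<in> S"
      then have "local_extremum (lam k p) (exp (theta * t))"
        using local_extremum_lam_iff[OF pos] by (simp add: S_def)
      moreover have "exp (theta * t) \<in> beta_dom k p" using pos by (rule exp_in_beta_dom)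
      ultimately have "(lam k p (exp (theta * t)), alpha k p (exp (theta * t))) \<in> turning_points k p"
        unfolding turning_points_def by blast
      then show "(Lam t, 1 / v t - 1) \<in> turning_points k p" by (simp add: lam_exp alpha_exp pos)
    qed
    moreover have "inj_on (\<lambda>t. (Lam t, 1 / v t - 1)) S"
      by (intro inj_onI) (metis v_strict_antimono Pair_inject diff_add_cancel linorder_neqE_linordered_idom
          order_less_irrefl divide_eq_eq_1 nonzero_eq_divide_eq one_divide_eq_0_iff inverse_eq_divide inverse_inverse_eq)
    ultimately have "finite S" using fin finite_subset inj_on_finite by metis
    then obtain M where M: "\<And>t. t \<in> S \<Longrightarrow> t \<le> M"
      using bdd_above_finite[of S] unfolding bdd_above_def by blast
    have "continuous_on UNIV ?X"
      using cont_Lam[OF pos] by (auto intro!: continuous_at_imp_continuous_on continuous_intros)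
    then obtain t where t: "t > M" "\<forall>\<^sub>F s in nhds t. ?X s \<le> ?X t"
      using oscillation_local_max[of ?X M] X by blast
    then have "t \<in> S" by (simp add: S_def local_extremum_def)
    then show False using M t by force
  qed
  ultimately show ?thesis
    unfolding type_I_def using emanates theta_sq converges_supercritical[OF th] by blast
qed

lemma type_II:
  assumes th: "theta < 1 / 2" and disc: "4 * k * (1 - theta) \<le> (1 - 2 * theta)\<^sup>2"
  shows "type_II k p"
proof -
  note pos = v_pos_supercritical[OF th]
  have mono: "Lam s < Lam t" if "s < t" for s t
    using Lam_strict_mono[OF that pos] q_less_theta[OF th disc] by blast
  have "mono_on (beta_dom k p) (lam k p)"
  proof (rule mono_onI)
    fix b1 b2 assume b: "b1 \<in> beta_dom k p" "b2 \<in> beta_dom k p" "b1 \<le> b2"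
    then obtain s t where st: "b1 = exp (theta * s)" "b2 = exp (theta * t)"
      using beta_domD[of b1] beta_domD[of b2] by blast
    then have "s \<le> t" using b theta by simp
    then show "lam k p b1 \<le> lam k p b2"
      using st mono[of s t] by (cases "s = t") (auto simp: lam_exp pos)
  qed
  moreover have "turning_points k p = {}"
  proof (rule ccontr)
    assume "turning_points k p \<noteq> {}"
    then obtain \<beta> where \<beta>: "\<beta> \<in> beta_dom k p" "local_extremum (lam k p) \<beta>"
      unfolding turning_points_def by auto
    obtain t where "local_extremum Lam t"
      using beta_domD[OF \<beta>(1)] \<beta>(2) local_extremum_lam_iff by metis
    then obtain d where d: "d > 0" "(\<forall>s. dist s t < d \<longrightarrow> Lam s \<le> Lam t) \<or> (\<forall>s. dist s t < d \<longrightarrow> Lam t \<le> Lam s)"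
      unfolding local_extremum_def eventually_nhds_metric by blast
    have "dist (t + d / 2) t < d" "dist (t - d / 2) t < d" using d(1) by (auto simp: dist_real_def)
    with d(2) have "Lam (t + d / 2) \<le> Lam t \<or> Lam t \<le> Lam (t - d / 2)" by blast
    then show False using mono[of t "t + d / 2"] mono[of "t - d / 2" t] d(1) by auto
  qed
  ultimately show ?thesis
    unfolding type_II_def using emanates theta_sq converges_supercritical[OF th] by blast
qed

end

section \<open>Existence of the orbit and the critical exponents\<close>

lemma singular_orbit_exists:
  assumes "k > 0" "p > k + 1"
  obtains v w where "singular_orbit k p v w"
proof -
  have p: "1 \<le> p" "0 \<le> p" using assms by auto
  show ?thesis
    by (rule singular_ivp_exists[OF assms(1) cut_pow_lipschitz[OF p(1)] cut_pow_bounds[OF p(2)]])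
      (rule that, unfold_locales, use assms in auto)
qed

text \<open>As a quadratic in \<open>2 * th\<close> the discriminant is
  \<open>(1 - 2 * th - k)\<^sup>2 - k * (k + 2)\<close>, which is where the square root in
  \<open>p_JL\<close> comes from.\<close>

lemma disc_iff:
  fixes k th :: real
  assumes "k > 0"
  shows "4 * k * (1 - th) \<le> (1 - 2 * th)\<^sup>2 \<longleftrightarrow> sqrt (k * (k + 2)) \<le> \<bar>1 - 2 * th - k\<bar>"
proof -
  have "(1 - 2 * th - k)\<^sup>2 - k * (k + 2) = (1 - 2 * th)\<^sup>2 - 4 * k * (1 - th)"
    by (simp add: power2_eq_square algebra_simps)
  then have "4 * k * (1 - th) \<le> (1 - 2 * th)\<^sup>2 \<longleftrightarrow> k * (k + 2) \<le> (1 - 2 * th - k)\<^sup>2" by linarith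
  also have "\<dots> \<longleftrightarrow> sqrt (k * (k + 2)) \<le> sqrt ((1 - 2 * th - k)\<^sup>2)" by (rule real_sqrt_le_iff[symmetric])
  finally show ?thesis by simp
qed

text \<open>The threshold 1/4 comes from
  \<open>k * (k + 2) - (1 - k)\<^sup>2 = 4 * k - 1\<close>.\<close>

lemma JL_denominator_pos:
  fixes k :: real
  assumes "k > 0"
  shows "1 - k - sqrt (k * (k + 2)) > 0 \<longleftrightarrow> k < 1 / 4"
proof -
  have sq: "k * (k + 2) - (1 - k)\<^sup>2 = 4 * k - 1" by (simp add: power2_eq_square algebra_simps)
  show ?thesis
  proof
    assume "1 - k - sqrt (k * (k + 2)) > 0"
    then have "sqrt (k * (k + 2)) < 1 - k" by simp
    moreover have "sqrt (k * (k + 2)) \<ge> 0" using assms by simp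
    ultimately have "(sqrt (k * (k + 2)))\<^sup>2 < (1 - k)\<^sup>2" by (intro power_strict_mono) auto
    then show "k < 1 / 4" using sq assms by simp
  next
    assume "k < 1 / 4"
    then have "sqrt (k * (k + 2)) < 1 - k" using sq by (intro real_less_lsqrt) auto
    then show "1 - k - sqrt (k * (k + 2)) > 0" by simp
  qed
qed

text \<open>One inequality covers both branches of \<open>p_JL\<close>: for
  \<open>k \<ge> 1 / 4\<close> the right-hand side is nonpositive, so no \<open>p\<close> satisfies
  it.\<close>

lemma p_JL_le_iff:
  fixes k p :: real
  assumes k: "k > 0" and p: "p > 1"
  shows "p_JL k \<le> ereal p \<longleftrightarrow> 2 * (k / (p - 1)) \<le> 1 - k - sqrt (k * (k + 2))"
proof (cases "k < 1 / 4")
  case True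
  then have m: "1 - k - sqrt (k * (k + 2)) > 0" using JL_denominator_pos k by simp
  have "p_JL k \<le> ereal p \<longleftrightarrow> 2 * k / (1 - k - sqrt (k * (k + 2))) \<le> p - 1"
    using True by (auto simp: p_JL_def)
  also have "\<dots> \<longleftrightarrow> 2 * (k / (p - 1)) \<le> 1 - k - sqrt (k * (k + 2))"
    using m p by (simp add: pos_divide_le_eq mult.commute)
  finally show ?thesis .
next
  case False
  then have "1 - k - sqrt (k * (k + 2)) \<le> 0" using JL_denominator_pos[OF k] by linarith
  moreover have "2 * (k / (p - 1)) > 0" using k p by simp
  ultimately show ?thesis using False by (simp add: p_JL_def)
qed

text \<open>The denominator in \<open>p_JL\<close> lies strictly between 0 and 1, so the quotient
  exceeds \<open>2 * k\<close>. Hence the range of type II is supercritical.\<close>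

lemma p_JL_gt_p_c:
  fixes k p :: real
  assumes k: "k > 0" and le: "p_JL k \<le> ereal p"
  shows "p > 2 * k + 1"
proof -
  have k4: "k < 1 / 4" using le by (auto simp: p_JL_def split: if_splits)
  have "0 \<le> sqrt (k * (k + 2))" using k by simp
  then have m: "0 < 1 - k - sqrt (k * (k + 2))" "1 - k - sqrt (k * (k + 2)) < 1"
    using JL_denominator_pos[OF k] k k4 by linarith+
  have "2 * k < 2 * k / (1 - k - sqrt (k * (k + 2)))"
    using m k by (simp add: pos_less_divide_eq)
  also have "\<dots> \<le> p - 1" using le k4 by (simp add: p_JL_def)
  finally show ?thesis by simp
qed

theorem theorem1p6:
  fixes k p :: real
  assumes "k > 0"
  shows "(p_s k < p \<longrightarrow> well_parameterized k p) \<and>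
    (p_s k < p \<and> p \<le> p_c k \<longrightarrow> type_0 k p) \<and>
    (p_c k < p \<and> ereal p < p_JL k \<longrightarrow> type_I k p) \<and>
    (p_JL k \<le> ereal p \<longrightarrow> type_II k p) \<and>
    ((p_s k < p \<and> p \<le> p_c k) \<or> p_JL k \<le> ereal p \<longrightarrow> globally_parameterized_by_alpha k p)"
proof (cases "p_s k < p")
  case True
  then have p: "p > k + 1" by (simp add: p_s_def)
  obtain v w where "singular_orbit k p v w" using singular_orbit_exists[OF assms p] by blast
  then interpret singular_orbit k p v w .
  define S where "S = sqrt (k * (k + 2))"
  have S: "S > k" unfolding S_def using assms by (intro real_less_rsqrt) (simp add: power2_eq_square algebra_simps)
  have th_c: "theta < 1 / 2 \<longleftrightarrow> p > p_c k"
    using p_gt_1 by (auto simp: theta_def p_c_def field_simps)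
  have JL: "p_JL k \<le> ereal p \<longleftrightarrow> 2 * theta \<le> 1 - k - S"
    unfolding theta_def S_def by (rule p_JL_le_iff[OF assms p_gt_1])
  have "type_I k p" if "p_c k < p" "ereal p < p_JL k"
  proof (rule type_I)
    show th: "theta < 1 / 2" using that th_c by simp
    have "\<not> p_JL k \<le> ereal p" using that by (simp add: not_le)
    then have "\<not> 2 * theta \<le> 1 - k - S" using JL by blast
    \<comment> \<open>The other root does not matter: \<open>1 - 2 * theta - k \<le> - S\<close>
      together with \<open>S > k\<close> would give \<open>2 * theta > 1\<close>.\<close>
    then have "\<not> S \<le> \<bar>1 - 2 * theta - k\<bar>" using S th by linarith
    then show "(1 - 2 * theta)\<^sup>2 < 4 * k * (1 - theta)"
      using disc_iff[OF assms, of theta] by (simp add: S_def not_le)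
  qed
  moreover have "type_II k p" if "p_JL k \<le> ereal p"
  proof (rule type_II)
    show "theta < 1 / 2" using p_JL_gt_p_c[OF assms that] th_c by (simp add: p_c_def)
    have "S \<le> \<bar>1 - 2 * theta - k\<bar>" using that JL by simp
    then show "4 * k * (1 - theta) \<le> (1 - 2 * theta)\<^sup>2"
      using disc_iff[OF assms, of theta] by (simp add: S_def)
  qed
  moreover have "type_0 k p" if "p \<le> p_c k" using type_0 th_c that by (simp add: not_less)
  ultimately show ?thesis using well_parameterized globally_parameterized by blast
next
  case False
  \<comment> \<open>For \<open>p \<le> p_s k\<close> every premise fails, as
    \<open>p_s k < p_c k\<close> and \<open>p_JL k\<close> lies above \<open>p_c k\<close>.\<close>
  then have "\<not> p_c k < p" "\<not> p_JL k \<le> ereal p"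
    using p_JL_gt_p_c[OF assms, of p] assms by (auto simp: p_s_def p_c_def)
  with False show ?thesis by blast
qed

end
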